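(* Let $u_0\in H$, $T>0$, and let $f(x,t)$ be an entire function with respect to the spatial variable $x$ such that for every $M\ge 0$ we have $\int_0^T |e^{M\sigma A^{1/2}}f(s)|^2\,ds<\infty$. Let $u(t)$ be the solution on $[0,T]$ of $$\frac{du}{dt}+\mu e^{2\sigma A^{1/2}}u+B(u,u)=f,\qquad u(0)=u_0 .$$ Then $u(t)$ is an entire function with respect to the spatial variable for all $t\in(0,T]$. Moreover, for any $n=1,2,\ldots$ there exist constants $C_n,\bar C_n,K_n,\bar K_n$, which depend on $|u_0|,\mu,T,\sigma$ and on $\int_0^T |e^{(n-1)\sigma A^{1/2}}f(s)|^2\,ds$, and integers $p_n,q_n\ge1$, such that for all $t\in(0,T]$ $$|e^{n\sigma A^{1/2}}u(t)|^2\le \frac{K_n}{t^{p_n}}+C_n\qquad\text{and}\qquad \int_t^T |e^{(n+1)\sigma A^{1/2}}u(s)|^2\,ds\le \frac{\bar K_n}{t^{q_n}}+\bar C_n .$$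
   Context: Let $\Omega=[0,2\pi]^3$ with periodic boundary conditions, and let $\mu>0$, $\sigma>0$ be fixed. For a space-periodic function or vector field $g$, $|g|=\left(\int_\Omega |g(x)|^2dx\right)^{1/2}$ is the $L^2$ norm. $H=\{\varphi\in (L^2(\Omega))^3:\ \varphi \text{ periodic},\ \int_\Omega\varphi\,dx=0,\ \nabla\cdot\varphi=0\}$. $A=-\nabla^2$; for real $\lambda$, $e^{\lambda A^{1/2}}$ is the operator with Fourier symbol $e^{\lambda|k|}$, $k\in\mathbb Z^3\setminus\{0\}$. $B(u,u)=P\big((u\cdot\nabla)u\big)$, where $P$ is the Leray ($L^2$-orthogonal) projector onto mean-zero divergence-free periodic fields; thus the equation is the abstract form of the 3D periodic incompressible Navier–Stokes equations $\partial_t u+u\cdot\nabla u=-\nabla p-\mu\mathcal D u+f$, $\nabla\cdot u=0$, where $\mathcal D$ has Fourier symbol $e^{2\sigma|k|}$. The forcing $f(\cdot,t)$ is a $2\pi$-periodic, mean-zero, divergence-free vector field. "Solution" means the weak solution with $u\in C([0,T];H)$ and $e^{\sigma A^{1/2}}u\in L^2(0,T;H)$, obtained e.g. as the limit of Galerkin approximations. "Entire with respect to the spatial variable" means that the function of $x\in\mathbb R^3$ extends to a holomorphic function on $\mathbb C^3$. *)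

theory Defs
  imports "HOL-Analysis.Analysis"
begin

text \<open>
  Space-periodic fields are functions on \<open>\<real>\<^sup>3\<close>.  Elements of \<open>L\<^sup>2\<close> are represented by functions, not
  by classes modulo null sets; a choice operator below selects one member of such a class, and only
  quantities that do not depend on the member (integrals, norms) are ever formed from it.
\<close>

definition periodic :: "(real^3 \<Rightarrow> 'b) \<Rightarrow> bool" where
  "periodic g \<longleftrightarrow> (\<forall>x j. g (x + axis j (2 * pi)) = g x)"

definition Omega :: "(real^3) set" where
  "Omega = cbox 0 (\<chi> i. 2 * pi)"

definition L2_per :: "(real^3 \<Rightarrow> real^3) set" where
  "L2_per = {g. periodic g \<and> g \<in> borel_measurable lebesgue \<and>
                integrable (lebesgue_on Omega) (\<lambda>x. (norm (g x))\<^sup>2)}"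

definition L2_inner :: "(real^3 \<Rightarrow> real^3) \<Rightarrow> (real^3 \<Rightarrow> real^3) \<Rightarrow> real" where
  "L2_inner g h = (LINT x|lebesgue_on Omega. g x \<bullet> h x)"

definition L2_norm :: "(real^3 \<Rightarrow> real^3) \<Rightarrow> real" where
  "L2_norm g = sqrt (LINT x|lebesgue_on Omega. (norm (g x))\<^sup>2)"

text \<open>Periodic scalar test functions of class \<open>C\<^sup>1\<close>, together with their gradient.\<close>

definition test_fun :: "(real^3 \<Rightarrow> real) \<Rightarrow> (real^3 \<Rightarrow> real^3) \<Rightarrow> bool" where
  "test_fun \<phi> G \<longleftrightarrow> periodic \<phi> \<and> (\<forall>x. GDERIV \<phi> x :> G x) \<and> continuous_on UNIV G"

text \<open>The divergence of an \<open>L\<^sup>2\<close> field is taken in the sense of distributions.\<close>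

definition div_free :: "(real^3 \<Rightarrow> real^3) \<Rightarrow> bool" where
  "div_free g \<longleftrightarrow> (\<forall>\<phi> G. test_fun \<phi> G \<longrightarrow> (LINT x|lebesgue_on Omega. g x \<bullet> G x) = 0)"

definition H :: "(real^3 \<Rightarrow> real^3) set" where
  "H = {g \<in> L2_per. (LINT x|lebesgue_on Omega. g x) = 0 \<and> div_free g}"

definition wavevec :: "int^3 \<Rightarrow> real^3" where
  "wavevec k = (\<chi> i. real_of_int (k $ i))"

definition fourier_coeff :: "(real^3 \<Rightarrow> real^3) \<Rightarrow> int^3 \<Rightarrow> complex^3" where
  "fourier_coeff g k =
     (\<chi> i. (LINT x|lebesgue_on Omega. complex_of_real (g x $ i) * cis (- (wavevec k \<bullet> x)))
            / complex_of_real ((2 * pi) ^ 3))"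

text \<open>
  The operator \<open>e\<^bsup>rA^(1/2)\<^esup>\<close> on \<open>H\<close>, with Fourier symbol \<open>e\<^bsup>r|k|\<^esup>\<close>.  It is unbounded for \<open>r > 0\<close>;
  \<open>expA r g\<close> is meaningful only for \<open>g\<close> in \<open>dom_expA r\<close>.
\<close>

definition is_expA :: "real \<Rightarrow> (real^3 \<Rightarrow> real^3) \<Rightarrow> (real^3 \<Rightarrow> real^3) \<Rightarrow> bool" where
  "is_expA r g w \<longleftrightarrow> w \<in> H \<and>
     (\<forall>k. fourier_coeff w k = exp (r * norm (wavevec k)) *\<^sub>R fourier_coeff g k)"

definition dom_expA :: "real \<Rightarrow> (real^3 \<Rightarrow> real^3) set" where
  "dom_expA r = {g \<in> H. \<exists>w. is_expA r g w}"

definition expA :: "real \<Rightarrow> (real^3 \<Rightarrow> real^3) \<Rightarrow> real^3 \<Rightarrow> real^3" where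
  "expA r g = (SOME w. is_expA r g w)"

text \<open>Weak partial derivative in direction \<open>j\<close>.\<close>

definition is_weak_deriv :: "3 \<Rightarrow> (real^3 \<Rightarrow> real^3) \<Rightarrow> (real^3 \<Rightarrow> real^3) \<Rightarrow> bool" where
  "is_weak_deriv j g w \<longleftrightarrow> w \<in> L2_per \<and>
     (\<forall>\<phi> G. test_fun \<phi> G \<longrightarrow>
        (LINT x|lebesgue_on Omega. (G x $ j) *\<^sub>R g x) = - (LINT x|lebesgue_on Omega. \<phi> x *\<^sub>R w x))"

definition weak_deriv :: "3 \<Rightarrow> (real^3 \<Rightarrow> real^3) \<Rightarrow> real^3 \<Rightarrow> real^3" where
  "weak_deriv j g = (SOME w. is_weak_deriv j g w)"

text \<open>\<open>(u \<cdot> \<nabla>) w\<close>\<close>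

definition convect :: "(real^3 \<Rightarrow> real^3) \<Rightarrow> (real^3 \<Rightarrow> real^3) \<Rightarrow> real^3 \<Rightarrow> real^3" where
  "convect u w x = (\<Sum>j\<in>UNIV. (u x $ j) *\<^sub>R weak_deriv j w x)"

text \<open>The Leray projector: \<open>L\<^sup>2\<close>-orthogonal projection onto \<open>H\<close>.\<close>

definition leray :: "(real^3 \<Rightarrow> real^3) \<Rightarrow> real^3 \<Rightarrow> real^3" where
  "leray g = (SOME w. w \<in> H \<and> (\<forall>v\<in>H. L2_inner (\<lambda>x. g x - w x) v = 0))"

definition B :: "(real^3 \<Rightarrow> real^3) \<Rightarrow> (real^3 \<Rightarrow> real^3) \<Rightarrow> real^3 \<Rightarrow> real^3" where
  "B u w = leray (convect u w)"

text \<open>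
  \<open>L\<^sup>2(I; H)\<close> for an interval \<open>I\<close> of times.  Measurability of an \<open>H\<close>-valued map is stated weakly;
  as \<open>H\<close> is separable this is the same as strong measurability.
\<close>

definition L2_time :: "real set \<Rightarrow> (real \<Rightarrow> real^3 \<Rightarrow> real^3) \<Rightarrow> bool" where
  "L2_time I g \<longleftrightarrow>
     (AE s in lebesgue_on I. g s \<in> H) \<and>
     (\<forall>v\<in>H. (\<lambda>s. L2_inner (g s) v) \<in> borel_measurable (lebesgue_on I)) \<and>
     integrable (lebesgue_on I) (\<lambda>s. (L2_norm (g s))\<^sup>2)"

text \<open>\<open>e\<^bsup>rA^(1/2)\<^esup> g\<close> is defined for almost every time and belongs to \<open>L\<^sup>2(I; H)\<close>.\<close>

definition expA_L2_time :: "real set \<Rightarrow> real \<Rightarrow> (real \<Rightarrow> real^3 \<Rightarrow> real^3) \<Rightarrow> bool" where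
  "expA_L2_time I r g \<longleftrightarrow>
     (AE s in lebesgue_on I. g s \<in> dom_expA r) \<and> L2_time I (\<lambda>s. expA r (g s))"

definition continuous_into_H :: "real \<Rightarrow> (real \<Rightarrow> real^3 \<Rightarrow> real^3) \<Rightarrow> bool" where
  "continuous_into_H T u \<longleftrightarrow>
     (\<forall>t\<in>{0..T}. u t \<in> H \<and>
        ((\<lambda>s. L2_norm (\<lambda>x. u s x - u t x)) \<longlongrightarrow> 0) (at t within {0..T}))"

text \<open>
  Weak solutions of \<open>du/dt + \<mu> e\<^bsup>2\<sigma>A^(1/2)\<^esup> u + B(u,u) = f\<close>, \<open>u(0) = u0\<close> on \<open>[0,T]\<close>: the equation is
  tested with every \<open>v\<close> in the form domain \<open>V\<close> of \<open>e\<^bsup>2\<sigma>A^(1/2)\<^esup>\<close>, that is \<open>V = dom_expA \<sigma>\<close>, and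
  integrated in time.  The pairing of \<open>e\<^bsup>2\<sigma>A^(1/2)\<^esup> u\<close> with \<open>v\<close> is the \<open>L\<^sup>2\<close> inner product of
  \<open>e\<^bsup>\<sigma>A^(1/2)\<^esup> u\<close> and \<open>e\<^bsup>\<sigma>A^(1/2)\<^esup> v\<close>.
\<close>

definition weak_solution ::
  "real \<Rightarrow> real \<Rightarrow> real \<Rightarrow> (real^3 \<Rightarrow> real^3) \<Rightarrow> (real \<Rightarrow> real^3 \<Rightarrow> real^3) \<Rightarrow>
   (real \<Rightarrow> real^3 \<Rightarrow> real^3) \<Rightarrow> bool" where
  "weak_solution \<mu> \<sigma> T u0 f u \<longleftrightarrow>
     continuous_into_H T u \<and>
     expA_L2_time {0..T} \<sigma> u \<and>
     (AE x in lebesgue. u 0 x = u0 x) \<and>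
     (\<forall>v\<in>dom_expA \<sigma>.
        integrable (lebesgue_on {0..T}) (\<lambda>s. L2_inner (expA \<sigma> (u s)) (expA \<sigma> v)) \<and>
        integrable (lebesgue_on {0..T}) (\<lambda>s. L2_inner (B (u s) (u s)) v) \<and>
        integrable (lebesgue_on {0..T}) (\<lambda>s. L2_inner (f s) v) \<and>
        (\<forall>t\<in>{0..T}.
           L2_inner (u t) v
             + \<mu> * (LINT s|lebesgue_on {0..t}. L2_inner (expA \<sigma> (u s)) (expA \<sigma> v))
             + (LINT s|lebesgue_on {0..t}. L2_inner (B (u s) (u s)) v)
           = L2_inner u0 v + (LINT s|lebesgue_on {0..t}. L2_inner (f s) v)))"

text \<open>Holomorphy on \<open>\<complex>\<^sup>3\<close>: the real Frechet derivative exists everywhere and is complex linear.\<close>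

definition holomorphic_C3 :: "(complex^3 \<Rightarrow> complex^3) \<Rightarrow> bool" where
  "holomorphic_C3 F \<longleftrightarrow>
     (\<forall>z. \<exists>D. (F has_derivative D) (at z) \<and> (\<forall>c h. D (c *s h) = c *s D h))"

definition cvec :: "real^3 \<Rightarrow> complex^3" where
  "cvec x = (\<chi> i. complex_of_real (x $ i))"

text \<open>A field, as an element of \<open>L\<^sup>2\<close>, is entire if it agrees almost everywhere with the restriction
  to \<open>\<real>\<^sup>3\<close> of a holomorphic map on \<open>\<complex>\<^sup>3\<close>.\<close>

definition entire_field :: "(real^3 \<Rightarrow> real^3) \<Rightarrow> bool" where
  "entire_field g \<longleftrightarrow>
     (\<exists>F. holomorphic_C3 F \<and> (AE x in lebesgue. F (cvec x) = cvec (g x)))"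

definition entire_forcing :: "real \<Rightarrow> real \<Rightarrow> (real \<Rightarrow> real^3 \<Rightarrow> real^3) \<Rightarrow> bool" where
  "entire_forcing \<sigma> T f \<longleftrightarrow>
     (\<forall>t\<in>{0..T}. f t \<in> H \<and> entire_field (f t)) \<and>
     (\<forall>M\<ge>0. expA_L2_time {0..T} (M * \<sigma>) f)"

end

theory Submission
  imports Defs
begin

text \<open>
  For a solution \<open>u\<close> let \<open>\<phi>\<^sub>r(t) = \<Sum>\<^sub>k e\<^bsup>2r|k|\<^esup> |u\<^sub>k(t)|\<^sup>2\<close>, where \<open>u\<^sub>k\<close> are the Fourier coefficients; up to the
  volume of the torus this is \<open>|e\<^bsup>rA^(1/2)\<^esup> u(t)|\<^sup>2\<close>.  The dissipation has symbol \<open>e\<^bsup>2\<sigma>|k|\<^esup>\<close>, so the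
  energy balance at level \<open>r\<close> controls the time integral of \<open>\<phi>\<^bsub>r+\<sigma>\<^esub>\<close>: every turn of the argument gains a
  full exponential factor.  The quadratic term loses much less.  As \<open>e\<^bsup>r|k|\<^esup> \<le> e\<^bsup>r|l|\<^esup> e\<^bsup>r|k-l|\<^esup>\<close>, the
  coefficients of the products \<open>u\<^sub>i u\<^sub>j\<close> are at most \<open>e\<^bsup>-r|k|\<^esup> \<phi>\<^sub>r\<close>, and since \<open>u\<close> is divergence free the
  convection term is a divergence of such products; hence \<open>|B\<^sub>k| \<le> 9 |k| e\<^bsup>-r|k|\<^esup> \<phi>\<^sub>r\<close>
  (\<open>norm_fourier_coeff_convection\<close>).  Take \<open>r = n\<sigma> + \<sigma>/2\<close> and use \<open>\<phi>\<^sub>r\<^sup>2 \<le> \<phi>\<^bsub>n\<sigma>\<^esub> \<phi>\<^bsub>(n+1)\<sigma>\<^esub>\<close>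
  (\<open>gevrey_Cauchy_Schwarz\<close>): the spare half of \<open>\<sigma>\<close> makes the sum over \<open>k\<close> converge, and Young's inequality
  turns the energy balance into
  \<open>d/dt \<phi>\<^bsub>(n+1)\<sigma>\<^esub> + \<mu> \<phi>\<^bsub>(n+2)\<sigma>\<^esub> \<le> (2/\<mu>) (S \<phi>\<^bsub>n\<sigma>\<^esub> \<phi>\<^bsub>(n+1)\<sigma>\<^esub> + \<psi>\<^bsub>n\<sigma>\<^esub>)\<close>
  with \<open>S = 81 \<Sum>\<^sub>k |k|\<^sup>2 e\<^bsup>-\<sigma>|k|\<^esup>\<close> and with \<open>\<psi>\<close> formed from \<open>f\<close> as \<open>\<phi>\<close> is from \<open>u\<close> (\<open>energy_step\<close>).

  The right-hand side only contains quantities bounded at the previous level.  If \<open>\<phi>\<^bsub>n\<sigma>\<^esub>(t)\<close> and the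
  integral of \<open>\<phi>\<^bsub>(n+1)\<sigma>\<^esub>\<close> over \<open>[t,T]\<close> are at most \<open>D / t\<^sup>p\<close>, its integral over \<open>[t/2,T]\<close> is at most a multiple
  of \<open>t\<^bsup>-2p\<^esup>\<close>.  Starting at a time in \<open>[t/2,t]\<close> at which \<open>\<phi>\<^bsub>(n+1)\<sigma>\<^esub>\<close> exceeds its mean by at most 1, one
  integration gives the same two bounds at the next level with \<open>2p\<close> in place of \<open>p\<close> (\<open>step_bound\<close>);
  no exponential of a power of \<open>1/t\<close> ever enters, and \<open>p\<close> depends on \<open>n\<close> alone.  The induction
  (\<open>gevrey_bounds\<close>) starts from the energy inequality \<open>base_inequality\<close>, where the quadratic term
  drops out because \<open>u\<close> is orthogonal to \<open>(u \<cdot> \<nabla>) u\<close>.  Once \<open>\<phi>\<^sub>r(t)\<close> is finite for all \<open>r\<close>, the Fourier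
  series of \<open>u(t)\<close> converges locally uniformly on \<open>\<complex>\<^sup>3\<close> and defines an entire function.

  The formal computation is made rigorous as follows.  Testing the equation with a single trigonometric field
  yields an integral equation for each Fourier coefficient (\<open>weak_form\<close>); a finite sum of modes is then
  absolutely continuous in time, satisfies the energy balance exactly (\<open>mode_identity\<close>), and monotone
  convergence removes the truncation (\<open>energy_limit\<close>).  In space, a square integrable field is
  determined almost everywhere by its Fourier coefficients (\<open>fourier_uniqueness\<close>), so the fields that
  the definitions of the operator, the weak derivative and the projector pick from an equivalence class are
  all controlled through their Fourier coefficients.
\<close>

no_notation Infinite_Set_Sum.abs_summable_on (infix \<open>abs'_summable'_on\<close> 50)

section \<open>The torus and its Fourier modes\<close>

abbreviation torus :: "(real^3) measure" where
  "torus \<equiv> lebesgue_on Omega"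

definition fmode :: "int^3 \<Rightarrow> real^3 \<Rightarrow> complex" where
  "fmode k x = cis (wavevec k \<bullet> x)"

definition scoeff :: "(real^3 \<Rightarrow> complex) \<Rightarrow> int^3 \<Rightarrow> complex" where
  "scoeff g k = (LINT x|torus. g x * fmode (- k) x) / complex_of_real ((2 * pi) ^ 3)"

abbreviation wn :: "int^3 \<Rightarrow> real" where
  "wn k \<equiv> norm (wavevec k)"

lemma wavevec_minus [simp]: "wavevec (- k) = - wavevec k"
  by (simp add: wavevec_def vec_eq_iff)

lemma wavevec_add: "wavevec (k + l) = wavevec k + wavevec l"
  by (simp add: wavevec_def vec_eq_iff)

lemma wavevec_diff: "wavevec (k - l) = wavevec k - wavevec l"
  by (simp add: wavevec_def vec_eq_iff)

lemma wavevec_0 [simp]: "wavevec 0 = 0"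
  by (simp add: wavevec_def vec_eq_iff)

lemma wavevec_nth [simp]: "wavevec k $ i = real_of_int (k $ i)"
  by (simp add: wavevec_def)

lemma wavevec_eq_0_iff [simp]: "wavevec k = 0 \<longleftrightarrow> k = 0"
  by (simp add: vec_eq_iff)

lemma norm_fmode [simp]: "norm (fmode k x) = 1"
  by (simp add: fmode_def)

lemma fmode_0 [simp]: "fmode 0 x = 1"
  by (simp add: fmode_def)

lemma fmode_add: "fmode (k + l) x = fmode k x * fmode l x"
  by (simp add: fmode_def wavevec_add inner_add_left cis_mult)

lemma cnj_fmode: "cnj (fmode k x) = fmode (- k) x"
  by (simp add: fmode_def cis_cnj)

lemma fmode_shift: "fmode k (x + y) = fmode k x * cis (wavevec k \<bullet> y)"
  by (simp add: fmode_def inner_add_right cis_mult)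

lemma fmode_continuous [continuous_intros]: "continuous_on S (fmode k)"
  unfolding fmode_def by (intro continuous_intros)

lemma fmode_measurable [measurable]: "fmode k \<in> borel_measurable borel"
  by (rule borel_measurable_continuous_onI) (rule fmode_continuous)

lemma periodic_fmode: "periodic (fmode k)"
proof -
  have "cis (real_of_int m * (2 * pi)) = 1" for m
    using cis_multiple_2pi[of "real_of_int m"] by (simp add: algebra_simps)
  then show ?thesis
    by (simp add: periodic_def fmode_shift inner_axis)
qed

lemma fourier_coeff_nth: "fourier_coeff g k $ i = scoeff (\<lambda>x. complex_of_real (g x $ i)) k"
  by (simp add: fourier_coeff_def scoeff_def fmode_def)

lemma Omega_sets [simp, measurable]: "Omega \<in> sets lebesgue"
  by (simp add: Omega_def)

lemma compact_Omega: "compact Omega"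
  by (simp add: Omega_def)

lemma mem_Omega: "x \<in> Omega \<longleftrightarrow> (\<forall>i. 0 \<le> x $ i \<and> x $ i \<le> 2 * pi)"
  by (simp add: Omega_def mem_box_cart)

lemma emeasure_torus: "emeasure torus Omega = ennreal ((2 * pi) ^ 3)"
proof -
  have "emeasure lebesgue Omega = emeasure lborel Omega"
    by (simp add: Omega_def emeasure_lborel_cbox_eq[symmetric])
  also have "\<dots> = ennreal (\<Prod>b\<in>(Basis::(real^3) set). ((\<chi> i. 2 * pi) - 0) \<bullet> b)"
    unfolding Omega_def by (subst emeasure_lborel_cbox) (auto simp: Basis_vec_def inner_axis)
  also have "(\<Prod>b\<in>(Basis::(real^3) set). ((\<chi> i. 2 * pi) - 0) \<bullet> b) = (\<Prod>b\<in>(Basis::(real^3) set). 2 * pi)"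
    by (rule prod.cong) (auto simp: Basis_vec_def inner_axis)
  finally show ?thesis
    by (simp add: emeasure_restrict_space)
qed

lemma measure_torus: "measure torus Omega = (2 * pi) ^ 3"
  by (simp add: measure_def emeasure_torus)

interpretation torus: finite_measure torus
  by (rule finite_measureI) (simp add: emeasure_torus)

lemma torus_measurable_borel: "f \<in> borel_measurable borel \<Longrightarrow> f \<in> borel_measurable torus"
  by (simp add: measurable_completion measurable_restrict_space1)

lemma torus_integrable_continuous:
  fixes g :: "real^3 \<Rightarrow> 'b::euclidean_space"
  shows "continuous_on Omega g \<Longrightarrow> integrable torus g"
  unfolding Omega_def by (rule continuous_imp_integrable)

lemma torus_integral_eq:
  fixes g :: "real^3 \<Rightarrow> 'b::euclidean_space"
  shows "continuous_on Omega g \<Longrightarrow> integral\<^sup>L torus g = integral Omega g"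
  by (intro lebesgue_integral_eq_integral torus_integrable_continuous) auto

lemma torus_integrable_mult_bounded:
  fixes g h :: "real^3 \<Rightarrow> complex"
  assumes "integrable torus g" "h \<in> borel_measurable torus" "\<And>x. norm (h x) \<le> C"
  shows "integrable torus (\<lambda>x. h x * g x)"
proof (rule Bochner_Integration.integrable_bound)
  show "integrable torus (\<lambda>x. C * norm (g x))"
    using assms(1) by simp
  show "(\<lambda>x. h x * g x) \<in> borel_measurable torus"
    using assms(1,2) by measurable
  have "norm (h x * g x) \<le> norm (C * norm (g x))" for x
    using mult_right_mono[OF assms(3)[of x] norm_ge_zero[of "g x"]] by (simp add: norm_mult)
  then show "AE x in torus. norm (h x * g x) \<le> norm (C * norm (g x))"
    by simp
qed

lemma torus_integrable_fmode:
  fixes g :: "real^3 \<Rightarrow> complex"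
  assumes "integrable torus g"
  shows "integrable torus (\<lambda>x. fmode k x * g x)" "integrable torus (\<lambda>x. g x * fmode k x)"
  using torus_integrable_mult_bounded[OF assms, of "fmode k" 1]
  by (simp_all add: torus_measurable_borel mult.commute)

text \<open>
  The box \<open>[0,2\<pi>]\<^sup>3\<close> extended by \<open>h\<close> in one direction can be cut into a copy of the torus and a slab in two
  ways, with the slab at either end; by periodicity the two slabs contribute the same.
\<close>

lemma torus_translation:
  fixes g :: "real^3 \<Rightarrow> 'b::euclidean_space"
  assumes per: "periodic g" and cont: "continuous_on UNIV g" and h: "0 \<le> h" "h \<le> 2 * pi"
  shows "integral Omega (\<lambda>x. g (x + axis j h)) = integral Omega g"
proof -
  let ?b = "(\<chi> i. 2 * pi) :: real^3"
  let ?big = "cbox 0 (?b + axis j h)"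
  have ax: "x \<bullet> axis j 1 = x $ j" for x :: "real^3"
    by (simp add: inner_axis)
  have ax': "axis j c $ i = (if i = j then c else 0)" for c :: real and i
    by (simp add: axis_def)
  have int: "g integrable_on cbox a b" for a b
    by (rule integrable_continuous) (rule continuous_on_subset[OF cont], simp)
  have "integral Omega (\<lambda>x. g (x + axis j h)) = integral (cbox (axis j h) (?b + axis j h)) g"
    using integral_shift_cbox[of "axis j h" "axis j h" "?b + axis j h" g]
    by (simp add: Omega_def)
  moreover have "integral ?big g = integral (cbox 0 ?b) g + integral (cbox (axis j (2 * pi)) (?b + axis j h)) g"
  proof -
    have "integral ?big g = integral (?big \<inter> {x. x \<bullet> axis j 1 \<le> 2 * pi}) g
            + integral (?big \<inter> {x. x \<bullet> axis j 1 \<ge> 2 * pi}) g"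
      by (rule integral_split[OF int]) simp
    moreover have "?big \<inter> {x. x \<bullet> axis j 1 \<le> 2 * pi} = cbox 0 ?b"
    proof (rule set_eqI)
      fix x
      have "x \<in> ?big \<inter> {x. x \<bullet> axis j 1 \<le> 2 * pi} \<longleftrightarrow> (\<forall>i. 0 \<le> x $ i \<and> x $ i \<le> 2 * pi + (if i = j then h else 0) \<and> (i = j \<longrightarrow> x $ i \<le> 2 * pi))"
        unfolding ax by (auto simp: mem_box_cart ax')
      also have "\<dots> \<longleftrightarrow> x \<in> cbox 0 ?b"
        unfolding mem_box_cart by (intro all_cong1) (use h in \<open>auto simp: ax'\<close>)
      finally show "x \<in> ?big \<inter> {x. x \<bullet> axis j 1 \<le> 2 * pi} \<longleftrightarrow> x \<in> cbox 0 ?b" .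
    qed
    moreover have "?big \<inter> {x. x \<bullet> axis j 1 \<ge> 2 * pi} = cbox (axis j (2 * pi)) (?b + axis j h)"
    proof (rule set_eqI)
      fix x
      have "x \<in> ?big \<inter> {x. x \<bullet> axis j 1 \<ge> 2 * pi} \<longleftrightarrow> (\<forall>i. 0 \<le> x $ i \<and> x $ i \<le> 2 * pi + (if i = j then h else 0) \<and> (i = j \<longrightarrow> x $ i \<ge> 2 * pi))"
        unfolding ax by (auto simp: mem_box_cart ax')
      also have "\<dots> \<longleftrightarrow> x \<in> cbox (axis j (2 * pi)) (?b + axis j h)"
        unfolding mem_box_cart by (intro all_cong1) (use h in \<open>auto simp: ax'\<close>)
      finally show "x \<in> ?big \<inter> {x. x \<bullet> axis j 1 \<ge> 2 * pi} \<longleftrightarrow> x \<in> cbox (axis j (2 * pi)) (?b + axis j h)" .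
    qed
    ultimately show ?thesis by simp
  qed
  moreover have "integral ?big g = integral (cbox 0 (?b + axis j h - axis j (2 * pi))) g
      + integral (cbox (axis j h) (?b + axis j h)) g"
  proof -
    have "integral ?big g = integral (?big \<inter> {x. x \<bullet> axis j 1 \<le> h}) g
            + integral (?big \<inter> {x. x \<bullet> axis j 1 \<ge> h}) g"
      by (rule integral_split[OF int]) simp
    moreover have "?big \<inter> {x. x \<bullet> axis j 1 \<le> h} = cbox 0 (?b + axis j h - axis j (2 * pi))"
    proof (rule set_eqI)
      fix x
      have "x \<in> ?big \<inter> {x. x \<bullet> axis j 1 \<le> h} \<longleftrightarrow> (\<forall>i. 0 \<le> x $ i \<and> x $ i \<le> 2 * pi + (if i = j then h else 0) \<and> (i = j \<longrightarrow> x $ i \<le> h))"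
        unfolding ax by (auto simp: mem_box_cart ax')
      also have "\<dots> \<longleftrightarrow> x \<in> cbox 0 (?b + axis j h - axis j (2 * pi))"
        unfolding mem_box_cart by (intro all_cong1) (use h in \<open>auto simp: ax'\<close>)
      finally show "x \<in> ?big \<inter> {x. x \<bullet> axis j 1 \<le> h} \<longleftrightarrow> x \<in> cbox 0 (?b + axis j h - axis j (2 * pi))" .
    qed
    moreover have "?big \<inter> {x. x \<bullet> axis j 1 \<ge> h} = cbox (axis j h) (?b + axis j h)"
    proof (rule set_eqI)
      fix x
      have "x \<in> ?big \<inter> {x. x \<bullet> axis j 1 \<ge> h} \<longleftrightarrow> (\<forall>i. 0 \<le> x $ i \<and> x $ i \<le> 2 * pi + (if i = j then h else 0) \<and> (i = j \<longrightarrow> x $ i \<ge> h))"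
        unfolding ax by (auto simp: mem_box_cart ax')
      also have "\<dots> \<longleftrightarrow> x \<in> cbox (axis j h) (?b + axis j h)"
        unfolding mem_box_cart by (intro all_cong1) (use h in \<open>auto simp: ax'\<close>)
      finally show "x \<in> ?big \<inter> {x. x \<bullet> axis j 1 \<ge> h} \<longleftrightarrow> x \<in> cbox (axis j h) (?b + axis j h)" .
    qed
    ultimately show ?thesis by simp
  qed
  moreover have "integral (cbox (axis j (2 * pi)) (?b + axis j h)) g
      = integral (cbox 0 (?b + axis j h - axis j (2 * pi))) g"
    using integral_shift_cbox[of "axis j (2*pi)" "axis j (2*pi)" "?b + axis j h" g] per
    by (simp add: periodic_def)
  ultimately show ?thesis
    by (simp add: Omega_def)
qed

text \<open>
  A shift by half a period changes the sign of a nonconstant mode and, by translation invariance,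
  leaves the integral unchanged.
\<close>

lemma integral_fmode: "(LINT x|torus. fmode k x) = (if k = 0 then complex_of_real ((2 * pi) ^ 3) else 0)"
proof (cases "k = 0")
  case True
  then show ?thesis using measure_torus by (simp add: scaleR_conv_of_real)
next
  case False
  then obtain j where j: "k $ j \<noteq> 0"
    by (auto simp: vec_eq_iff)
  \<comment> \<open>half a period of the mode in direction \<open>j\<close>\<close>
  define h where "h = pi / \<bar>real_of_int (k $ j)\<bar>"
  have k1: "1 \<le> \<bar>real_of_int (k $ j)\<bar>"
    using j by linarith
  have h: "0 \<le> h" "h \<le> 2 * pi"
  proof -
    have "pi / \<bar>real_of_int (k $ j)\<bar> \<le> pi / 1"
      using k1 by (intro divide_left_mono) auto
    then show "h \<le> 2 * pi" using pi_gt_zero unfolding h_def by linarith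
  qed (simp add: h_def)
  have c: "cis (wavevec k \<bullet> axis j h) = -1"
    using j by (auto simp: inner_axis h_def abs_if complex_eq_iff)
  have "integral Omega (fmode k) = integral Omega (\<lambda>x. fmode k (x + axis j h))"
    by (rule torus_translation[symmetric]) (use h periodic_fmode in \<open>auto intro: continuous_intros\<close>)
  also have "\<dots> = - integral Omega (fmode k)"
    by (simp add: fmode_shift c)
  finally have "integral Omega (fmode k) = 0"
    by simp
  then show ?thesis
    using False by (simp add: torus_integral_eq fmode_continuous)
qed

section \<open>Integration by parts\<close>

text \<open>
  Difference quotients in direction \<open>j\<close> have zero mean by translation invariance, and they converge
  boundedly to the derivative.
\<close>

lemma torus_integral_deriv_zero:
  fixes \<psi> :: "real^3 \<Rightarrow> real"
  assumes per: "periodic \<psi>" and d: "\<And>x. GDERIV \<psi> x :> G x" and G: "continuous_on UNIV G"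
  shows "(LINT x|torus. G x $ j) = 0"
proof -
  have dx: "((\<lambda>t. \<psi> (x + axis j t)) has_real_derivative G (x + axis j t) $ j) (at t)" for x t
  proof -
    have "((\<lambda>t. x + t *\<^sub>R axis j 1) has_derivative (\<lambda>s. s *\<^sub>R axis j 1)) (at t)"
      by (auto intro!: derivative_eq_intros)
    moreover have "(\<psi> has_derivative (\<lambda>v. v \<bullet> G (x + t *\<^sub>R axis j 1))) (at (x + t *\<^sub>R axis j 1))"
      using d by (simp add: gderiv_def)
    ultimately have "((\<lambda>t. \<psi> (x + t *\<^sub>R axis j 1)) has_derivative (\<lambda>s. (s *\<^sub>R axis j 1) \<bullet> G (x + t *\<^sub>R axis j 1))) (at t)"
      by (rule has_derivative_compose)
    moreover have "t *\<^sub>R axis j 1 = axis j t" for t :: real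
      by (simp add: vec_eq_iff axis_def)
    ultimately show ?thesis
      by (simp add: has_field_derivative_def inner_axis' mult.commute[of _ "G _ $ j"])
  qed
  have cont: "continuous_on UNIV \<psi>"
    using d by (auto simp: gderiv_def intro!: has_derivative_continuous_on[of UNIV \<psi>] intro: has_derivative_at_withinI)
  define r where "r n = 1 / real (Suc n)" for n
  have r: "0 < r n" "r n \<le> 1" for n
    by (auto simp: r_def)
  have r0: "r \<longlonglongrightarrow> 0"
    unfolding r_def by (rule LIMSEQ_inverse_real_of_nat[unfolded inverse_eq_divide])
  define D where "D n x = (\<psi> (x + axis j (r n)) - \<psi> x) / r n" for n x
  have axc: "continuous_on UNIV (\<lambda>x::real^3. x + axis j c)" for c
    by (intro continuous_intros)
  have shc: "continuous_on UNIV (\<lambda>x. \<psi> (x + axis j c))" for c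
    by (rule continuous_on_compose2[OF cont axc]) auto
  have Dc: "continuous_on S (D n)" for n S
    unfolding D_def using r(1)[of n]
    by (intro continuous_intros continuous_on_subset[OF shc] continuous_on_subset[OF cont]) auto
  have zero: "(LINT x|torus. D n x) = 0" for n
  proof -
    have "1 \<le> 2 * pi" using pi_gt3 by simp
    then have "integral Omega (\<lambda>x. \<psi> (x + axis j (r n))) = integral Omega \<psi>"
      using r[of n] by (intro torus_translation[OF per cont]) auto
    moreover have "(\<lambda>x. \<psi> (x + axis j (r n))) integrable_on Omega" "\<psi> integrable_on Omega"
      unfolding Omega_def
      by (rule integrable_continuous, rule continuous_on_subset[OF shc] continuous_on_subset[OF cont], simp)+
    ultimately have "integral Omega (D n) = 0"
      unfolding D_def by (simp add: Henstock_Kurzweil_Integration.integral_diff)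
    then show ?thesis
      by (simp add: torus_integral_eq Dc)
  qed
  \<comment> \<open>contains the points at which the mean value theorem evaluates the derivative\<close>
  let ?K = "cbox (0::real^3) (\<chi> i. 2 * pi + 1)"
  have "bounded ((\<lambda>x. G x $ j) ` ?K)"
    by (intro compact_imp_bounded compact_continuous_image continuous_intros
        continuous_on_subset[OF G]) auto
  then obtain C where C: "\<And>x. x \<in> ?K \<Longrightarrow> \<bar>G x $ j\<bar> \<le> C"
    by (auto simp: bounded_iff)
  have bound: "norm (D n x) \<le> C" if x: "x \<in> Omega" for n x
  proof -
    obtain t where t: "0 < t" "t < r n" and eq: "\<psi> (x + axis j (r n)) - \<psi> (x + axis j 0) = (r n - 0) * G (x + axis j t) $ j"
      using MVT2[of 0 "r n" "\<lambda>t. \<psi> (x + axis j t)" "\<lambda>t. G (x + axis j t) $ j"] r(1) dx by blast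
    have a0: "axis j 0 = (0::real^3)" by simp
    have "D n x = G (x + axis j t) $ j"
      using eq r(1)[of n] by (simp add: D_def a0)
    moreover have "x + axis j t \<in> ?K"
      using x t r(2)[of n] by (auto simp: mem_Omega mem_box_cart axis_def intro: add_nonneg_nonneg order_trans[OF add_mono[of _ "2*pi" _ 1]] order_trans[of _ "2 * pi"])
    ultimately show ?thesis using C by simp
  qed
  have "(\<lambda>n. LINT x|torus. D n x) \<longlonglongrightarrow> (LINT x|torus. G x $ j)"
  proof (rule integral_dominated_convergence)
    show "integrable torus (\<lambda>_. C)" by simp
    show "(\<lambda>x. G x $ j) \<in> borel_measurable torus"
      by (intro borel_measurable_integrable torus_integrable_continuous continuous_intros continuous_on_subset[OF G]) auto
    show "D n \<in> borel_measurable torus" for n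
      by (intro borel_measurable_integrable torus_integrable_continuous Dc)
    have "(\<lambda>n. D n x) \<longlonglongrightarrow> G x $ j" for x
    proof -
      have "((\<lambda>h. (\<psi> (x + axis j (0 + h)) - \<psi> (x + axis j 0)) / h) \<longlongrightarrow> G (x + axis j 0) $ j) (at 0)"
        using dx[of x 0] by (simp add: DERIV_def)
      then have "((\<lambda>h. (\<psi> (x + axis j h) - \<psi> x) / h) \<longlongrightarrow> G x $ j) (at 0)"
        by (simp add: axis_def zero_vec_def[symmetric])
      moreover have "filterlim r (at 0) sequentially"
        using r0 r(1) less_imp_neq[OF r(1), THEN not_sym] by (simp add: filterlim_at)
      ultimately show ?thesis
        unfolding D_def by (rule filterlim_compose)
    qed
    then show "AE x in torus. (\<lambda>n. D n x) \<longlonglongrightarrow> G x $ j"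
      by simp
    show "AE x in torus. norm (D n x) \<le> C" for n
      using bound by (intro AE_I2) auto
  qed
  then show ?thesis
    using LIMSEQ_unique zero by (simp add: LIMSEQ_const_iff)
qed

lemma test_fun_mult:
  assumes "test_fun \<phi> G" "test_fun \<psi> K"
  shows "test_fun (\<lambda>x. \<phi> x * \<psi> x) (\<lambda>x. \<phi> x *\<^sub>R K x + \<psi> x *\<^sub>R G x)"
proof -
  have c: "continuous_on UNIV \<phi>" "continuous_on UNIV \<psi>"
    using assms by (auto simp: test_fun_def gderiv_def intro!: has_derivative_continuous_on intro: has_derivative_at_withinI)
  show ?thesis
    using assms c by (auto simp: test_fun_def periodic_def intro!: GDERIV_mult continuous_intros)
qed

lemma integration_by_parts:
  assumes "test_fun \<phi> G" "test_fun \<psi> K"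
  shows "(LINT x|torus. \<phi> x * K x $ j) = - (LINT x|torus. \<psi> x * G x $ j)"
proof -
  have c: "continuous_on UNIV \<phi>" "continuous_on UNIV \<psi>" "continuous_on UNIV G" "continuous_on UNIV K"
    using assms by (auto simp: test_fun_def gderiv_def intro!: has_derivative_continuous_on intro: has_derivative_at_withinI)
  have "(LINT x|torus. (\<phi> x *\<^sub>R K x + \<psi> x *\<^sub>R G x) $ j) = 0"
    using test_fun_mult[OF assms] by (intro torus_integral_deriv_zero) (auto simp: test_fun_def)
  then have "(LINT x|torus. \<phi> x * K x $ j + \<psi> x * G x $ j) = 0"
    by simp
  moreover have "(LINT x|torus. \<phi> x * K x $ j + \<psi> x * G x $ j)
      = (LINT x|torus. \<phi> x * K x $ j) + (LINT x|torus. \<psi> x * G x $ j)"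
    by (intro Bochner_Integration.integral_add torus_integrable_continuous continuous_intros
        continuous_on_subset[OF c(1)] continuous_on_subset[OF c(2)] continuous_on_subset[OF c(3)]
        continuous_on_subset[OF c(4)]) auto
  ultimately show ?thesis by simp
qed

lemma test_fun_cos: "test_fun (\<lambda>x. cos (wavevec k \<bullet> x)) (\<lambda>x. - sin (wavevec k \<bullet> x) *\<^sub>R wavevec k)"
  and test_fun_sin: "test_fun (\<lambda>x. sin (wavevec k \<bullet> x)) (\<lambda>x. cos (wavevec k \<bullet> x) *\<^sub>R wavevec k)"
proof -
  have "cos (wavevec k \<bullet> x) = Re (fmode k x)" "sin (wavevec k \<bullet> x) = Im (fmode k x)" for x
    by (simp_all add: fmode_def)
  then have "periodic (\<lambda>x. cos (wavevec k \<bullet> x))" "periodic (\<lambda>x. sin (wavevec k \<bullet> x))"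
    using periodic_fmode[of k] by (simp_all add: periodic_def)
  then show "test_fun (\<lambda>x. cos (wavevec k \<bullet> x)) (\<lambda>x. - sin (wavevec k \<bullet> x) *\<^sub>R wavevec k)"
    "test_fun (\<lambda>x. sin (wavevec k \<bullet> x)) (\<lambda>x. cos (wavevec k \<bullet> x) *\<^sub>R wavevec k)"
    by (auto simp: test_fun_def gderiv_def inner_commute intro!: continuous_intros derivative_eq_intros)
qed

section \<open>Uniqueness of Fourier coefficients\<close>

text \<open>
  Periodic functions on \<open>\<real>\<^sup>3\<close> are functions on a compact subset of \<open>\<complex>\<^sup>3\<close>, the image of this map.  Real
  polynomials on that set are trigonometric polynomials, which brings in the Stone-Weierstrass theorem.
\<close>

definition circle_map :: "real^3 \<Rightarrow> complex^3" where
  "circle_map x = (\<chi> i. cis (x $ i))"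

lemma circle_map_continuous: "continuous_on S circle_map"
  unfolding circle_map_def by (intro continuous_intros)

definition orth_modes :: "(real^3 \<Rightarrow> complex) \<Rightarrow> bool" where
  "orth_modes g \<longleftrightarrow> integrable torus g \<and> (\<forall>k. (LINT x|torus. g x * fmode k x) = 0)"

lemma orth_modes_cmult: "orth_modes g \<Longrightarrow> orth_modes (\<lambda>x. c * g x)"
  by (simp add: orth_modes_def mult.assoc)

lemma orth_modes_add: "orth_modes g \<Longrightarrow> orth_modes h \<Longrightarrow> orth_modes (\<lambda>x. g x + h x)"
  by (simp add: orth_modes_def distrib_right torus_integrable_fmode)

lemma orth_modes_sum: "finite A \<Longrightarrow> (\<And>i. i \<in> A \<Longrightarrow> orth_modes (g i)) \<Longrightarrow> orth_modes (\<lambda>x. \<Sum>i\<in>A. g i x)"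
proof (induction A rule: finite_induct)
  case empty
  then show ?case by (simp add: orth_modes_def)
next
  case (insert a A)
  then show ?case by (simp add: orth_modes_add)
qed

lemma orth_modes_ek:
  assumes "orth_modes g"
  shows "orth_modes (\<lambda>x. fmode l x * g x)"
proof -
  have "fmode l x * g x * fmode k x = g x * fmode (l + k) x" for k x
    by (simp add: fmode_add mult_ac)
  then show ?thesis
    using assms unfolding orth_modes_def by (auto simp only: torus_integrable_fmode)
qed

text \<open>
  Multiplication by a mode only permutes the Fourier coefficients, so the property is preserved by
  multiplication with a trigonometric polynomial.  It is this formulation, with \<open>g\<close> arbitrary, that makes the
  induction pass through products.
\<close>

lemma orth_modes_polynomial:
  assumes "real_polynomial_function p" "orth_modes g"
  shows "orth_modes (\<lambda>x. complex_of_real (p (circle_map x)) * g x)"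
  using assms
proof (induction p arbitrary: g rule: real_polynomial_function.induct)
  case (linear f)
  have fe: "f (circle_map x) = (\<Sum>i\<in>UNIV. cos (x $ i) * f (axis i 1) + sin (x $ i) * f (axis i \<i>))" for x
  proof -
    have "circle_map x = (\<Sum>i\<in>UNIV. cos (x $ i) *\<^sub>R axis i 1 + sin (x $ i) *\<^sub>R axis i \<i>)"
      by (simp add: circle_map_def vec_eq_iff axis_def complex_eq_iff sum.distrib if_distrib if_distribR cong: if_cong)
    then show ?thesis
      using linear(1) by (simp add: bounded_linear.linear linear_sum linear_add linear_scale)
  qed
  have ax: "wavevec (axis i 1) \<bullet> x = x $ i" for i x
  proof -
    have "wavevec (axis i 1) = axis i 1"
      by (simp add: vec_eq_iff axis_def)
    then show ?thesis by (simp add: inner_axis')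
  qed
  have co: "complex_of_real (cos (x $ i)) = (1/2) * (fmode (axis i 1) x + fmode (- axis i 1) x)"
    "complex_of_real (sin (x $ i)) = (- \<i>/2) * (fmode (axis i 1) x - fmode (- axis i 1) x)" for x i
    by (simp_all add: fmode_def ax complex_eq_iff)
  have "orth_modes (\<lambda>x. \<Sum>i\<in>UNIV.
       ((f (axis i 1)/2 - \<i>/2 * f (axis i \<i>)) * (fmode (axis i 1) x * g x)
       + (f (axis i 1)/2 + \<i>/2 * f (axis i \<i>)) * (fmode (- axis i 1) x * g x)))"
    by (intro orth_modes_sum orth_modes_add orth_modes_cmult orth_modes_ek linear) simp
  moreover have "(\<lambda>x. \<Sum>i\<in>UNIV.
       ((f (axis i 1)/2 - \<i>/2 * f (axis i \<i>)) * (fmode (axis i 1) x * g x)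
       + (f (axis i 1)/2 + \<i>/2 * f (axis i \<i>)) * (fmode (- axis i 1) x * g x)))
     = (\<lambda>x. complex_of_real (f (circle_map x)) * g x)"
    by (rule ext, simp only: fe of_real_sum of_real_add of_real_mult co sum_distrib_right, rule sum.cong)
      (simp_all add: field_simps)
  ultimately show ?case by simp
next
  case (const c)
  then show ?case by (intro orth_modes_cmult)
next
  case (add f g)
  then show ?case by (simp add: distrib_right orth_modes_add)
next
  case (mult f g)
  then show ?case by (simp add: mult.assoc)
qed

lemma orth_modes_continuous:
  assumes h: "continuous_on UNIV h" and g: "orth_modes g"
  shows "(LINT x|torus. complex_of_real (h (circle_map x)) * g x) = 0"
proof -
  let ?I = "LINT x|torus. complex_of_real (h (circle_map x)) * g x"
  have gi: "integrable torus g" using g by (simp add: orth_modes_def)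
  define N where "N = (LINT x|torus. norm (g x))"
  have N: "0 \<le> N" by (simp add: N_def)
  have comp: "compact (circle_map ` Omega)"
    by (intro compact_continuous_image circle_map_continuous compact_Omega)
  have int: "integrable torus (\<lambda>x. complex_of_real (q (circle_map x)) * g x)" if "continuous_on UNIV q" for q
  proof -
    have qc: "continuous_on Omega (\<lambda>x. complex_of_real (q (circle_map x)))"
      by (intro continuous_intros continuous_on_compose2[OF that circle_map_continuous]) auto
    then have "bounded ((\<lambda>x. complex_of_real (q (circle_map x))) ` Omega)"
      by (intro compact_imp_bounded compact_continuous_image compact_Omega)
    then obtain C where C: "\<And>x. x \<in> Omega \<Longrightarrow> norm (complex_of_real (q (circle_map x))) \<le> C"
      by (auto simp: bounded_iff)
    show ?thesis
    proof (rule Bochner_Integration.integrable_bound)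
      show "integrable torus (\<lambda>x. C * norm (g x))" using gi by simp
      show "(\<lambda>x. complex_of_real (q (circle_map x)) * g x) \<in> borel_measurable torus"
        using borel_measurable_integrable[OF torus_integrable_continuous[OF qc]] gi by measurable
      show "AE x in torus. norm (complex_of_real (q (circle_map x)) * g x) \<le> norm (C * norm (g x))"
      proof (rule AE_I2)
        fix x assume "x \<in> space torus"
        then have "norm (complex_of_real (q (circle_map x))) \<le> C" using C by auto
        from mult_right_mono[OF this norm_ge_zero[of "g x"]]
        show "norm (complex_of_real (q (circle_map x)) * g x) \<le> norm (C * norm (g x))"
          using abs_ge_self[of "C * norm (g x)"] unfolding norm_mult real_norm_def by linarith
      qed
    qed
  qed
  have "norm ?I \<le> e * N" if e: "e > 0" for e
  proof -
    obtain p where p: "real_polynomial_function p" and ap: "\<And>z. z \<in> circle_map ` Omega \<Longrightarrow> \<bar>h z - p z\<bar> < e"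
      using Stone_Weierstrass_real_polynomial_function[OF comp continuous_on_subset[OF h] e] by blast
    have pc: "continuous_on UNIV p"
      using p continuous_on_polymonial_function real_polynomial_function_eq by blast
    have "orth_modes (\<lambda>x. complex_of_real (p (circle_map x)) * g x)"
      by (rule orth_modes_polynomial[OF p g])
    then have p0: "(LINT x|torus. complex_of_real (p (circle_map x)) * g x) = 0"
      by (auto simp: orth_modes_def dest!: spec[of _ 0])
    have "?I = (LINT x|torus. complex_of_real (h (circle_map x)) * g x - complex_of_real (p (circle_map x)) * g x)"
      using p0 by (simp add: int h pc)
    also have "norm \<dots> \<le> (LINT x|torus. norm (complex_of_real (h (circle_map x)) * g x - complex_of_real (p (circle_map x)) * g x))"
      by (rule integral_norm_bound)
    also have "\<dots> \<le> (LINT x|torus. e * norm (g x))"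
    proof (rule integral_mono)
      show "integrable torus (\<lambda>x. norm (complex_of_real (h (circle_map x)) * g x - complex_of_real (p (circle_map x)) * g x))"
        by (intro integrable_norm Bochner_Integration.integrable_diff int h pc)
      show "integrable torus (\<lambda>x. e * norm (g x))" using gi by simp
      fix x assume "x \<in> space torus"
      then have "\<bar>h (circle_map x) - p (circle_map x)\<bar> \<le> e"
        using ap[of "circle_map x"] by auto
      then have "norm (complex_of_real (h (circle_map x) - p (circle_map x)) * g x) \<le> e * norm (g x)"
        unfolding norm_mult norm_of_real by (intro mult_right_mono) auto
      then show "norm (complex_of_real (h (circle_map x)) * g x - complex_of_real (p (circle_map x)) * g x) \<le> e * norm (g x)"
        by (simp add: left_diff_distrib)
    qed
    finally show ?thesis by (simp add: N_def)
  qed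
  note le = this
  have "norm ?I \<le> 0"
  proof (rule field_le_epsilon)
    fix e :: real assume "e > 0"
    then have "norm ?I \<le> e / (N + 1) * N" using N by (intro le) auto
    also have "\<dots> \<le> e" using N \<open>e > 0\<close> by (simp add: field_simps)
    finally show "norm ?I \<le> 0 + e" by simp
  qed
  then show ?thesis by simp
qed

lemma circle_map_inj:
  assumes "x \<in> interior Omega" "y \<in> Omega" "circle_map x = circle_map y"
  shows "x = y"
proof -
  have "x $ i = y $ i" for i
  proof -
    have x: "0 < x $ i" "x $ i < 2 * pi"
      using assms(1) by (auto simp: Omega_def interior_cbox mem_box_cart)
    have y: "0 \<le> y $ i" "y $ i \<le> 2 * pi"
      using assms(2) by (auto simp: mem_Omega)
    have "cis (x $ i) = cis (y $ i)"
      using assms(3) by (auto simp: circle_map_def vec_eq_iff)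
    then have "sin (x $ i) = sin (y $ i) \<and> cos (x $ i) = cos (y $ i)"
      by (simp add: complex_eq_iff)
    then obtain n :: int where n: "x $ i = y $ i + 2 * pi * n"
      using sin_cos_eq_iff by blast
    have "n = 0"
    proof (rule ccontr)
      assume "n \<noteq> 0"
      then have "real_of_int n \<ge> 1 \<or> real_of_int n \<le> -1" by linarith
      then have "2 * pi * n \<ge> 2 * pi \<or> 2 * pi * n \<le> - (2 * pi)"
        using mult_left_mono[of 1 "real_of_int n" "2*pi"] mult_left_mono[of "real_of_int n" "-1" "2*pi"] by auto
      then show False using n x y by linarith
    qed
    then show ?thesis using n by simp
  qed
  then show ?thesis by (simp add: vec_eq_iff)
qed

lemma AE_interior_Omega: "AE x in torus. x \<in> interior Omega"
proof -
  have "negligible (frontier Omega)"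
    unfolding Omega_def by (simp add: negligible_convex_frontier)
  then have "AE x in lebesgue. x \<notin> frontier Omega"
    by (simp add: negligible_iff_null_sets AE_not_in)
  then show ?thesis
    by (auto simp: AE_restrict_space_iff frontier_def closure_closed compact_imp_closed[OF compact_Omega])
qed

text \<open>
  The indicator of a closed set is the limit of continuous functions of the distance to its image.  Two
  different points have the same image only if both lie on the boundary of the box.
\<close>

lemma orth_modes_closed:
  assumes C: "closed C" "C \<subseteq> Omega" and g: "orth_modes g"
  shows "(LINT x|torus. indicator C x *\<^sub>R g x) = 0"
proof (cases "C = {}")
  case True
  then show ?thesis by simp
next
  case False
  define K where "K = circle_map ` C"
  have "compact C" using C compact_Omega compact_Int_closed by (metis inf.absorb_iff2)
  then have K: "closed K" "K \<noteq> {}"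
    using False by (auto simp: K_def intro!: compact_imp_closed compact_continuous_image circle_map_continuous)
  define h where "h n z = max 0 (1 - real n * infdist z K)" for n z
  have hc: "continuous_on UNIV (h n)" for n
    unfolding h_def by (intro continuous_intros)
  have h01: "0 \<le> h n z" "h n z \<le> 1" for n z
    by (auto simp: h_def infdist_nonneg)
  have lim: "(\<lambda>n. h n z) \<longlonglongrightarrow> indicator K z" for z
  proof (cases "z \<in> K")
    case True
    then show ?thesis by (simp add: h_def)
  next
    case F: False
    then have d: "infdist z K > 0"
      using K in_closed_iff_infdist_zero infdist_nonneg by (metis order_le_less)
    obtain N where N: "real N * infdist z K > 1"
      using d reals_Archimedean3 by blast
    have "h n z = 0" if "n \<ge> N" for n
    proof -
      have "real N * infdist z K \<le> real n * infdist z K"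
        using that d by (intro mult_right_mono) auto
      then show ?thesis using N by (simp add: h_def)
    qed
    then have "eventually (\<lambda>n. h n z = 0) sequentially"
      by (auto simp: eventually_sequentially)
    then show ?thesis using F by (simp add: tendsto_eventually)
  qed
  have gi: "integrable torus g" using g by (simp add: orth_modes_def)
  have "(\<lambda>n. LINT x|torus. complex_of_real (h n (circle_map x)) * g x) \<longlonglongrightarrow> (LINT x|torus. indicator C x *\<^sub>R g x)"
  proof (rule integral_dominated_convergence)
    show "integrable torus (\<lambda>x. norm (g x))" using gi by simp
    show "(\<lambda>x. indicator C x *\<^sub>R g x) \<in> borel_measurable torus"
    proof -
      have "(indicator C :: _ \<Rightarrow> real) \<in> borel_measurable torus"
        using C by (intro torus_measurable_borel) auto
      then show ?thesis using gi by measurable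
    qed
    show "(\<lambda>x. complex_of_real (h n (circle_map x)) * g x) \<in> borel_measurable torus" for n
    proof -
      have "(\<lambda>x. complex_of_real (h n (circle_map x))) \<in> borel_measurable torus"
        by (intro borel_measurable_integrable torus_integrable_continuous continuous_intros
            continuous_on_compose2[OF hc circle_map_continuous]) auto
      then show ?thesis using gi by measurable
    qed
    show "AE x in torus. (\<lambda>n. complex_of_real (h n (circle_map x)) * g x) \<longlonglongrightarrow> indicator C x *\<^sub>R g x"
      using AE_interior_Omega
    proof eventually_elim
      case (elim x)
      have "circle_map x \<in> K \<longleftrightarrow> x \<in> C"
        using circle_map_inj[OF elim] C by (auto simp: K_def)
      then have "(\<lambda>n. h n (circle_map x)) \<longlonglongrightarrow> indicator C x"
        using lim[of "circle_map x"] by (simp add: indicator_def)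
      then show ?case
        unfolding scaleR_conv_of_real by (intro tendsto_intros)
    qed
    show "AE x in torus. norm (complex_of_real (h n (circle_map x)) * g x) \<le> norm (g x)" for n
      using h01[of n] by (auto simp: norm_mult intro!: AE_I2 mult_left_le_one_le)
  qed
  then show ?thesis
    using orth_modes_continuous[OF hc g] by (simp add: LIMSEQ_const_iff)
qed

text \<open>
  A set of positive measure contains a closed set of positive measure; if it were contained in
  \<open>{x. 0 < g x}\<close>, the integral of \<open>g\<close> over it would be positive, against \<open>orth_modes_closed\<close>.
\<close>

lemma orth_modes_not_pos:
  fixes g :: "real^3 \<Rightarrow> real"
  assumes g: "orth_modes (\<lambda>x. complex_of_real (g x))"
  shows "AE x in torus. g x \<le> 0"
proof (rule ccontr)
  assume n: "\<not> ?thesis"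
  have gi: "integrable torus g"
    using g complex_of_real_integrable_eq by (auto simp: orth_modes_def)
  define A where "A = {x \<in> Omega. g x > 0}"
  have As: "A \<in> sets torus"
  proof -
    have "{x \<in> space torus. g x > 0} \<in> sets torus"
      using gi by measurable
    then show ?thesis by (simp add: A_def)
  qed
  then have Al: "A \<in> sets lebesgue" by (simp add: sets_restrict_space_iff)
  have "emeasure lebesgue A \<noteq> 0"
  proof
    assume "emeasure lebesgue A = 0"
    then have "A \<in> null_sets torus" using As by (auto simp: null_sets_def emeasure_restrict_space A_def)
    then have "AE x in torus. x \<notin> A" by (rule AE_not_in)
    then have "AE x in torus. g x \<le> 0"
      by (auto simp: A_def AE_restrict_space_iff elim!: eventually_mono)
    then show False using n by simp
  qed
  then obtain e where e: "e > 0" "ennreal e < emeasure lebesgue A"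
    by (cases "emeasure lebesgue A") (auto intro: that[of 1] that[of "enn2real (emeasure lebesgue A) / 2"] simp: ennreal_less_iff)
  obtain C where C: "closed C" "C \<subseteq> A" "A - C \<in> lmeasurable" "emeasure lebesgue (A - C) < ennreal e"
    using sets_lebesgue_inner_closed[OF Al e(1)] by blast
  have Cl: "C \<in> sets lebesgue" using C(1) by auto
  have "emeasure lebesgue A \<le> emeasure lebesgue C + emeasure lebesgue (A - C)"
    using emeasure_subadditive[OF Cl, of "A - C"] C Al by (simp add: Un_absorb1)
  then have Cpos: "emeasure lebesgue C \<noteq> 0"
    using e C(4) by auto
  have CO: "C \<subseteq> Omega" using C(2) by (auto simp: A_def)
  have "(LINT x|torus. complex_of_real (indicator C x * g x)) = 0"
    using orth_modes_closed[OF C(1) CO g] by (simp add: scaleR_conv_of_real)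
  then have z: "(LINT x|torus. indicator C x * g x) = 0"
    by (simp only: integral_complex_of_real of_real_eq_0_iff)
  have ind: "(indicator C :: _ \<Rightarrow> real) \<in> borel_measurable torus"
    using C by (intro torus_measurable_borel) auto
  have "integrable torus (\<lambda>x. indicator C x * g x)"
  proof (rule Bochner_Integration.integrable_bound[OF gi])
    show "(\<lambda>x. indicator C x * g x) \<in> borel_measurable torus"
      using ind gi by measurable
  qed (auto simp: indicator_def)
  moreover have "AE x in torus. 0 \<le> indicator C x * g x"
    using C(2) by (intro AE_I2) (auto simp: indicator_def A_def)
  ultimately have "AE x in torus. indicator C x * g x = 0"
    using z integral_nonneg_eq_0_iff_AE by blast
  then have "AE x in torus. x \<notin> C"
    by eventually_elim (use C(2) in \<open>auto simp: A_def split: split_indicator_asm\<close>)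
  then have "AE x in lebesgue. x \<notin> C"
    using CO by (auto simp: AE_restrict_space_iff elim!: eventually_mono)
  then have "emeasure lebesgue C = 0"
    using Cl by (simp add: AE_iff_measurable[of C])
  then show False using Cpos by simp
qed

theorem fourier_uniqueness:
  fixes g :: "real^3 \<Rightarrow> real"
  assumes g: "integrable torus g" and z: "\<And>k. scoeff (\<lambda>x. complex_of_real (g x)) k = 0"
  shows "AE x in torus. g x = 0"
proof -
  have "(LINT x|torus. complex_of_real (g x) * fmode k x) = 0" for k
    using z[of "- k"] by (simp add: scoeff_def)
  then have a: "orth_modes (\<lambda>x. complex_of_real (g x))"
    using g by (simp add: orth_modes_def)
  from orth_modes_not_pos[OF a] orth_modes_not_pos[of "\<lambda>x. - g x"] orth_modes_cmult[OF a, of "-1"]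
  have "AE x in torus. g x \<le> 0" "AE x in torus. - g x \<le> 0"
    by auto
  then show ?thesis by eventually_elim auto
qed

section \<open>Bessel's inequality\<close>

lemma integrable_norm_of_square:
  fixes g :: "real^3 \<Rightarrow> 'a::{banach, second_countable_topology}"
  assumes "g \<in> borel_measurable torus" "integrable torus (\<lambda>x. (norm (g x))\<^sup>2)"
  shows "integrable torus g"
proof (rule Bochner_Integration.integrable_bound)
  show "integrable torus (\<lambda>x. 1 + (norm (g x))\<^sup>2)"
    using assms by simp
  have "a \<le> 1 + a\<^sup>2" for a :: real
    using zero_le_power2[of "a - 1/2"] by (simp add: power2_eq_square algebra_simps)
  then show "AE x in torus. norm (g x) \<le> norm (1 + (norm (g x))\<^sup>2)"
    by simp
qed (use assms in auto)

text \<open>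
  Expand the nonnegative integral of \<open>|g - s|\<^sup>2\<close>, where \<open>s\<close> is the partial Fourier sum over \<open>F\<close>.
\<close>

lemma bessel:
  fixes g :: "real^3 \<Rightarrow> complex"
  assumes g: "g \<in> borel_measurable torus" "integrable torus (\<lambda>x. (norm (g x))\<^sup>2)" and F: "finite F"
  shows "(\<Sum>k\<in>F. (norm (scoeff g k))\<^sup>2) \<le> (LINT x|torus. (norm (g x))\<^sup>2) / (2 * pi) ^ 3"
proof -
  let ?V = "(2 * pi) ^ 3 :: real"
  define s where "s x = (\<Sum>k\<in>F. scoeff g k * fmode k x)" for x
  have gi: "integrable torus g" by (rule integrable_norm_of_square[OF g])
  have fcV: "(LINT x|torus. g x * fmode (- k) x) = scoeff g k * complex_of_real ?V" for k
    by (simp add: scoeff_def)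
  have sc: "continuous_on S s" for S
    unfolding s_def by (intro continuous_intros)
  have cnjs: "cnj (s x) = (\<Sum>k\<in>F. cnj (scoeff g k) * fmode (- k) x)" for x
    by (simp add: s_def cnj_fmode)
  have gs: "g x * cnj (s x) = (\<Sum>k\<in>F. cnj (scoeff g k) * (g x * fmode (- k) x))" for x
    by (simp add: cnjs sum_distrib_left mult_ac)
  have i1: "integrable torus (\<lambda>x. g x * cnj (s x))"
    unfolding gs by (intro Bochner_Integration.integrable_sum integrable_mult_right torus_integrable_fmode gi)
  have I1: "(LINT x|torus. g x * cnj (s x)) = complex_of_real (?V * (\<Sum>k\<in>F. (norm (scoeff g k))\<^sup>2))"
  proof -
    have "(LINT x|torus. g x * cnj (s x)) = (\<Sum>k\<in>F. cnj (scoeff g k) * (LINT x|torus. g x * fmode (- k) x))"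
      unfolding gs by (subst Bochner_Integration.integral_sum) (auto intro!: integrable_mult_right torus_integrable_fmode gi)
    also have "\<dots> = (\<Sum>k\<in>F. complex_of_real ?V * (scoeff g k * cnj (scoeff g k)))"
      by (simp add: fcV mult_ac)
    also have "\<dots> = (\<Sum>k\<in>F. complex_of_real (?V * (norm (scoeff g k))\<^sup>2))"
      by (simp only: complex_norm_square of_real_mult)
    finally show ?thesis
      by (simp only: sum_distrib_left of_real_sum)
  qed
  have ss: "s x * cnj (s x) = (\<Sum>l\<in>F. \<Sum>k\<in>F. (cnj (scoeff g k) * scoeff g l) * fmode (l - k) x)" for x
    unfolding cnjs unfolding s_def
    by (subst sum_product) (auto intro!: sum.cong simp: fmode_add[of _ "- _", simplified] mult_ac)
  have I2: "(LINT x|torus. s x * cnj (s x)) = complex_of_real (?V * (\<Sum>k\<in>F. (norm (scoeff g k))\<^sup>2))"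
  proof -
    have "(LINT x|torus. s x * cnj (s x)) = (\<Sum>l\<in>F. \<Sum>k\<in>F. (cnj (scoeff g k) * scoeff g l) * (LINT x|torus. fmode (l - k) x))"
      unfolding ss
      by (simp add: Bochner_Integration.integral_sum torus_integrable_continuous fmode_continuous)
    also have "\<dots> = (\<Sum>l\<in>F. \<Sum>k\<in>F. if l = k then complex_of_real ?V * (norm (scoeff g l))\<^sup>2 else 0)"
      by (intro sum.cong refl) (simp add: integral_fmode complex_norm_square del: of_real_power mult_ac)
    finally show ?thesis
      using F by (simp add: sum_distrib_left)
  qed
  have i2: "integrable torus (\<lambda>x. s x * cnj (s x))"
    by (intro torus_integrable_continuous continuous_intros sc)
  have sq: "(norm (g x - s x))\<^sup>2 = (norm (g x))\<^sup>2 - 2 * Re (g x * cnj (s x)) + Re (s x * cnj (s x))" for x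
    unfolding cmod_power2 by (simp add: power2_eq_square algebra_simps)
  have "0 \<le> (LINT x|torus. (norm (g x - s x))\<^sup>2)"
    by simp
  also have "\<dots> = (LINT x|torus. (norm (g x))\<^sup>2) - 2 * Re (LINT x|torus. g x * cnj (s x)) + Re (LINT x|torus. s x * cnj (s x))"
  proof -
    have "(LINT x|torus. f x - 2 * Re (P x) + Re (Q x)) = integral\<^sup>L torus f - 2 * Re (integral\<^sup>L torus P) + Re (integral\<^sup>L torus Q)"
      if "integrable torus f" "integrable torus P" "integrable torus Q" for f and P Q :: "real^3 \<Rightarrow> complex"
      using that by simp
    from this[OF g(2) i1 i2] show ?thesis
      by (simp only: sq)
  qed
  also have "\<dots> = (LINT x|torus. (norm (g x))\<^sup>2) - ?V * (\<Sum>k\<in>F. (norm (scoeff g k))\<^sup>2)"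
    unfolding I1 I2 Re_complex_of_real by simp
  finally show ?thesis
    by (simp add: field_simps)
qed

section \<open>Exponential weights on the lattice of modes\<close>

lemma norm_vec3_ge: "\<bar>wavevec k $ 1\<bar> + \<bar>wavevec k $ 2\<bar> + \<bar>wavevec k $ 3\<bar> \<le> 3 * wn k"
  using component_le_norm_cart[of "wavevec k" 1] component_le_norm_cart[of "wavevec k" 2]
    component_le_norm_cart[of "wavevec k" 3] by linarith

lemma summable_exp_int:
  assumes r: "r > 0"
  shows "(\<lambda>m::int. exp (- r * \<bar>real_of_int m\<bar>)) summable_on UNIV"
proof -
  have UN: "(UNIV::int set) = range int \<union> range (\<lambda>n. - int n)"
    by (auto simp: image_iff) (metis int_cases2)
  have g: "(\<lambda>n::nat. exp (- r * real n)) summable_on UNIV"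
  proof -
    have "summable (\<lambda>n. exp (- r) ^ n)"
      using r by (intro summable_geometric) auto
    then show ?thesis
      by (subst summable_on_UNIV_nonneg_real_iff) (auto simp: exp_of_nat_mult[symmetric] mult_ac)
  qed
  show ?thesis unfolding UN
  proof (rule summable_on_union)
    show "(\<lambda>m::int. exp (- r * \<bar>real_of_int m\<bar>)) summable_on range int"
      by (subst summable_on_reindex) (use g in \<open>auto simp: o_def inj_on_def\<close>)
    show "(\<lambda>m::int. exp (- r * \<bar>real_of_int m\<bar>)) summable_on range (\<lambda>n. - int n)"
      by (subst summable_on_reindex) (use g in \<open>auto simp: o_def inj_on_def\<close>)
  qed
qed

lemma summable_on_product2:
  fixes f :: "'a \<Rightarrow> real" and g :: "'b \<Rightarrow> real"
  assumes f: "f summable_on UNIV" "\<And>x. 0 \<le> f x" and g: "g summable_on UNIV" "\<And>x. 0 \<le> g x"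
  shows "(\<lambda>p. f (fst p) * g (snd p)) summable_on UNIV"
proof -
  have "(\<lambda>p. f (fst p) * g (snd p)) summable_on (SIGMA x:UNIV. UNIV)"
  proof (rule summable_on_SigmaI)
    show "((\<lambda>y. f (fst (x, y)) * g (snd (x, y))) has_sum f x * infsum g UNIV) UNIV" for x
      using has_sum_cmult_right[OF has_sum_infsum[OF g(1)], of "f x"] by simp
    show "(\<lambda>x. f x * infsum g UNIV) summable_on UNIV"
      by (intro summable_on_cmult_left f)
  qed (use f g in auto)
  then show ?thesis by simp
qed

text \<open>
  As \<open>3|k| \<ge> |k\<^sub>1| + |k\<^sub>2| + |k\<^sub>3|\<close>, a product of three geometric series is a majorant.
\<close>

lemma summable_exp_wavevec:
  assumes r: "r > 0"
  shows "(\<lambda>k. exp (- r * wn k)) summable_on UNIV"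
proof -
  define q where "q m = exp (- (r/3) * \<bar>real_of_int m\<bar>)" for m
  have q: "q summable_on UNIV" "\<And>m. 0 \<le> q m"
    using summable_exp_int[of "r/3"] r by (auto simp: q_def[abs_def])
  have "(\<lambda>p. q (fst p) * (q (fst (snd p)) * q (snd (snd p)))) summable_on UNIV"
    using summable_on_product2[OF q summable_on_product2[OF q q]] q by simp
  moreover have "bij_betw (\<lambda>k::int^3. (k $ 1, k $ 2, k $ 3)) UNIV UNIV"
    by (rule bij_betw_byWitness[where f' = "\<lambda>(a, b, c). vector [a, b, c]"]) (auto simp: vec_eq_iff forall_3)
  ultimately have s: "(\<lambda>k::int^3. q (k $ 1) * (q (k $ 2) * q (k $ 3))) summable_on UNIV"
    by (subst (asm) summable_on_reindex_bij_betw[symmetric]) auto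
  have "norm (exp (- r * wn k)) \<le> q (k $ 1) * (q (k $ 2) * q (k $ 3))" for k
  proof -
    have "- r * wn k \<le> - (r/3) * (\<bar>wavevec k $ 1\<bar> + \<bar>wavevec k $ 2\<bar> + \<bar>wavevec k $ 3\<bar>)"
      using mult_left_mono[OF norm_vec3_ge[of k], of "r/3"] r by simp
    then show ?thesis
      by (simp add: q_def exp_add[symmetric] algebra_simps)
  qed
  then have "(\<lambda>k. exp (- r * wn k)) abs_summable_on UNIV"
    by (intro Infinite_Sum.abs_summable_on_comparison_test'[OF s]) auto
  then show ?thesis by simp
qed

lemma mult_exp_le:
  assumes "0 < e" "0 \<le> (x::real)"
  shows "x \<le> (1 / e) * exp (e * x)"
proof -
  have "x * e \<le> exp (e * x)"
    using exp_ge_add_one_self[of "e * x"] unfolding mult.commute[of x e] by linarith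
  then show ?thesis
    using assms by (simp add: pos_le_divide_eq)
qed

text \<open>
  Coefficients with this property sum to a function that extends holomorphically to the strip
  \<open>|Im z| < R\<close>.
\<close>

definition decays :: "real \<Rightarrow> (int^3 \<Rightarrow> 'a::real_normed_vector) \<Rightarrow> bool" where
  "decays R c \<longleftrightarrow> (\<lambda>k. norm (c k) * exp (R * wn k)) summable_on UNIV"

lemma decays_bound:
  assumes d: "decays R c" and b: "\<And>k. norm (f k) \<le> C * (norm (c k) * exp (R * wn k))"
  shows "f abs_summable_on UNIV"
  by (rule Infinite_Sum.abs_summable_on_comparison_test'[where g = "\<lambda>k. C * (norm (c k) * exp (R * wn k))"])
    (use d b in \<open>auto simp: decays_def intro: summable_on_cmult_right\<close>)

lemma decays_mono:
  assumes "decays R c" "S \<le> R" "\<And>k. norm (d k) \<le> C * norm (c k)" "0 \<le> C"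
  shows "decays S d"
proof -
  have "(\<lambda>k. norm (d k) * exp (S * wn k)) abs_summable_on UNIV"
  proof (rule decays_bound[OF assms(1), where C = C])
    fix k
    have "norm (d k) * exp (S * wn k) \<le> (C * norm (c k)) * exp (R * wn k)"
      using assms by (intro mult_mono) (auto intro: mult_right_mono)
    then show "norm (norm (d k) * exp (S * wn k)) \<le> C * (norm (c k) * exp (R * wn k))"
      by (simp add: mult.assoc)
  qed
  then show ?thesis by (simp add: decays_def)
qed

lemma decays_le: "decays R c \<Longrightarrow> S \<le> R \<Longrightarrow> decays S c"
  by (rule decays_mono[where C = 1]) auto

lemma decays_nth: "decays R c \<Longrightarrow> decays R (\<lambda>k. c k $ i)"
  for c :: "int^3 \<Rightarrow> complex^3"
  by (rule decays_mono[where C = 1]) (auto intro: Finite_Cartesian_Product.norm_nth_le)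

lemma decays_summable: "decays R c \<Longrightarrow> 0 \<le> R \<Longrightarrow> c abs_summable_on UNIV"
  using decays_le[of R c 0] by (simp add: decays_def)

text \<open>
  Differentiation multiplies the coefficients by at most \<open>|k|\<close>, which an arbitrarily small loss of the
  exponential rate absorbs.
\<close>

lemma decays_derivative:
  assumes d: "decays R c" and S: "S < R" and b: "\<And>k. norm (f k) \<le> C * wn k * norm (c k)" and C: "0 \<le> C"
  shows "decays S f"
proof -
  have "(\<lambda>k. norm (f k) * exp (S * wn k)) abs_summable_on UNIV"
  proof (rule decays_bound[OF d, where C = "C * (1 / (R - S))"])
    fix k
    have "norm (f k) * exp (S * wn k)
        \<le> (C * (1 / (R - S) * exp ((R - S) * wn k)) * norm (c k)) * exp (S * wn k)"
      using S C by (intro mult_right_mono order_trans[OF b] mult_left_mono mult_exp_le) auto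
    also have "\<dots> = C * (1 / (R - S)) * (norm (c k) * (exp ((R - S) * wn k) * exp (S * wn k)))"
      by (simp only: mult_ac)
    also have "exp ((R - S) * wn k) * exp (S * wn k) = exp (R * wn k)"
      by (simp add: exp_add[symmetric] algebra_simps)
    finally show "norm (norm (f k) * exp (S * wn k))
        \<le> C * (1 / (R - S)) * (norm (c k) * exp (R * wn k))" by simp
  qed
  then show ?thesis by (simp add: decays_def)
qed

lemma has_sum_finite_sum:
  fixes f :: "'i \<Rightarrow> 'b \<Rightarrow> 'a::{topological_comm_monoid_add, t2_space}"
  assumes "finite I" "\<And>i. i \<in> I \<Longrightarrow> (f i has_sum S i) A"
  shows "((\<lambda>x. \<Sum>i\<in>I. f i x) has_sum (\<Sum>i\<in>I. S i)) A"
  using assms by (induction I rule: finite_induct) (auto intro!: has_sum_add)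

lemma has_sum_minus:
  fixes f :: "'b \<Rightarrow> 'a::real_normed_vector"
  assumes "(f has_sum a) A" "(g has_sum b) A"
  shows "((\<lambda>x. f x - g x) has_sum (a - b)) A"
  using has_sum_add[OF assms(1), of "\<lambda>x. - g x" "- b"] assms(2) by (simp add: has_sum_uminus)

section \<open>Fourier series on complex space\<close>

definition phase :: "int^3 \<Rightarrow> complex^3 \<Rightarrow> complex" where
  "phase k z = (\<Sum>j\<in>UNIV. of_int (k $ j) * z $ j)"

definition Im_vec :: "complex^3 \<Rightarrow> real^3" where
  "Im_vec z = (\<chi> j. Im (z $ j))"

definition series :: "(int^3 \<Rightarrow> complex) \<Rightarrow> complex^3 \<Rightarrow> complex" where
  "series c z = (\<Sum>\<^sub>\<infinity>k. c k * exp (\<i> * phase k z))"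

lemma phase_add: "phase k (z + w) = phase k z + phase k w"
  by (simp add: phase_def distrib_left sum.distrib)

lemma phase_cvec: "phase k (cvec x) = complex_of_real (wavevec k \<bullet> x)"
  by (simp add: phase_def cvec_def inner_vec_def)

lemma exp_phase_cvec: "exp (\<i> * phase k (cvec x)) = fmode k x"
  by (simp add: fmode_def phase_cvec cis_conv_exp)

lemma series_cvec: "series c (cvec x) = (\<Sum>\<^sub>\<infinity>k. c k * fmode k x)"
  by (simp add: series_def exp_phase_cvec)

lemma Im_phase: "Im (phase k z) = wavevec k \<bullet> Im_vec z"
  by (simp add: phase_def Im_vec_def inner_vec_def)

lemma norm_exp_phase: "norm (exp (\<i> * phase k z)) \<le> exp (wn k * norm (Im_vec z))"
proof -
  have "- (wavevec k \<bullet> Im_vec z) \<le> wn k * norm (Im_vec z)"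
    using Cauchy_Schwarz_ineq2[of "wavevec k" "Im_vec z"] by linarith
  then show ?thesis by (simp add: Im_phase)
qed

lemma norm_phase: "norm (phase k z) \<le> 3 * wn k * norm z"
proof -
  have "norm (phase k z) \<le> (\<Sum>j\<in>(UNIV::3 set). wn k * norm z)"
    unfolding phase_def
  proof (rule sum_norm_le)
    fix j :: 3
    have "\<bar>wavevec k $ j\<bar> \<le> wn k" by (rule component_le_norm_cart)
    then show "norm (of_int (k $ j) * z $ j) \<le> wn k * norm z"
      unfolding norm_mult by (intro mult_mono Finite_Cartesian_Product.norm_nth_le) auto
  qed
  then show ?thesis by simp
qed

lemma series_abs_summable:
  assumes "decays R c" "norm (Im_vec z) \<le> R"
  shows "(\<lambda>k. c k * exp (\<i> * phase k z)) abs_summable_on UNIV"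
proof (rule decays_bound[OF assms(1), where C = 1])
  fix k
  have "norm (exp (\<i> * phase k z)) \<le> exp (R * wn k)"
    using norm_exp_phase[of k z] mult_left_mono[OF assms(2), of "wn k"]
    by (smt (verit) exp_le_cancel_iff mult.commute norm_ge_zero)
  then show "norm (c k * exp (\<i> * phase k z)) \<le> 1 * (norm (c k) * exp (R * wn k))"
    by (simp add: norm_mult mult_left_mono)
qed

lemma Im_vec_cvec [simp]: "Im_vec (cvec x) = 0"
  by (simp add: Im_vec_def cvec_def vec_eq_iff)

lemma norm_exp_minus: "norm (exp w - 1 - w) \<le> exp (norm w) * (norm w)\<^sup>2" for w :: complex
  using Taylor_exp_field[of w 1] by (simp add: numeral_2_eq_2 algebra_simps)

text \<open>
  Termwise, \<open>|e\<^bsup>w\<^esup> - 1 - w| \<le> e\<^bsup>|w|\<^esup> |w|\<^sup>2\<close> with \<open>w = i k \<cdot> h\<close>.  The factors \<open>|k|\<^sup>2\<close> and \<open>e\<^bsup>|w|\<^esup>\<close> are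
  absorbed by the gap between \<open>|Im z|\<close> and \<open>R\<close>, so the remainder is quadratic in \<open>h\<close>.
\<close>

lemma series_has_derivative:
  assumes d: "decays R c" and z: "norm (Im_vec z) < R"
  shows "(series c has_derivative (\<lambda>h. \<Sum>j\<in>UNIV. h $ j * series (\<lambda>k. \<i> * of_int (k $ j) * c k) z)) (at z)"
    (is "(_ has_derivative ?D) _")
proof -
  define r where "r = norm (Im_vec z)"
  \<comment> \<open>A quarter of the gap absorbs \<open>|k|\<^sup>2\<close>, another one the exponential of the remainder estimate.\<close>
  define e where "e = (R - r) / 4"
  have e: "0 < e" "r + 3 * e \<le> R" "r + 4 * e = R" and r: "0 \<le> r"
    using z by (simp_all add: e_def r_def field_simps)
  define K where "K = (\<Sum>\<^sub>\<infinity>k. (9 / e\<^sup>2) * 4 * (norm (c k) * exp (R * wn k)))"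
  have sumK: "(\<lambda>k. (9 / e\<^sup>2) * 4 * (norm (c k) * exp (R * wn k))) summable_on UNIV"
    using d by (intro summable_on_cmult_right) (simp add: decays_def)
  have dj: "decays r (\<lambda>k. \<i> * of_int (k $ j) * c k)" for j
  proof (rule decays_derivative[OF d, where C = 1])
    show "r < R" using z by (simp add: r_def)
    fix k
    have "\<bar>wavevec k $ j\<bar> \<le> wn k" by (rule component_le_norm_cart)
    then show "norm (\<i> * of_int (k $ j) * c k) \<le> 1 * wn k * norm (c k)"
      by (simp add: norm_mult mult_right_mono)
  qed simp
  have Imv_add: "norm (Im_vec (z + h)) \<le> r + norm h" for h
  proof -
    have "Im_vec (z + h) = Im_vec z + Im_vec h" by (simp add: Im_vec_def vec_eq_iff)
    moreover have "norm (Im_vec h) \<le> norm h"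
      unfolding norm_vec_def by (rule L2_set_mono) (auto simp: Im_vec_def abs_Im_le_cmod)
    ultimately show ?thesis
      using norm_triangle_ineq[of "Im_vec z" "Im_vec h"] by (simp add: r_def)
  qed
  have Dsum: "?D h = (\<Sum>\<^sub>\<infinity>k. c k * exp (\<i> * phase k z) * (\<i> * phase k h))"
    and Dabs: "(\<lambda>k. c k * exp (\<i> * phase k z) * (\<i> * phase k h)) summable_on UNIV" for h
  proof -
    have hs: "((\<lambda>k. h $ j * (\<i> * of_int (k $ j) * c k * exp (\<i> * phase k z))) has_sum (h $ j * series (\<lambda>k. \<i> * of_int (k $ j) * c k) z)) UNIV" for j
      unfolding series_def
      by (rule has_sum_cmult_right, rule has_sum_infsum, rule abs_summable_summable, rule series_abs_summable[OF dj]) (simp add: r_def)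
    have "((\<lambda>k. \<Sum>j\<in>UNIV. h $ j * (\<i> * of_int (k $ j) * c k * exp (\<i> * phase k z))) has_sum ?D h) UNIV"
      by (rule has_sum_finite_sum) (use hs in auto)
    moreover have "(\<Sum>j\<in>UNIV. h $ j * (\<i> * of_int (k $ j) * c k * exp (\<i> * phase k z))) = c k * exp (\<i> * phase k z) * (\<i> * phase k h)" for k
      unfolding phase_def[of k h] sum_distrib_left by (simp only: mult_ac)
    ultimately have hD: "((\<lambda>k. c k * exp (\<i> * phase k z) * (\<i> * phase k h)) has_sum ?D h) UNIV"
      by simp
    show "?D h = (\<Sum>\<^sub>\<infinity>k. c k * exp (\<i> * phase k z) * (\<i> * phase k h))"
      using hD by (simp add: infsumI)
    show "(\<lambda>k. c k * exp (\<i> * phase k z) * (\<i> * phase k h)) summable_on UNIV"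
      using hD by (rule has_sum_imp_summable)
  qed
  have est: "norm (series c (z + h) - series c z - ?D h) \<le> K * (norm h)\<^sup>2" if h: "norm h \<le> e / 3" for h
  proof -
    have h1: "norm (Im_vec (z + h)) \<le> R" using Imv_add[of h] h e r by linarith
    have s1: "(\<lambda>k. c k * exp (\<i> * phase k (z + h))) summable_on UNIV"
      by (rule abs_summable_summable[OF series_abs_summable[OF d h1]])
    have s2: "(\<lambda>k. c k * exp (\<i> * phase k z)) summable_on UNIV"
      using z by (intro abs_summable_summable[OF series_abs_summable[OF d]]) auto
    have "series c (z + h) - series c z - ?D h
        = (\<Sum>\<^sub>\<infinity>k. c k * exp (\<i> * phase k (z + h)) - c k * exp (\<i> * phase k z) - c k * exp (\<i> * phase k z) * (\<i> * phase k h))"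
      unfolding Dsum unfolding series_def
      by (rule infsumI[symmetric]) (intro has_sum_minus has_sum_infsum s1 s2 Dabs)
    also have "\<dots> = (\<Sum>\<^sub>\<infinity>k. c k * exp (\<i> * phase k z) * (exp (\<i> * phase k h) - 1 - \<i> * phase k h))" (is "_ = infsum ?t _")
      by (simp add: phase_add distrib_left exp_add algebra_simps)
    finally have eq: "series c (z + h) - series c z - ?D h = infsum ?t UNIV" .
    have b: "norm (?t k) \<le> (9 / e\<^sup>2) * 4 * (norm (c k) * exp (R * wn k)) * (norm h)\<^sup>2" for k
    proof -
      let ?n = "wn k"
      have w: "norm (\<i> * phase k h) \<le> 3 * ?n * norm h"
        using norm_phase[of k h] by (simp add: norm_mult)
      have w2: "3 * ?n * norm h \<le> e * ?n"
        using mult_left_mono[OF h, of "3 * ?n"] by (simp add: mult_ac)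
      have x2: "?n\<^sup>2 \<le> (4 / e\<^sup>2) * exp (e * ?n)"
      proof -
        have "?n\<^sup>2 \<le> ((1 / (e / 2)) * exp ((e / 2) * ?n))\<^sup>2"
          using e by (intro power_mono mult_exp_le) auto
        also have "\<dots> = (4 / e\<^sup>2) * exp (e * ?n)"
          using e by (simp add: power_mult_distrib power_divide power2_eq_square exp_add[symmetric])
        finally show ?thesis .
      qed
      have "norm (exp (\<i> * phase k h) - 1 - \<i> * phase k h) \<le> exp (norm (\<i> * phase k h)) * (norm (\<i> * phase k h))\<^sup>2"
        by (rule norm_exp_minus)
      also have "\<dots> \<le> exp (e * ?n) * (3 * ?n * norm h)\<^sup>2"
        using w w2 by (intro mult_mono power_mono) auto
      also have "\<dots> = 9 * exp (e * ?n) * ?n\<^sup>2 * (norm h)\<^sup>2"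
        by (simp add: power_mult_distrib)
      also have "\<dots> \<le> 9 * exp (e * ?n) * ((4 / e\<^sup>2) * exp (e * ?n)) * (norm h)\<^sup>2"
        by (intro mult_right_mono mult_left_mono x2) auto
      finally have a: "norm (exp (\<i> * phase k h) - 1 - \<i> * phase k h) \<le> (9 / e\<^sup>2) * 4 * (exp (e * ?n) * exp (e * ?n)) * (norm h)\<^sup>2"
        by (simp add: mult_ac)
      have "norm (?t k) \<le> norm (c k) * exp (?n * r) * ((9 / e\<^sup>2) * 4 * (exp (e * ?n) * exp (e * ?n)) * (norm h)\<^sup>2)"
        unfolding norm_mult[of "c k * _"] norm_mult[of "c k"]
        using norm_exp_phase[of k z] by (intro mult_mono a mult_left_mono) (auto simp: r_def)
      also have "\<dots> = (9 / e\<^sup>2) * 4 * (norm (c k) * (exp (?n * r) * (exp (e * ?n) * exp (e * ?n)))) * (norm h)\<^sup>2"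
        by (simp only: mult_ac)
      also have "\<dots> \<le> (9 / e\<^sup>2) * 4 * (norm (c k) * exp (R * ?n)) * (norm h)\<^sup>2"
      proof -
        have "exp (?n * r) * (exp (e * ?n) * exp (e * ?n)) = exp ((r + 2 * e) * ?n)"
          by (simp add: exp_add[symmetric] algebra_simps)
        also have "\<dots> \<le> exp (R * ?n)"
          using e by (simp add: mult_right_mono)
        finally show ?thesis
          using e by (intro mult_right_mono mult_left_mono) auto
      qed
      finally show ?thesis .
    qed
    have sb: "(\<lambda>k. (9 / e\<^sup>2) * 4 * (norm (c k) * exp (R * wn k)) * (norm h)\<^sup>2) summable_on UNIV"
      by (intro summable_on_cmult_left sumK)
    have abst: "?t abs_summable_on UNIV"
      by (rule Infinite_Sum.abs_summable_on_comparison_test'[OF sb]) (use b in auto)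
    have "norm (infsum ?t UNIV) \<le> (\<Sum>\<^sub>\<infinity>k. norm (?t k))"
      by (rule norm_infsum_bound[OF abst])
    also have "\<dots> \<le> (\<Sum>\<^sub>\<infinity>k. (9 / e\<^sup>2) * 4 * (norm (c k) * exp (R * wn k)) * (norm h)\<^sup>2)"
      by (intro infsum_mono abst sb b)
    also have "\<dots> = K * (norm h)\<^sup>2"
      unfolding K_def by (rule infsum_cmult_left')
    finally show ?thesis unfolding eq .
  qed
  have K0: "0 \<le> K" unfolding K_def by (intro infsum_nonneg) auto
  have bl: "bounded_linear ?D"
    by (intro bounded_linear_sum bounded_linear_mult_const bounded_linear_vec_nth)
  show ?thesis
    unfolding has_derivative_at
  proof (intro conjI bl)
    show "(\<lambda>h. norm (series c (z + h) - series c z - ?D h) / norm h) \<midarrow>0\<rightarrow> 0"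
    proof (rule Lim_null_comparison)
      show "\<forall>\<^sub>F h in at 0. norm (norm (series c (z + h) - series c z - ?D h) / norm h) \<le> K * norm h"
        unfolding eventually_at
      proof (intro exI[of _ "e / 3"] conjI ballI impI)
        fix h :: "complex^3" assume h: "h \<noteq> 0 \<and> dist h 0 < e / 3"
        then have "norm (series c (z + h) - series c z - ?D h) \<le> K * (norm h)\<^sup>2"
          by (intro est) auto
        then show "norm (norm (series c (z + h) - series c z - ?D h) / norm h) \<le> K * norm h"
          using h by (simp add: divide_le_eq power2_eq_square mult.assoc)
      qed (use e in auto)
      show "((\<lambda>h. K * norm h) \<longlongrightarrow> 0) (at 0)"
        by (auto intro!: tendsto_eq_intros)
    qed
  qed
qed

section \<open>Integrals of Fourier series\<close>

lemma infinite_modes: "infinite (UNIV :: (int^3) set)"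
proof -
  have "inj (\<lambda>n::nat. (\<chi> i. int n) :: int^3)"
    by (auto simp: inj_on_def vec_eq_iff)
  from infinite_super[OF subset_UNIV range_inj_infinite[OF this]] show ?thesis .
qed

text \<open>
  Sums over modes are taken in this order where countable additivity or monotone convergence in the
  other variable is involved.
\<close>

definition enum_modes :: "nat \<Rightarrow> int^3" where
  "enum_modes = from_nat_into UNIV"

lemma bij_enum_modes: "bij_betw enum_modes UNIV UNIV"
  unfolding enum_modes_def by (rule bij_betw_from_nat_into) (use infinite_modes in \<open>auto simp: countableI_type\<close>)

lemma enum_modes_sums:
  fixes f :: "int^3 \<Rightarrow> 'a::banach"
  assumes "f abs_summable_on UNIV"
  shows "(\<lambda>n. f (enum_modes n)) sums infsum f UNIV"
proof -
  have "(f has_sum infsum f UNIV) UNIV"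
    by (rule has_sum_infsum[OF abs_summable_summable[OF assms]])
  then have "((\<lambda>n. f (enum_modes n)) has_sum infsum f UNIV) UNIV"
    using has_sum_reindex_bij_betw[OF bij_enum_modes, of f] by simp
  then show ?thesis by (rule has_sum_imp_sums)
qed

text \<open>
  The theorem for sequences, read along the enumeration of the modes.
\<close>

lemma integral_infsum:
  fixes f :: "int^3 \<Rightarrow> 'a \<Rightarrow> complex"
  assumes f: "\<And>k. integrable M (f k)"
    and s: "(\<lambda>k. LINT x|M. norm (f k x)) summable_on UNIV"
    and p: "\<And>x. (\<lambda>k. f k x) abs_summable_on UNIV"
  shows "integrable M (\<lambda>x. \<Sum>\<^sub>\<infinity>k. f k x)" "(LINT x|M. (\<Sum>\<^sub>\<infinity>k. f k x)) = (\<Sum>\<^sub>\<infinity>k. LINT x|M. f k x)"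
    "(\<lambda>k. LINT x|M. f k x) abs_summable_on UNIV"
proof -
  have e: "(\<Sum>n. f (enum_modes n) x) = (\<Sum>\<^sub>\<infinity>k. f k x)" for x
    using enum_modes_sums[OF p] by (simp add: sums_iff)
  have 1: "AE x in M. summable (\<lambda>n. norm (f (enum_modes n) x))"
    using enum_modes_sums[of "\<lambda>k. norm (f k _)"] p by (auto simp: sums_iff intro!: AE_I2)
  have 2: "summable (\<lambda>n. LINT x|M. norm (f (enum_modes n) x))"
    using enum_modes_sums[of "\<lambda>k. LINT x|M. norm (f k x)"] s by (auto simp: sums_iff)
  show "integrable M (\<lambda>x. \<Sum>\<^sub>\<infinity>k. f k x)"
    using integrable_suminf[OF f 1 2] by (simp add: e)
  show a: "(\<lambda>k. LINT x|M. f k x) abs_summable_on UNIV"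
    by (rule Infinite_Sum.abs_summable_on_comparison_test'[OF s]) (rule integral_norm_bound)
  show "(LINT x|M. (\<Sum>\<^sub>\<infinity>k. f k x)) = (\<Sum>\<^sub>\<infinity>k. LINT x|M. f k x)"
    using integral_suminf[OF f 1 2] enum_modes_sums[OF a] by (simp add: e sums_iff)
qed

lemma integral_series:
  fixes \<psi> :: "real^3 \<Rightarrow> complex"
  assumes c: "decays 0 c" and \<psi>: "integrable torus \<psi>"
  shows "integrable torus (\<lambda>x. series c (cvec x) * \<psi> x)"
    "(LINT x|torus. series c (cvec x) * \<psi> x) = (\<Sum>\<^sub>\<infinity>k. c k * (LINT x|torus. fmode k x * \<psi> x))"
    "(\<lambda>k. c k * (LINT x|torus. fmode k x * \<psi> x)) abs_summable_on UNIV"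
proof -
  have eq: "series c (cvec x) * \<psi> x = (\<Sum>\<^sub>\<infinity>k. c k * fmode k x * \<psi> x)" for x
    by (simp add: series_cvec infsum_cmult_left')
  have cs: "c abs_summable_on UNIV" using c by (intro decays_summable) auto
  have "(\<lambda>k. norm (c k) * (LINT x|torus. norm (\<psi> x))) summable_on UNIV"
    using cs by (rule summable_on_cmult_left)
  then have 2: "(\<lambda>k. LINT x|torus. norm (c k * fmode k x * \<psi> x)) summable_on UNIV"
    by (simp add: norm_mult)
  have 3: "(\<lambda>k. c k * fmode k x * \<psi> x) abs_summable_on UNIV" for x
    using summable_on_cmult_left[OF cs, of "norm (\<psi> x)"] by (simp add: norm_mult)
  have 1: "integrable torus (\<lambda>x. c k * fmode k x * \<psi> x)" for k
    unfolding mult.assoc using \<psi> by (intro integrable_mult_right torus_integrable_fmode)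
  have 4: "(LINT x|torus. c k * fmode k x * \<psi> x) = c k * (LINT x|torus. fmode k x * \<psi> x)" for k
    unfolding mult.assoc by simp
  note I = integral_infsum[OF 1 2 3]
  show "integrable torus (\<lambda>x. series c (cvec x) * \<psi> x)"
    "(LINT x|torus. series c (cvec x) * \<psi> x) = (\<Sum>\<^sub>\<infinity>k. c k * (LINT x|torus. fmode k x * \<psi> x))"
    "(\<lambda>k. c k * (LINT x|torus. fmode k x * \<psi> x)) abs_summable_on UNIV"
    using I by (simp_all add: eq 4)
qed

lemma scoeff_series:
  assumes c: "decays 0 c"
  shows "scoeff (\<lambda>x. series c (cvec x)) k = c k"
proof -
  have i: "integrable torus (fmode (- k))" by (simp add: torus_integrable_continuous fmode_continuous)
  have "(LINT x|torus. series c (cvec x) * fmode (- k) x) = (\<Sum>\<^sub>\<infinity>l. c l * (LINT x|torus. fmode l x * fmode (- k) x))"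
    by (rule integral_series[OF c i])
  also have "(\<lambda>l. c l * (LINT x|torus. fmode l x * fmode (- k) x)) = (\<lambda>l. if l = k then c k * complex_of_real ((2 * pi) ^ 3) else 0)"
    by (rule ext) (simp add: fmode_add[symmetric] integral_fmode)
  also have "(\<Sum>\<^sub>\<infinity>l. if l = k then c k * complex_of_real ((2 * pi) ^ 3) else 0) = (\<Sum>\<^sub>\<infinity>l\<in>{k}. c k * complex_of_real ((2 * pi) ^ 3))"
    by (rule infsum_cong_neutral) auto
  finally show ?thesis by (simp add: scoeff_def)
qed

definition hermitian :: "(int^3 \<Rightarrow> complex) \<Rightarrow> bool" where
  "hermitian c \<longleftrightarrow> (\<forall>k. c (- k) = cnj (c k))"

lemma hermitian_scoeff_real: "hermitian (scoeff (\<lambda>x. complex_of_real (g x)))"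
proof -
  have "scoeff (\<lambda>x. complex_of_real (g x)) (- k) = cnj (scoeff (\<lambda>x. complex_of_real (g x)) k)" for k
  proof -
    have "cnj (LINT x|torus. complex_of_real (g x) * fmode (- k) x) = (LINT x|torus. complex_of_real (g x) * fmode k x)"
      by (subst Bochner_Integration.integral_cnj[symmetric]) (simp add: cnj_fmode)
    then show ?thesis by (simp add: scoeff_def)
  qed
  then show ?thesis by (simp add: hermitian_def)
qed

lemma series_real:
  assumes "hermitian c"
  shows "complex_of_real (Re (series c (cvec x))) = series c (cvec x)"
proof -
  have "cnj (series c (cvec x)) = (\<Sum>\<^sub>\<infinity>k. c (- k) * fmode (- k) x)"
    using assms by (simp add: series_cvec hermitian_def cnj_fmode infsum_cnj[symmetric] del: infsum_cnj)
  also have "\<dots> = (\<Sum>\<^sub>\<infinity>k. c k * fmode k x)"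
    by (rule infsum_reindex_bij_betw) (rule bij_betw_byWitness[where f' = uminus]; simp)
  finally show ?thesis
    by (simp add: series_cvec complex_eq_iff)
qed

section \<open>Vector fields given by Fourier series\<close>

abbreviation volume :: real where "volume \<equiv> (2 * pi) ^ 3"

text \<open>
  For coefficients with \<open>c (- k) = cnj (c k)\<close> the series is real and taking the real part changes
  nothing.
\<close>

definition field_of :: "(int^3 \<Rightarrow> complex^3) \<Rightarrow> real^3 \<Rightarrow> real^3" where
  "field_of c x = (\<chi> i. Re (series (\<lambda>k. c k $ i) (cvec x)))"

definition hermitian_vec :: "(int^3 \<Rightarrow> complex^3) \<Rightarrow> bool" where
  "hermitian_vec c \<longleftrightarrow> (\<forall>i. hermitian (\<lambda>k. c k $ i))"

definition deriv_coeff :: "3 \<Rightarrow> (int^3 \<Rightarrow> complex^3) \<Rightarrow> int^3 \<Rightarrow> complex^3" where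
  "deriv_coeff j c k = (\<chi> i. \<i> * of_int (k $ j) * c k $ i)"

definition wave_dot :: "int^3 \<Rightarrow> complex^3 \<Rightarrow> complex" where
  "wave_dot k a = (\<Sum>j\<in>UNIV. of_int (k $ j) * a $ j)"

lemma volume_pos [simp]: "0 < volume" "volume \<noteq> 0" "0 \<le> volume"
  by simp_all

lemma bounded_linear_cvec: "bounded_linear cvec"
proof -
  have "linear cvec"
    by (rule linearI) (auto simp: cvec_def vec_eq_iff complex_eq_iff)
  then show ?thesis by (rule linear_conv_bounded_linear[THEN iffD1])
qed

lemma norm_vec_nth_le: "norm (a $ i) \<le> norm a"
  by (rule Finite_Cartesian_Product.norm_nth_le)

lemma wavevec_component_le: "\<bar>real_of_int (k $ j)\<bar> \<le> wn k"
  using component_le_norm_cart[of "wavevec k" j] by simp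

lemma norm_sq_vec3: "(norm a)\<^sup>2 = (\<Sum>i\<in>UNIV. (norm (a $ i))\<^sup>2)" for a :: "complex^3"
  by (simp add: norm_vec_def L2_set_def sum_nonneg)

lemma norm_le_sum: "norm a \<le> (\<Sum>i\<in>UNIV. norm (a $ i))" for a :: "complex^3"
  unfolding norm_vec_def by (rule L2_set_le_sum) auto

lemma norm_sq_vec3_real: "(norm a)\<^sup>2 = (\<Sum>i\<in>UNIV. (a $ i)\<^sup>2)" for a :: "real^3"
  by (simp add: norm_vec_def L2_set_def sum_nonneg)

lemma decays_0: "decays R c \<Longrightarrow> 0 < R \<Longrightarrow> decays 0 c"
  by (rule decays_le[of R]) auto

lemma decays_deriv_coeff:
  assumes "decays R c" "S < R"
  shows "decays S (deriv_coeff j c)"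
proof (rule decays_derivative[OF assms, where C = 3])
  fix k
  have "norm (deriv_coeff j c k $ i) \<le> wn k * norm (c k)" for i
    by (auto simp: deriv_coeff_def norm_mult intro!: mult_mono norm_vec_nth_le wavevec_component_le)
  then have "norm (deriv_coeff j c k) \<le> (\<Sum>i\<in>(UNIV::3 set). wn k * norm (c k))"
    by (intro order_trans[OF norm_le_sum] sum_mono)
  then show "norm (deriv_coeff j c k) \<le> 3 * wn k * norm (c k)"
    by simp
qed simp

lemma field_of_GDERIV:
  assumes "decays R c" "0 < R"
  shows "GDERIV (\<lambda>x. field_of c x $ i) x :> (\<chi> j. field_of (deriv_coeff j c) x $ i)"
proof -
  have "(series (\<lambda>k. c k $ i) has_derivative (\<lambda>h. \<Sum>j\<in>UNIV. h $ j * series (\<lambda>k. \<i> * of_int (k $ j) * c k $ i) (cvec x))) (at (cvec x))"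
    by (rule series_has_derivative[OF decays_nth[OF assms(1)]]) (use assms in simp)
  from has_derivative_Re[OF has_derivative_compose[OF bounded_linear_imp_has_derivative[OF bounded_linear_cvec] this]]
  have "((\<lambda>x. Re (series (\<lambda>k. c k $ i) (cvec x))) has_derivative
      (\<lambda>h. Re (\<Sum>j\<in>UNIV. cvec h $ j * series (\<lambda>k. \<i> * of_int (k $ j) * c k $ i) (cvec x)))) (at x)" .
  then show ?thesis
    by (simp add: gderiv_def field_of_def deriv_coeff_def inner_vec_def cvec_def mult.commute)
qed

lemma field_of_continuous:
  assumes "decays R c" "0 < R"
  shows "continuous_on S (field_of c)"
proof -
  have "continuous_on S (\<lambda>x. field_of c x $ i)" for i
    using field_of_GDERIV[OF assms]
    by (auto simp: gderiv_def intro!: has_derivative_continuous_on intro: has_derivative_at_withinI)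
  then show ?thesis
    using continuous_on_vec_lambda[of S "\<lambda>i x. field_of c x $ i"] by simp
qed

lemma field_of_continuous_nth:
  assumes "decays R c" "0 < R"
  shows "continuous_on S (\<lambda>x. field_of c x $ i)"
  by (intro continuous_intros field_of_continuous[OF assms])

lemma field_of_periodic: "periodic (field_of c)"
  using periodic_fmode by (simp add: periodic_def field_of_def series_cvec vec_eq_iff)

lemma field_of_test_fun:
  assumes "decays R c" "0 < R"
  shows "test_fun (\<lambda>x. field_of c x $ i) (\<lambda>x. \<chi> j. field_of (deriv_coeff j c) x $ i)"
proof -
  have "decays (R/2) (deriv_coeff j c)" for j
    using assms by (intro decays_deriv_coeff[OF assms(1)]) simp
  then have "continuous_on UNIV (\<lambda>x. field_of (deriv_coeff j c) x $ i)" for j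
    using assms by (intro field_of_continuous_nth[of "R/2"]) auto
  then have "continuous_on UNIV (\<lambda>x. \<chi> j. field_of (deriv_coeff j c) x $ i)"
    by (rule continuous_on_vec_lambda)
  then show ?thesis
    using field_of_GDERIV[OF assms] field_of_periodic[of c]
    by (simp add: test_fun_def periodic_def)
qed

lemma continuous_periodic_L2_per:
  assumes "periodic g" "continuous_on UNIV g"
  shows "g \<in> L2_per"
proof -
  have "g \<in> borel_measurable lebesgue"
    using borel_measurable_continuous_onI[OF assms(2)] by (simp add: measurable_completion)
  moreover have "integrable torus (\<lambda>x. (norm (g x))\<^sup>2)"
    by (intro torus_integrable_continuous continuous_intros continuous_on_subset[OF assms(2)]) auto
  ultimately show ?thesis
    using assms by (simp add: L2_per_def)
qed

lemma field_of_L2_per: "decays R c \<Longrightarrow> 0 < R \<Longrightarrow> field_of c \<in> L2_per"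
  by (intro continuous_periodic_L2_per field_of_periodic field_of_continuous)

lemma L2_per_measurable: "g \<in> L2_per \<Longrightarrow> g \<in> borel_measurable torus"
  by (simp add: L2_per_def measurable_restrict_space1)

lemma measurable_vec_nth [measurable (raw)]:
  fixes g :: "'a \<Rightarrow> ('b::euclidean_space)^'n"
  assumes "g \<in> borel_measurable M"
  shows "(\<lambda>x. g x $ i) \<in> borel_measurable M"
  by (rule measurable_compose[OF assms, of "\<lambda>v. v $ i" borel])
    (intro borel_measurable_continuous_onI continuous_intros)

lemma L2_per_integrable: "g \<in> L2_per \<Longrightarrow> integrable torus g"
  by (rule integrable_norm_of_square) (auto simp: L2_per_measurable, simp add: L2_per_def)

lemma L2_per_integrable_nth: "g \<in> L2_per \<Longrightarrow> integrable torus (\<lambda>x. g x $ i)"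
  using integrable_bounded_linear[OF bounded_linear_vec_nth L2_per_integrable] by blast

lemma L2_per_integrable_nth_complex: "g \<in> L2_per \<Longrightarrow> integrable torus (\<lambda>x. complex_of_real (g x $ i))"
  by (simp add: L2_per_integrable_nth)

lemma L2_per_inner_integrable:
  assumes "g \<in> L2_per" "h \<in> L2_per"
  shows "integrable torus (\<lambda>x. g x \<bullet> h x)"
proof (rule Bochner_Integration.integrable_bound)
  show "integrable torus (\<lambda>x. (norm (g x))\<^sup>2 + (norm (h x))\<^sup>2)"
    using assms by (simp add: L2_per_def)
  show "(\<lambda>x. g x \<bullet> h x) \<in> borel_measurable torus"
    using assms[THEN L2_per_measurable] by measurable
  have "\<bar>a \<bullet> b\<bar> \<le> (norm a)\<^sup>2 + (norm b)\<^sup>2" for a b :: "real^3"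
  proof -
    have "\<bar>a \<bullet> b\<bar> \<le> norm a * norm b" by (rule Cauchy_Schwarz_ineq2)
    also have "\<dots> \<le> 2 * (norm a * norm b)" by simp
    also have "\<dots> \<le> (norm a)\<^sup>2 + (norm b)\<^sup>2"
      using sum_squares_bound[of "norm a" "norm b"] by simp
    finally show ?thesis .
  qed
  then show "AE x in torus. norm (g x \<bullet> h x) \<le> norm ((norm (g x))\<^sup>2 + (norm (h x))\<^sup>2)"
    by simp
qed

lemma hermitian_fourier_coeff: "hermitian_vec (fourier_coeff g)"
  by (simp add: hermitian_vec_def fourier_coeff_nth hermitian_scoeff_real)

lemma fourier_coeff_field_of:
  assumes "decays 0 c" "hermitian_vec c"
  shows "fourier_coeff (field_of c) = c"
proof -
  have "fourier_coeff (field_of c) k $ i = c k $ i" for k i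
    using assms scoeff_series[OF decays_nth[OF assms(1)], of i k]
    by (simp add: fourier_coeff_nth field_of_def series_real hermitian_vec_def)
  then show ?thesis by (simp add: vec_eq_iff fun_eq_iff)
qed

lemma scoeff_cong_AE:
  assumes "AE x in torus. g x = h x" "g \<in> borel_measurable torus" "h \<in> borel_measurable torus"
  shows "scoeff g k = scoeff h k"
proof -
  have [measurable]: "fmode (- k) \<in> borel_measurable torus" by (simp add: torus_measurable_borel)
  have "(LINT x|torus. g x * fmode (- k) x) = (LINT x|torus. h x * fmode (- k) x)"
    by (rule integral_cong_AE) (use assms in auto)
  then show ?thesis by (simp add: scoeff_def)
qed

lemma fourier_coeff_cong_AE:
  assumes "AE x in torus. g x = h x" "g \<in> borel_measurable torus" "h \<in> borel_measurable torus"
  shows "fourier_coeff g = fourier_coeff h"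
proof -
  have "fourier_coeff g k $ i = fourier_coeff h k $ i" for k i
    unfolding fourier_coeff_nth
    by (rule scoeff_cong_AE) (use assms in \<open>auto elim: eventually_mono\<close>)
  then show ?thesis by (simp add: vec_eq_iff fun_eq_iff)
qed

lemma L2_inner_cong_AE:
  assumes "AE x in torus. g x = g' x" "g \<in> borel_measurable torus" "g' \<in> borel_measurable torus"
    "h \<in> borel_measurable torus"
  shows "L2_inner g h = L2_inner g' h" "L2_inner h g = L2_inner h g'"
  unfolding L2_inner_def by (rule integral_cong_AE; use assms in \<open>auto elim: eventually_mono\<close>)+

lemma L2_norm_sq: "(L2_norm g)\<^sup>2 = L2_inner g g"
  by (simp add: L2_norm_def L2_inner_def power2_norm_eq_inner)

lemma L2_inner_commute: "L2_inner g h = L2_inner h g"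
  by (simp add: L2_inner_def inner_commute)

text \<open>
  Square integrable fields can be identified, almost everywhere, through their coefficients.
\<close>

lemma fourier_unique_AE:
  assumes "g \<in> L2_per" "h \<in> L2_per" "fourier_coeff g = fourier_coeff h"
  shows "AE x in torus. g x = h x"
proof -
  have "AE x in torus. g x $ i - h x $ i = 0" for i
  proof (rule fourier_uniqueness)
    show "integrable torus (\<lambda>x. g x $ i - h x $ i)"
      using assms by (intro Bochner_Integration.integrable_diff L2_per_integrable_nth)
    fix k
    have "scoeff (\<lambda>x. complex_of_real (g x $ i)) k = scoeff (\<lambda>x. complex_of_real (h x $ i)) k"
      using assms(3) by (metis fourier_coeff_nth)
    moreover have "scoeff (\<lambda>x. complex_of_real (g x $ i - h x $ i)) k
       = scoeff (\<lambda>x. complex_of_real (g x $ i)) k - scoeff (\<lambda>x. complex_of_real (h x $ i)) k"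
      using torus_integrable_fmode(2)[OF L2_per_integrable_nth_complex[OF assms(1)]]
        torus_integrable_fmode(2)[OF L2_per_integrable_nth_complex[OF assms(2)]]
      by (simp add: scoeff_def left_diff_distrib diff_divide_distrib)
    ultimately show "scoeff (\<lambda>x. complex_of_real (g x $ i - h x $ i)) k = 0" by simp
  qed
  then have "AE x in torus. \<forall>i. g x $ i - h x $ i = 0"
    by (subst AE_all_countable) auto
  then show ?thesis
    by eventually_elim (simp add: vec_eq_iff)
qed

lemma AE_eq_field_of:
  assumes "g \<in> L2_per" "decays R (fourier_coeff g)" "0 < R"
  shows "AE x in torus. g x = field_of (fourier_coeff g) x"
  by (rule fourier_unique_AE[OF assms(1) field_of_L2_per[OF assms(2,3)]
        fourier_coeff_field_of[OF decays_0[OF assms(2,3)] hermitian_fourier_coeff, symmetric]])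

text \<open>
  Parseval's identity; as one of the two series converges absolutely, it follows by integrating term by
  term.
\<close>

lemma L2_inner_field_of:
  assumes c: "decays R c" "0 < R" and v: "v \<in> L2_per"
  shows "(\<lambda>k. c k \<bullet> fourier_coeff v k) abs_summable_on UNIV"
    and "L2_inner (field_of c) v = volume * (\<Sum>\<^sub>\<infinity>k. c k \<bullet> fourier_coeff v k)"
proof -
  have c0: "decays 0 (\<lambda>k. c k $ i)" for i
    by (rule decays_nth[OF decays_0[OF c]])
  define I where "I i = (LINT x|torus. series (\<lambda>k. c k $ i) (cvec x) * complex_of_real (v x $ i))" for i
  note S = integral_series[OF c0 L2_per_integrable_nth_complex[OF v]]
  have ev: "(LINT x|torus. fmode k x * complex_of_real (v x $ i)) = volume * cnj (fourier_coeff v k $ i)" for k i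
  proof -
    have "(LINT x|torus. fmode k x * complex_of_real (v x $ i)) = volume * scoeff (\<lambda>x. complex_of_real (v x $ i)) (- k)"
      by (simp add: scoeff_def mult.commute)
    also have "scoeff (\<lambda>x. complex_of_real (v x $ i)) (- k) = cnj (fourier_coeff v k $ i)"
      using hermitian_scoeff_real[of "\<lambda>x. v x $ i"] by (simp add: hermitian_def fourier_coeff_nth)
    finally show ?thesis .
  qed
  have s: "(\<lambda>k. c k $ i * (volume * cnj (fourier_coeff v k $ i))) abs_summable_on UNIV" for i
    using S(3)[of i i] unfolding ev .
  have hs: "((\<lambda>k. Re (c k $ i * (volume * cnj (fourier_coeff v k $ i)))) has_sum Re (I i)) UNIV" for i
    unfolding I_def S(2) ev
    by (rule has_sum_Re[OF has_sum_infsum[OF abs_summable_summable[OF s]]])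
  have "((\<lambda>k. \<Sum>i\<in>UNIV. Re (c k $ i * (volume * cnj (fourier_coeff v k $ i)))) has_sum (\<Sum>i\<in>UNIV. Re (I i))) UNIV"
    by (rule has_sum_finite_sum) (use hs in auto)
  moreover have "(\<Sum>i\<in>UNIV. Re (c k $ i * (volume * cnj (fourier_coeff v k $ i)))) = volume * (c k \<bullet> fourier_coeff v k)" for k
  proof -
    have "Re (a * (complex_of_real V * cnj b)) = V * (a \<bullet> b)" for a b V
      by (simp add: inner_complex_def algebra_simps)
    then show ?thesis by (simp only: inner_vec_def sum_distrib_left)
  qed
  ultimately have hs2: "((\<lambda>k. volume * (c k \<bullet> fourier_coeff v k)) has_sum (\<Sum>i\<in>UNIV. Re (I i))) UNIV"
    by simp
  have "L2_inner (field_of c) v = (LINT x|torus. (\<Sum>i\<in>UNIV. Re (series (\<lambda>k. c k $ i) (cvec x) * complex_of_real (v x $ i))))"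
    by (simp add: L2_inner_def field_of_def inner_vec_def)
  also have "\<dots> = (\<Sum>i\<in>UNIV. LINT x|torus. Re (series (\<lambda>k. c k $ i) (cvec x) * complex_of_real (v x $ i)))"
    by (intro Bochner_Integration.integral_sum integrable_Re S)
  also have "\<dots> = (\<Sum>i\<in>UNIV. Re (I i))"
    unfolding I_def by (intro sum.cong refl integral_Re S)
  finally have L: "L2_inner (field_of c) v = (\<Sum>i\<in>UNIV. Re (I i))" .
  have "(\<Sum>\<^sub>\<infinity>k. volume * (c k \<bullet> fourier_coeff v k)) = L2_inner (field_of c) v"
    using hs2 L by (simp add: infsumI)
  then show "L2_inner (field_of c) v = volume * (\<Sum>\<^sub>\<infinity>k. c k \<bullet> fourier_coeff v k)"
    by (simp only: infsum_cmult_right')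
  have "(\<lambda>k. volume * (c k \<bullet> fourier_coeff v k)) summable_on UNIV"
    using hs2 by (rule has_sum_imp_summable)
  then have "(\<lambda>k. (1 / volume) * (volume * (c k \<bullet> fourier_coeff v k))) summable_on UNIV"
    by (rule summable_on_cmult_right)
  then have "(\<lambda>k. c k \<bullet> fourier_coeff v k) summable_on UNIV"
    by simp
  then show "(\<lambda>k. c k \<bullet> fourier_coeff v k) abs_summable_on UNIV"
    by (rule summable_on_iff_abs_summable_on_real[THEN iffD1])
qed

lemma bessel_vec:
  assumes g: "g \<in> L2_per" and F: "finite F"
  shows "(\<Sum>k\<in>F. (norm (fourier_coeff g k))\<^sup>2) \<le> (L2_norm g)\<^sup>2 / volume"
proof -
  have i: "integrable torus (\<lambda>x. (g x $ i)\<^sup>2)" for i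
  proof (rule Bochner_Integration.integrable_bound)
    show "integrable torus (\<lambda>x. (norm (g x))\<^sup>2)" using g by (simp add: L2_per_def)
    show "(\<lambda>x. (g x $ i)\<^sup>2) \<in> borel_measurable torus" using L2_per_measurable[OF g] by measurable
    have "(g x $ i)\<^sup>2 \<le> (norm (g x))\<^sup>2" for x
      using component_le_norm_cart[of "g x" i] by (metis abs_ge_zero power2_abs power_mono)
    then show "AE x in torus. norm ((g x $ i)\<^sup>2) \<le> norm ((norm (g x))\<^sup>2)" by simp
  qed
  have "(\<Sum>k\<in>F. (norm (fourier_coeff g k))\<^sup>2) = (\<Sum>i\<in>UNIV. \<Sum>k\<in>F. (norm (fourier_coeff g k $ i))\<^sup>2)"
    unfolding norm_sq_vec3 by (rule sum.swap)
  also have "\<dots> \<le> (\<Sum>i\<in>UNIV. (LINT x|torus. (norm (complex_of_real (g x $ i)))\<^sup>2) / volume)"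
    unfolding fourier_coeff_nth
    using L2_per_measurable[OF g] i by (intro sum_mono bessel F) auto
  also have "\<dots> = (\<Sum>i\<in>UNIV. LINT x|torus. (g x $ i)\<^sup>2) / volume"
    by (simp add: sum_divide_distrib)
  also have "(\<Sum>i\<in>UNIV. LINT x|torus. (g x $ i)\<^sup>2) = (LINT x|torus. (norm (g x))\<^sup>2)"
    unfolding norm_sq_vec3_real using i by (simp add: Bochner_Integration.integral_sum)
  also have "\<dots> = (L2_norm g)\<^sup>2"
    by (simp add: L2_norm_def)
  finally show ?thesis .
qed

section \<open>Fourier coefficients of solenoidal fields\<close>

lemma H_L2_per: "g \<in> H \<Longrightarrow> g \<in> L2_per"
  by (simp add: H_def)

lemma integral_vec_nth:
  fixes g :: "real^3 \<Rightarrow> real^3"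
  shows "integrable torus g \<Longrightarrow> (LINT x|torus. g x) $ i = (LINT x|torus. g x $ i)"
  using integral_bounded_linear[OF bounded_linear_vec_nth, of torus g i] by simp

lemma H_fourier_coeff_0:
  assumes "g \<in> H"
  shows "fourier_coeff g 0 = 0"
proof -
  have "(LINT x|torus. g x $ i) = 0" for i
    using integral_vec_nth[OF L2_per_integrable[OF H_L2_per[OF assms]], of i] assms by (simp add: H_def)
  then show ?thesis
    by (simp add: vec_eq_iff fourier_coeff_nth scoeff_def)
qed

lemma fourier_coeff_cos_sin:
  assumes "integrable torus g"
  shows "(LINT x|torus. complex_of_real (g x) * fmode (- k) x)
    = Complex (LINT x|torus. g x * cos (wavevec k \<bullet> x)) (- (LINT x|torus. g x * sin (wavevec k \<bullet> x)))"
proof -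
  have i: "integrable torus (\<lambda>x. complex_of_real (g x) * fmode (- k) x)"
    using assms by (intro torus_integrable_fmode) auto
  have "Re (LINT x|torus. complex_of_real (g x) * fmode (- k) x) = (LINT x|torus. Re (complex_of_real (g x) * fmode (- k) x))"
    "Im (LINT x|torus. complex_of_real (g x) * fmode (- k) x) = (LINT x|torus. Im (complex_of_real (g x) * fmode (- k) x))"
    by (rule integral_Re[OF i, symmetric], rule integral_Im[OF i, symmetric])
  then show ?thesis
    by (simp add: complex_eq_iff fmode_def)
qed

lemma div_freeD: "div_free g \<Longrightarrow> test_fun \<phi> G \<Longrightarrow> (LINT x|torus. g x \<bullet> G x) = 0"
  by (simp add: div_free_def)

text \<open>
  Test the vanishing divergence with the real and imaginary part of the mode.
\<close>

lemma H_wave_dot: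
  assumes "g \<in> H"
  shows "wave_dot k (fourier_coeff g k) = 0"
proof -
  have gi: "integrable torus (\<lambda>x. g x $ j)" for j
    using assms by (intro L2_per_integrable_nth H_L2_per)
  have bounded: "integrable torus (\<lambda>x. g x $ j * cos (wavevec k \<bullet> x))" "integrable torus (\<lambda>x. g x $ j * sin (wavevec k \<bullet> x))" for j
  proof -
    have "integrable torus (\<lambda>x. complex_of_real (g x $ j) * fmode k x)"
      using gi by (intro torus_integrable_fmode) auto
    from integrable_Re[OF this] integrable_Im[OF this]
    show "integrable torus (\<lambda>x. g x $ j * cos (wavevec k \<bullet> x))" "integrable torus (\<lambda>x. g x $ j * sin (wavevec k \<bullet> x))"
      by (simp_all add: fmode_def)
  qed
  have df: "div_free g" using assms by (simp add: H_def)
  have "0 = (LINT x|torus. g x \<bullet> (cos (wavevec k \<bullet> x) *\<^sub>R wavevec k))"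
    by (rule div_freeD[OF df test_fun_sin, symmetric])
  also have "\<dots> = (LINT x|torus. (\<Sum>j\<in>UNIV. real_of_int (k $ j) * (g x $ j * cos (wavevec k \<bullet> x))))"
    by (simp add: inner_vec_def mult_ac)
  also have "\<dots> = (\<Sum>j\<in>UNIV. real_of_int (k $ j) * (LINT x|torus. g x $ j * cos (wavevec k \<bullet> x)))"
    using bounded by (simp add: Bochner_Integration.integral_sum)
  finally have c: "(\<Sum>j\<in>UNIV. real_of_int (k $ j) * (LINT x|torus. g x $ j * cos (wavevec k \<bullet> x))) = 0" ..
  have "0 = (LINT x|torus. g x \<bullet> (- sin (wavevec k \<bullet> x) *\<^sub>R wavevec k))"
    by (rule div_freeD[OF df test_fun_cos, symmetric])
  also have "\<dots> = (LINT x|torus. (\<Sum>j\<in>UNIV. - real_of_int (k $ j) * (g x $ j * sin (wavevec k \<bullet> x))))"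
    by (simp add: inner_vec_def mult_ac sum_negf)
  also have "\<dots> = (\<Sum>j\<in>UNIV. - real_of_int (k $ j) * (LINT x|torus. g x $ j * sin (wavevec k \<bullet> x)))"
    using bounded by (simp add: Bochner_Integration.integral_sum)
  finally have s: "(\<Sum>j\<in>UNIV. - real_of_int (k $ j) * (LINT x|torus. g x $ j * sin (wavevec k \<bullet> x))) = 0" ..
  have "wave_dot k (fourier_coeff g k) = (\<Sum>j\<in>UNIV. of_int (k $ j) * (LINT x|torus. complex_of_real (g x $ j) * fmode (- k) x)) / volume"
    by (simp add: wave_dot_def fourier_coeff_nth scoeff_def sum_divide_distrib)
  also have "(\<Sum>j\<in>UNIV. of_int (k $ j) * (LINT x|torus. complex_of_real (g x $ j) * fmode (- k) x)) = 0"
    using c s by (simp add: fourier_coeff_cos_sin gi complex_eq_iff)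
  finally show ?thesis by simp
qed

text \<open>
  Orthogonality of the coefficients to the wave vectors says that the classical divergence of the series
  vanishes; integration by parts transfers this to the weak formulation.
\<close>

lemma field_of_in_H:
  assumes c: "decays R c" "0 < R" "hermitian_vec c" and z: "c 0 = 0" "\<And>k. wave_dot k (c k) = 0"
  shows "field_of c \<in> H"
proof -
  have L2: "field_of c \<in> L2_per" by (rule field_of_L2_per[OF c(1,2)])
  have fcc: "fourier_coeff (field_of c) = c"
    by (rule fourier_coeff_field_of[OF decays_0[OF c(1,2)] c(3)])
  have "(LINT x|torus. field_of c x $ i) = 0" for i
  proof -
    have "fourier_coeff (field_of c) 0 $ i = 0" using z fcc by simp
    then show ?thesis
      by (simp add: fourier_coeff_nth scoeff_def)
  qed
  then have mean: "(LINT x|torus. field_of c x) = 0"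
    by (simp add: vec_eq_iff integral_vec_nth L2_per_integrable[OF L2])
  have dd: "decays (R/2) (deriv_coeff i c)" for i
    using c by (intro decays_deriv_coeff[OF c(1)]) auto
  have div: "(\<Sum>i\<in>UNIV. field_of (deriv_coeff i c) x $ i) = 0" for x
  proof -
    have hs: "((\<lambda>k. deriv_coeff i c k $ i * exp (\<i> * phase k (cvec x))) has_sum series (\<lambda>k. deriv_coeff i c k $ i) (cvec x)) UNIV" for i
      unfolding series_def
      by (rule has_sum_infsum, rule abs_summable_summable, rule series_abs_summable[OF decays_nth[OF dd]]) (use c in simp)
    have "((\<lambda>k. \<Sum>i\<in>UNIV. deriv_coeff i c k $ i * exp (\<i> * phase k (cvec x))) has_sum (\<Sum>i\<in>UNIV. series (\<lambda>k. deriv_coeff i c k $ i) (cvec x))) UNIV"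
      by (rule has_sum_finite_sum) (use hs in auto)
    moreover have "(\<Sum>i\<in>UNIV. deriv_coeff i c k $ i * exp (\<i> * phase k (cvec x))) = \<i> * wave_dot k (c k) * exp (\<i> * phase k (cvec x))" for k
      by (simp add: deriv_coeff_def wave_dot_def sum_distrib_left sum_distrib_right mult_ac)
    ultimately have "((\<lambda>k. 0) has_sum (\<Sum>i\<in>UNIV. series (\<lambda>k. deriv_coeff i c k $ i) (cvec x))) (UNIV :: (int^3) set)"
      using z by simp
    then have "(\<Sum>i\<in>UNIV. series (\<lambda>k. deriv_coeff i c k $ i) (cvec x)) = 0"
      by (rule has_sum_unique) (rule has_sum_0, simp)
    then have "Re (\<Sum>i\<in>UNIV. series (\<lambda>k. deriv_coeff i c k $ i) (cvec x)) = 0" by simp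
    then show ?thesis by (simp add: field_of_def)
  qed
  have "div_free (field_of c)"
    unfolding div_free_def
  proof (intro allI impI)
    fix \<phi> G assume t: "test_fun \<phi> G"
    have cont: "continuous_on UNIV \<phi>" "continuous_on UNIV G"
      using t by (auto simp: test_fun_def gderiv_def intro!: has_derivative_continuous_on intro: has_derivative_at_withinI)
    have i1: "integrable torus (\<lambda>x. field_of c x $ i * G x $ i)" for i
      by (intro torus_integrable_continuous continuous_intros field_of_continuous[OF c(1,2)] continuous_on_subset[OF cont(2)]) auto
    have i2: "integrable torus (\<lambda>x. \<phi> x * field_of (deriv_coeff i c) x $ i)" for i
      by (intro torus_integrable_continuous continuous_intros field_of_continuous[OF dd] continuous_on_subset[OF cont(1)]) (use c in auto)
    have "(LINT x|torus. field_of c x \<bullet> G x) = (\<Sum>i\<in>UNIV. LINT x|torus. field_of c x $ i * G x $ i)"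
      using i1 by (simp add: inner_vec_def Bochner_Integration.integral_sum)
    also have "\<dots> = (\<Sum>i\<in>UNIV. - (LINT x|torus. \<phi> x * field_of (deriv_coeff i c) x $ i))"
      using integration_by_parts[OF field_of_test_fun[OF c(1,2)] t] by simp
    also have "\<dots> = - (LINT x|torus. (\<Sum>i\<in>UNIV. \<phi> x * field_of (deriv_coeff i c) x $ i))"
      using i2 by (simp add: Bochner_Integration.integral_sum sum_negf)
    also have "\<dots> = 0"
      by (simp add: sum_distrib_left[symmetric] div)
    finally show "(LINT x|torus. field_of c x \<bullet> G x) = 0" .
  qed
  then show ?thesis using L2 mean by (simp add: H_def)
qed

section \<open>Gevrey sums\<close>

abbreviation gterm :: "real \<Rightarrow> (int^3 \<Rightarrow> complex^3) \<Rightarrow> int^3 \<Rightarrow> real" where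
  "gterm r c k \<equiv> exp (2 * r * wn k) * (norm (c k))\<^sup>2"

text \<open>
  Up to the volume of the torus this is the squared norm of \<open>e\<^bsup>rA^(1/2)\<^esup>\<close> applied to the field with
  coefficients \<open>c\<close>.  It is defined for all \<open>c\<close>, with the value \<open>\<infinity>\<close> outside the domain.
\<close>

definition gevrey :: "real \<Rightarrow> (int^3 \<Rightarrow> complex^3) \<Rightarrow> ennreal" where
  "gevrey r c = (\<Sum>n. ennreal (gterm r c (enum_modes n)))"

lemma gevrey_finite:
  assumes "gevrey r c < top"
  shows "(\<lambda>k. gterm r c k) summable_on UNIV"
    and "gevrey r c = ennreal (\<Sum>\<^sub>\<infinity>k. gterm r c k)"
proof -
  let ?f = "\<lambda>k. gterm r c k"
  have s: "summable (\<lambda>n. ?f (enum_modes n))"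
    using assms by (intro summable_suminf_not_top) (auto simp: gevrey_def)
  then have "(\<lambda>n. ?f (enum_modes n)) summable_on UNIV"
    by (subst summable_on_UNIV_nonneg_real_iff) auto
  then show f: "?f summable_on UNIV"
    by (subst (asm) summable_on_reindex_bij_betw[OF bij_enum_modes, of ?f])
  have "(\<lambda>n. ?f (enum_modes n)) sums (\<Sum>\<^sub>\<infinity>k. ?f k)"
    by (rule enum_modes_sums) (use f in simp)
  then show "gevrey r c = ennreal (\<Sum>\<^sub>\<infinity>k. ?f k)"
    unfolding gevrey_def by (intro suminf_ennreal_eq) auto
qed

lemma gevrey_summable:
  assumes "(\<lambda>k. gterm r c k) summable_on UNIV"
  shows "gevrey r c = ennreal (\<Sum>\<^sub>\<infinity>k. gterm r c k)"
  unfolding gevrey_def by (intro suminf_ennreal_eq enum_modes_sums) (use assms in auto)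

lemma gevrey_partial: "gevrey r c = (SUP N. ennreal (\<Sum>k\<in>enum_modes ` {..<N}. gterm r c k))"
proof -
  have inj: "inj_on enum_modes A" for A
    using bij_enum_modes by (auto simp: bij_betw_def intro: inj_on_subset)
  have "(\<Sum>i<N. ennreal (gterm r c (enum_modes i)))
     = ennreal (\<Sum>k\<in>enum_modes ` {..<N}. gterm r c k)" for N
    by (subst sum_ennreal) (auto simp: sum.reindex[OF inj])
  then show ?thesis
    unfolding gevrey_def suminf_eq_SUP by simp
qed

lemma gevrey_le:
  assumes "\<And>F. finite F \<Longrightarrow> (\<Sum>k\<in>F. gterm r c k) \<le> D"
  shows "gevrey r c \<le> ennreal D"
  unfolding gevrey_partial by (intro SUP_least ennreal_leI assms) auto

lemma gevrey_mono:
  assumes "r \<le> s"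
  shows "gevrey r c \<le> gevrey s c"
  unfolding gevrey_def using assms
  by (intro suminf_le ennreal_leI mult_right_mono) (auto intro!: mult_right_mono)

text \<open>
  Logarithmic convexity in the exponent.
\<close>

lemma gevrey_Cauchy_Schwarz: "(gevrey ((a + b) / 2) c)\<^sup>2 \<le> gevrey a c * gevrey b c"
proof -
  let ?f = "\<lambda>a n. ennreal (exp (a * wn (enum_modes n)) * norm (c (enum_modes n)))"
  have e: "?f a n * ?f b n = ennreal (exp (2 * ((a + b) / 2) * wn (enum_modes n)) * (norm (c (enum_modes n)))\<^sup>2)" for a b n
  proof -
    have "exp (a * t) * x * (exp (b * t) * x) = exp (2 * ((a + b) / 2) * t) * x\<^sup>2" for t x :: real
    proof -
      have "2 * ((a + b) / 2) * t = a * t + b * t" by (simp add: field_simps)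
      then show ?thesis by (simp only: exp_add) (simp add: power2_eq_square mult_ac)
    qed
    then show ?thesis by (simp add: ennreal_mult[symmetric])
  qed
  have e2: "(?f a n)\<^sup>2 = ennreal (gterm a c (enum_modes n))" for a n
    using e[of a n a] by (simp add: power2_eq_square)
  have "(\<integral>\<^sup>+n. ?f a n * ?f b n \<partial>count_space UNIV)\<^sup>2 \<le> (\<integral>\<^sup>+n. (?f a n)\<^sup>2 \<partial>count_space UNIV) * (\<integral>\<^sup>+n. (?f b n)\<^sup>2 \<partial>count_space UNIV)"
    by (rule Cauchy_Schwarz_nn_integral) auto
  then show ?thesis
    unfolding e e2 nn_integral_count_space_nat gevrey_def .
qed

lemma gevrey_scale: "gevrey 0 (\<lambda>k. exp (r * wn k) *\<^sub>R c k) = gevrey r c"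
  unfolding gevrey_def
  by (intro suminf_cong arg_cong[where f = ennreal]) (simp add: power_mult_distrib exp_double[symmetric] mult.assoc)

text \<open>
  Square summability at rate \<open>s\<close> gives absolute summability at every smaller rate, by
  \<open>2xy \<le> x\<^sup>2 + y\<^sup>2\<close> with \<open>y = e\<^bsup>-(s-r)|k|\<^esup>\<close>.
\<close>

lemma decays_of_gevrey:
  assumes "gevrey s c < top" "r < s"
  shows "decays r c"
proof -
  have s1: "(\<lambda>k. gterm s c k) summable_on UNIV"
    by (rule gevrey_finite(1)[OF assms(1)])
  have s2: "(\<lambda>k. exp (- (2 * (s - r)) * wn k)) summable_on UNIV"
    using assms by (intro summable_exp_wavevec) auto
  have "(\<lambda>k. norm (c k) * exp (r * wn k)) abs_summable_on UNIV"
  proof (rule Infinite_Sum.abs_summable_on_comparison_test'[OF summable_on_add[OF s1 s2]])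
    fix k
    let ?n = "wn k"
    let ?x = "exp (s * ?n) * norm (c k)" and ?y = "exp (- (s - r) * ?n)"
    have "norm (c k) * exp (r * ?n) = ?x * ?y"
      by (simp add: mult_ac exp_add[symmetric]) (simp add: algebra_simps)
    also have "\<dots> \<le> 2 * ?x * ?y" by simp
    also have "\<dots> \<le> ?x\<^sup>2 + ?y\<^sup>2" by (rule sum_squares_bound)
    also have "\<dots> = exp (2 * s * ?n) * (norm (c k))\<^sup>2 + exp (- (2 * (s - r)) * ?n)"
      by (simp add: power_mult_distrib exp_double[symmetric] algebra_simps)
    finally show "norm (norm (c k) * exp (r * ?n)) \<le> exp (2 * s * ?n) * (norm (c k))\<^sup>2 + exp (- (2 * (s - r)) * ?n)"
      by simp
  qed
  then show ?thesis by (simp add: decays_def)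
qed

lemma decays_scale:
  assumes "decays (r + s) c"
  shows "decays s (\<lambda>k. exp (r * wn k) *\<^sub>R c k)"
  using assms by (simp add: decays_def exp_add distrib_right mult_ac)

lemma hermitian_scale:
  assumes "hermitian_vec c"
  shows "hermitian_vec (\<lambda>k. exp (r * wn k) *\<^sub>R c k)"
  using assms by (simp add: hermitian_vec_def hermitian_def)

lemma wave_dot_scaleR: "wave_dot k (r *\<^sub>R a) = r *\<^sub>R wave_dot k a"
  by (simp add: wave_dot_def scaleR_sum_right)

section \<open>The exponential operator\<close>

lemma is_expA_expA: "g \<in> dom_expA r \<Longrightarrow> is_expA r g (expA r g)"
  unfolding dom_expA_def expA_def by (simp add: someI_ex)

lemma expA_H: "g \<in> dom_expA r \<Longrightarrow> expA r g \<in> H"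
  using is_expA_expA by (auto simp: is_expA_def)

lemma dom_expA_H: "g \<in> dom_expA r \<Longrightarrow> g \<in> H"
  by (simp add: dom_expA_def)

lemma fourier_coeff_expA:
  "g \<in> dom_expA r \<Longrightarrow> fourier_coeff (expA r g) = (\<lambda>k. exp (r * wn k) *\<^sub>R fourier_coeff g k)"
  using is_expA_expA by (auto simp: is_expA_def fun_eq_iff)

lemma gevrey_0_le_L2_norm: "g \<in> L2_per \<Longrightarrow> gevrey 0 (fourier_coeff g) \<le> ennreal ((L2_norm g)\<^sup>2 / volume)"
  by (intro gevrey_le) (use bessel_vec in simp)

text \<open>
  Bessel's inequality for the field \<open>expA r g\<close>.
\<close>

lemma gevrey_le_expA:
  assumes "g \<in> dom_expA r"
  shows "gevrey r (fourier_coeff g) \<le> ennreal ((L2_norm (expA r g))\<^sup>2 / volume)"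
  using gevrey_0_le_L2_norm[OF H_L2_per[OF expA_H[OF assms]]]
  by (simp only: fourier_coeff_expA[OF assms] gevrey_scale)

text \<open>
  A little more than rate \<open>r\<close> makes the series with the coefficients of \<open>expA r g\<close> converge absolutely.  Its
  sum belongs to \<open>H\<close> and is a representative of \<open>expA r g\<close>.
\<close>

lemma expA_of_gevrey:
  assumes g: "g \<in> H" and p: "gevrey s (fourier_coeff g) < top" and rs: "r < s"
  defines "c \<equiv> \<lambda>k. exp (r * wn k) *\<^sub>R fourier_coeff g k"
  shows "g \<in> dom_expA r" "AE x in torus. expA r g x = field_of c x" "decays ((s - r) / 2) c"
proof -
  have "decays (r + (s - r) / 2) (fourier_coeff g)"
    using rs by (intro decays_of_gevrey[OF p]) (simp add: field_simps)
  then show d: "decays ((s - r) / 2) c"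
    unfolding c_def by (rule decays_scale)
  have pos: "0 < (s - r) / 2" using rs by simp
  have h: "hermitian_vec c"
    unfolding c_def by (intro hermitian_scale hermitian_fourier_coeff)
  have fH: "field_of c \<in> H"
    by (rule field_of_in_H[OF d pos h]) (use g in \<open>auto simp: c_def H_fourier_coeff_0 wave_dot_scaleR H_wave_dot\<close>)
  moreover have fcc: "fourier_coeff (field_of c) = c"
    by (rule fourier_coeff_field_of[OF decays_0[OF d pos] h])
  ultimately have "is_expA r g (field_of c)"
    by (simp add: is_expA_def c_def)
  then show dom: "g \<in> dom_expA r" using g by (auto simp: dom_expA_def)
  show "AE x in torus. expA r g x = field_of c x"
    by (rule fourier_unique_AE) (use fH fcc fourier_coeff_expA[OF dom] expA_H[OF dom] in \<open>auto simp: H_L2_per c_def\<close>)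
qed

lemma expA_inner:
  assumes g: "g \<in> H" and p: "gevrey s (fourier_coeff g) < top" and rs: "r < s" and v: "v \<in> L2_per"
  shows "L2_inner (expA r g) v = volume * (\<Sum>\<^sub>\<infinity>k. (exp (r * wn k) *\<^sub>R fourier_coeff g k) \<bullet> fourier_coeff v k)"
    and "(\<lambda>k. (exp (r * wn k) *\<^sub>R fourier_coeff g k) \<bullet> fourier_coeff v k) abs_summable_on UNIV"
proof -
  note E = expA_of_gevrey[OF g p rs]
  have pos: "0 < (s - r) / 2" using rs by simp
  have "L2_inner (expA r g) v = L2_inner (field_of (\<lambda>k. exp (r * wn k) *\<^sub>R fourier_coeff g k)) v"
    by (rule L2_inner_cong_AE(1)[OF E(2)])
      (auto intro!: L2_per_measurable H_L2_per expA_H E(1) field_of_L2_per[OF E(3) pos] v[unfolded H_def])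
  then show "L2_inner (expA r g) v = volume * (\<Sum>\<^sub>\<infinity>k. (exp (r * wn k) *\<^sub>R fourier_coeff g k) \<bullet> fourier_coeff v k)"
    using L2_inner_field_of(2)[OF E(3) pos v] by simp
  show "(\<lambda>k. (exp (r * wn k) *\<^sub>R fourier_coeff g k) \<bullet> fourier_coeff v k) abs_summable_on UNIV"
    by (rule L2_inner_field_of(1)[OF E(3) pos v])
qed

lemma expA_norm:
  assumes g: "g \<in> H" and p: "gevrey s (fourier_coeff g) < top" and rs: "r < s"
  shows "ennreal ((L2_norm (expA r g))\<^sup>2) = ennreal volume * gevrey r (fourier_coeff g)"
proof -
  note E = expA_of_gevrey[OF g p rs]
  have fin: "gevrey r (fourier_coeff g) < top"
    using gevrey_mono[of r s] rs p by (meson less_imp_le order_le_less_trans)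
  have "(L2_norm (expA r g))\<^sup>2 = L2_inner (expA r g) (expA r g)"
    by (rule L2_norm_sq)
  also have "\<dots> = volume * (\<Sum>\<^sub>\<infinity>k. (exp (r * wn k) *\<^sub>R fourier_coeff g k) \<bullet> fourier_coeff (expA r g) k)"
    by (rule expA_inner(1)[OF g p rs H_L2_per[OF expA_H[OF E(1)]]])
  also have "\<dots> = volume * (\<Sum>\<^sub>\<infinity>k. exp (2 * r * wn k) * (norm (fourier_coeff g k))\<^sup>2)"
  proof -
    have "(exp (r * n) *\<^sub>R a) \<bullet> (exp (r * n) *\<^sub>R a) = exp (2 * r * n) * (norm a)\<^sup>2" for n and a :: "complex^3"
    proof -
      have "2 * r * n = r * n + r * n" by simp
      then show ?thesis by (simp only: exp_add) (simp add: power2_norm_eq_inner)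
    qed
    then show ?thesis unfolding fourier_coeff_expA[OF E(1)] by simp
  qed
  finally show ?thesis
    by (simp add: gevrey_finite(2)[OF fin] ennreal_mult'' infsum_nonneg)
qed

section \<open>Trigonometric test fields\<close>

text \<open>
  The component of \<open>a\<close> orthogonal to \<open>k\<close>: the Fourier symbol of the Leray projector.
\<close>

definition leray_symbol :: "int^3 \<Rightarrow> complex^3 \<Rightarrow> complex^3" where
  "leray_symbol k a = (\<chi> j. a $ j - wave_dot k a / complex_of_real ((wn k)\<^sup>2) * of_int (k $ j))"

lemma norm_wavevec_sq: "(wn k)\<^sup>2 = (\<Sum>j\<in>UNIV. (real_of_int (k $ j))\<^sup>2)"
  by (simp add: norm_sq_vec3_real)

lemma wave_dot_leray_symbol:
  assumes "k \<noteq> 0"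
  shows "wave_dot k (leray_symbol k a) = 0"
proof -
  define q where "q = wave_dot k a / complex_of_real ((wn k)\<^sup>2)"
  have "leray_symbol k a = (\<chi> j. a $ j - q * of_int (k $ j))"
    by (simp add: leray_symbol_def q_def)
  then have "wave_dot k (leray_symbol k a) = wave_dot k a - q * (\<Sum>j\<in>UNIV. of_int (k $ j) * of_int (k $ j))"
    by (simp add: wave_dot_def right_diff_distrib sum_subtractf sum_distrib_left mult_ac)
  also have "(\<Sum>j\<in>UNIV. of_int (k $ j) * of_int (k $ j)) = complex_of_real ((wn k)\<^sup>2)"
    unfolding norm_wavevec_sq by (simp add: power2_eq_square)
  also have "q * complex_of_real ((wn k)\<^sup>2) = wave_dot k a"
    using assms by (simp add: q_def)
  finally show ?thesis by simp
qed

text \<open>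
  The inner product is the real one, \<open>Re (\<Sum>\<^sub>j a\<^sub>j cnj b\<^sub>j)\<close>, here and below; multiples of \<open>k\<close> by
  complex scalars are orthogonal to \<open>b\<close> because \<open>k\<close> is real.
\<close>

lemma inner_parallel:
  assumes "wave_dot k b = 0"
  shows "(\<chi> j. q * of_int (k $ j)) \<bullet> b = 0"
proof -
  have i: "inner z w = Re (z * cnj w)" for z w :: complex
    by (simp add: inner_complex_def)
  have "(\<chi> j. q * of_int (k $ j)) \<bullet> b = Re (\<Sum>j\<in>UNIV. q * (of_int (k $ j) * cnj (b $ j)))"
    by (simp add: inner_vec_def i mult.assoc)
  also have "(\<Sum>j\<in>UNIV. q * (of_int (k $ j) * cnj (b $ j))) = q * cnj (wave_dot k b)"
    by (simp add: wave_dot_def sum_distrib_left)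
  finally show ?thesis using assms by simp
qed

lemma inner_leray_symbol:
  assumes "wave_dot k b = 0"
  shows "leray_symbol k a \<bullet> b = a \<bullet> b"
proof -
  have "leray_symbol k a = a - (\<chi> j. wave_dot k a / complex_of_real ((wn k)\<^sup>2) * of_int (k $ j))"
    by (simp add: leray_symbol_def vec_eq_iff)
  then show ?thesis
    by (simp only: inner_diff_left inner_parallel[OF assms] diff_zero)
qed

lemma norm_leray_symbol:
  assumes "k \<noteq> 0"
  shows "norm (leray_symbol k a) \<le> norm a"
proof -
  have "(norm (leray_symbol k a))\<^sup>2 = a \<bullet> leray_symbol k a"
    using inner_leray_symbol[OF wave_dot_leray_symbol[OF assms], of a a] by (simp add: power2_norm_eq_inner)
  also have "\<dots> \<le> norm a * norm (leray_symbol k a)"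
    by (rule norm_cauchy_schwarz)
  finally show ?thesis
    by (cases "leray_symbol k a = 0") (auto simp: power2_eq_square)
qed

definition cnj_vec :: "complex^3 \<Rightarrow> complex^3" where
  "cnj_vec a = (\<chi> i. cnj (a $ i))"

lemma cnj_vec_inner: "cnj_vec a \<bullet> cnj_vec b = a \<bullet> b"
  by (simp add: cnj_vec_def inner_vec_def inner_complex_def)

lemma hermitian_vec_iff: "hermitian_vec c \<longleftrightarrow> (\<forall>k. c (- k) = cnj_vec (c k))"
  by (auto simp: hermitian_vec_def hermitian_def cnj_vec_def vec_eq_iff)

lemma wave_dot_minus: "wave_dot (- k) a = - wave_dot k a"
  by (simp add: wave_dot_def sum_negf)

lemma wave_dot_cnj_vec: "wave_dot k (cnj_vec a) = cnj (wave_dot k a)"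
  by (simp add: wave_dot_def cnj_vec_def)

text \<open>
  The coefficients of a real solenoidal field supported on the modes \<open>k\<close> and \<open>-k\<close>.  Pairing with it reads
  off the component of the \<open>k\<close>-th coefficient in the direction \<open>e\<close>, as \<open>L2_inner_testfield_H\<close> shows.  For \<open>k = 0\<close> the
  field is zero, which matches the zero mean of the fields in \<open>H\<close>.
\<close>

definition testcoef :: "int^3 \<Rightarrow> complex^3 \<Rightarrow> int^3 \<Rightarrow> complex^3" where
  "testcoef k e l = (if k = 0 then 0 else if l = k then leray_symbol k e else if l = - k then cnj_vec (leray_symbol k e) else 0)"

abbreviation testfield :: "int^3 \<Rightarrow> complex^3 \<Rightarrow> real^3 \<Rightarrow> real^3" where
  "testfield k e \<equiv> field_of (testcoef k e)"

lemma minus_mode_neq: "k \<noteq> 0 \<Longrightarrow> - k \<noteq> k" for k :: "int^3"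
  by (auto simp: vec_eq_iff)

lemma decays_testcoef: "decays R (testcoef k e)"
  unfolding decays_def
  by (rule finite_nonzero_values_imp_summable_on, rule finite_subset[of _ "{k, - k}"]) (auto simp: testcoef_def)

lemma cnj_vec_simps [simp]: "cnj_vec (cnj_vec a) = a" "cnj_vec 0 = 0"
  by (simp_all add: cnj_vec_def vec_eq_iff)

lemma hermitian_testcoef: "hermitian_vec (testcoef k e)"
  unfolding hermitian_vec_iff
proof
  fix l
  consider "k = 0" | "k \<noteq> 0" "l = k" | "k \<noteq> 0" "l = - k" | "k \<noteq> 0" "l \<noteq> k" "l \<noteq> - k" "- l \<noteq> k" "- l \<noteq> - k"
    by (metis minus_minus)
  then show "testcoef k e (- l) = cnj_vec (testcoef k e l)"
    using minus_mode_neq[of k] by cases (simp_all add: testcoef_def)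
qed

lemma testfield_H: "testfield k e \<in> H"
  by (rule field_of_in_H[OF decays_testcoef[of 1]])
    (auto simp: hermitian_testcoef testcoef_def wave_dot_leray_symbol wave_dot_cnj_vec wave_dot_minus wave_dot_def[of _ 0])

lemma fourier_coeff_testfield: "fourier_coeff (testfield k e) = testcoef k e"
  by (rule fourier_coeff_field_of[OF decays_testcoef hermitian_testcoef])

lemma infsum_testcoef:
  assumes b: "hermitian_vec b" and w: "\<And>l. w (- l) = w l"
  shows "(\<Sum>\<^sub>\<infinity>l. (w l *\<^sub>R testcoef k e l) \<bullet> b l) = (if k = 0 then 0 else 2 * w k * (leray_symbol k e \<bullet> b k))"
proof (cases "k = 0")
  case True
  then show ?thesis by (simp add: testcoef_def)
next
  case False
  have "(\<Sum>\<^sub>\<infinity>l. (w l *\<^sub>R testcoef k e l) \<bullet> b l) = (\<Sum>\<^sub>\<infinity>l\<in>{k, - k}. (w l *\<^sub>R testcoef k e l) \<bullet> b l)"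
    by (rule infsum_cong_neutral) (auto simp: testcoef_def)
  also have "\<dots> = (w k *\<^sub>R testcoef k e k) \<bullet> b k + (w (- k) *\<^sub>R testcoef k e (- k)) \<bullet> b (- k)"
    using minus_mode_neq[OF False] by simp
  also have "\<dots> = 2 * w k * (leray_symbol k e \<bullet> b k)"
    using False minus_mode_neq[OF False] b by (simp add: testcoef_def w hermitian_vec_iff cnj_vec_inner)
  finally show ?thesis using False by simp
qed

lemma L2_inner_testfield:
  assumes "g \<in> L2_per"
  shows "L2_inner g (testfield k e) = (if k = 0 then 0 else 2 * volume * (leray_symbol k e \<bullet> fourier_coeff g k))"
  using L2_inner_field_of(2)[OF decays_testcoef[of 1] _ assms, of k e]
    infsum_testcoef[OF hermitian_fourier_coeff, of "\<lambda>_. 1" k e g]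
  by (simp add: L2_inner_commute[of g])

lemma L2_inner_testfield_H:
  assumes "g \<in> H"
  shows "L2_inner g (testfield k e) = 2 * volume * (e \<bullet> fourier_coeff g k)"
  using L2_inner_testfield[OF H_L2_per[OF assms], of k e] inner_leray_symbol[OF H_wave_dot[OF assms], of k e] H_fourier_coeff_0[OF assms]
  by auto

lemma testfield_dom_expA: "testfield k e \<in> dom_expA r"
  and AE_expA_testfield: "AE x in torus. expA r (testfield k e) x = field_of (\<lambda>l. exp (r * wn l) *\<^sub>R testcoef k e l) x"
proof -
  have "gevrey (r + 1) (testcoef k e) = ennreal (\<Sum>\<^sub>\<infinity>l. exp (2 * (r + 1) * wn l) * (norm (testcoef k e l))\<^sup>2)"
    by (rule gevrey_summable, rule finite_nonzero_values_imp_summable_on, rule finite_subset[of _ "{k, - k}"]) (auto simp: testcoef_def)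
  then have p: "gevrey (r + 1) (fourier_coeff (testfield k e)) < top"
    by (simp add: fourier_coeff_testfield)
  have "r < r + 1" by simp
  from expA_of_gevrey[OF testfield_H p this]
  show "testfield k e \<in> dom_expA r"
    "AE x in torus. expA r (testfield k e) x = field_of (\<lambda>l. exp (r * wn l) *\<^sub>R testcoef k e l) x"
    by (simp_all add: fourier_coeff_testfield)
qed

lemma L2_inner_expA_testfield:
  assumes g: "g \<in> dom_expA r"
  shows "L2_inner (expA r g) (expA r (testfield k e))
    = 2 * volume * (exp (2 * r * wn k) * (e \<bullet> fourier_coeff g k))"
proof -
  let ?c = "\<lambda>l. exp (r * wn l) *\<^sub>R testcoef k e l"
  have d: "decays 1 ?c"
    by (rule decays_scale[OF decays_testcoef])
  have "L2_inner (expA r g) (expA r (testfield k e)) = L2_inner (expA r g) (field_of ?c)"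
    by (rule L2_inner_cong_AE(2)[OF AE_expA_testfield])
      (auto intro!: L2_per_measurable H_L2_per expA_H testfield_dom_expA g field_of_L2_per[OF d, unfolded])
  also have "\<dots> = volume * (\<Sum>\<^sub>\<infinity>l. ?c l \<bullet> fourier_coeff (expA r g) l)"
    using L2_inner_field_of(2)[OF d _ H_L2_per[OF expA_H[OF g]]] by (simp add: L2_inner_commute[of "expA r g"])
  also have "\<dots> = 2 * volume * (exp (2 * r * wn k) * (e \<bullet> fourier_coeff g k))"
    using inner_leray_symbol[OF H_wave_dot[OF dom_expA_H[OF g]], of k e] H_fourier_coeff_0[OF dom_expA_H[OF g]]
    by (subst infsum_testcoef[OF hermitian_fourier_coeff])
      (auto simp: fourier_coeff_expA[OF g] exp_double power2_eq_square mult.assoc)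
  finally show ?thesis .
qed

section \<open>The Leray projector\<close>

lemma L2_inner_diff_left:
  assumes "g \<in> L2_per" "h \<in> L2_per" "v \<in> L2_per"
  shows "L2_inner (\<lambda>x. g x - h x) v = L2_inner g v - L2_inner h v"
  unfolding L2_inner_def using assms
  by (simp add: inner_diff_left L2_per_inner_integrable)

text \<open>
  Projecting each coefficient of \<open>F\<close> orthogonally to its wave vector gives a candidate for the projection,
  so the choice in \<open>leray\<close> is from a nonempty set.  Testing the chosen field with trigonometric fields bounds
  its coefficients.
\<close>

lemma leray_projection:
  assumes m: "g \<in> borel_measurable torus" and ae: "AE x in torus. g x = F x"
    and F: "F \<in> L2_per" and d: "decays R (fourier_coeff F)" "0 < R"
  shows "leray g \<in> H" "\<And>v. v \<in> H \<Longrightarrow> L2_inner (leray g) v = L2_inner F v"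
    "norm (fourier_coeff (leray g) k) \<le> norm (fourier_coeff F k)"
proof -
  let ?c = "fourier_coeff F"
  define b where "b k = (if k = 0 then 0 else leray_symbol k (?c k))" for k
  have nb: "norm (b k) \<le> norm (?c k)" for k
    by (simp add: b_def norm_leray_symbol)
  have db: "decays R b"
    by (rule decays_mono[OF d(1), where C = 1]) (use nb in auto)
  have hb: "hermitian_vec b"
  proof -
    have l: "leray_symbol (- k) (cnj_vec a) = cnj_vec (leray_symbol k a)" for k a
      by (simp add: leray_symbol_def wave_dot_minus wave_dot_cnj_vec vec_eq_iff) (simp add: cnj_vec_def)
    have "?c (- k) = cnj_vec (?c k)" for k
      using hermitian_fourier_coeff[of F] by (simp add: hermitian_vec_iff)
    then show ?thesis
      unfolding hermitian_vec_iff by (simp add: b_def l)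
  qed
  have w0: "field_of b \<in> H"
    by (rule field_of_in_H[OF db d(2) hb]) (auto simp: b_def wave_dot_leray_symbol wave_dot_def[of 0])
  have fF: "AE x in torus. F x = field_of ?c x"
    by (rule AE_eq_field_of[OF F d])
  have FI: "L2_inner F v = volume * (\<Sum>\<^sub>\<infinity>k. ?c k \<bullet> fourier_coeff v k)" if "v \<in> L2_per" for v
    using L2_inner_cong_AE(1)[OF fF] L2_inner_field_of(2)[OF d that] F that field_of_L2_per[OF d]
    by (simp add: L2_per_measurable)
  have *: "L2_inner (\<lambda>x. g x - w x) v = L2_inner F v - L2_inner w v" if w: "w \<in> H" and v: "v \<in> H" for w v
  proof -
    have "L2_inner (\<lambda>x. g x - w x) v = L2_inner (\<lambda>x. F x - w x) v"
    proof (rule L2_inner_cong_AE(1))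
      show "AE x in torus. g x - w x = F x - w x" using ae by eventually_elim simp
    qed (use m L2_per_measurable[OF F] L2_per_measurable[OF H_L2_per[OF w]] L2_per_measurable[OF H_L2_per[OF v]] in simp_all)
    then show ?thesis
      using L2_inner_diff_left[OF F H_L2_per[OF w] H_L2_per[OF v]] by simp
  qed
  have "L2_inner (\<lambda>x. g x - field_of b x) v = 0" if v: "v \<in> H" for v
  proof -
    have "?c k \<bullet> fourier_coeff v k = b k \<bullet> fourier_coeff v k" for k
      using v by (auto simp: b_def H_fourier_coeff_0 inner_leray_symbol H_wave_dot)
    then show ?thesis
      using *[OF w0 v] FI[OF H_L2_per[OF v]] L2_inner_field_of(2)[OF db d(2) H_L2_per[OF v]] by simp
  qed
  then have ex: "\<exists>w. w \<in> H \<and> (\<forall>v\<in>H. L2_inner (\<lambda>x. g x - w x) v = 0)"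
    using w0 by blast
  have L: "leray g \<in> H \<and> (\<forall>v\<in>H. L2_inner (\<lambda>x. g x - leray g x) v = 0)"
    unfolding leray_def by (rule someI_ex[OF ex])
  then show lH: "leray g \<in> H" by simp
  show I: "L2_inner (leray g) v = L2_inner F v" if "v \<in> H" for v
    using L *[OF lH that] that by simp
  show "norm (fourier_coeff (leray g) k) \<le> norm (?c k)"
  proof (cases "k = 0")
    case True
    then show ?thesis by (simp add: H_fourier_coeff_0[OF lH])
  next
    case False
    let ?e = "fourier_coeff (leray g) k"
    have "2 * volume * (?e \<bullet> ?e) = L2_inner (leray g) (testfield k ?e)"
      by (rule L2_inner_testfield_H[OF lH, symmetric])
    also have "\<dots> = L2_inner F (testfield k ?e)"
      by (rule I[OF testfield_H])
    also have "\<dots> = 2 * volume * (leray_symbol k ?e \<bullet> ?c k)"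
      using L2_inner_testfield[OF F] False by simp
    finally have "(norm ?e)\<^sup>2 = leray_symbol k ?e \<bullet> ?c k"
      by (simp add: power2_norm_eq_inner)
    also have "\<dots> \<le> norm (leray_symbol k ?e) * norm (?c k)"
      by (rule norm_cauchy_schwarz)
    also have "\<dots> \<le> norm ?e * norm (?c k)"
      by (intro mult_right_mono norm_leray_symbol False) simp
    finally show ?thesis
      by (cases "?e = 0") (auto simp: power2_eq_square)
  qed
qed

section \<open>Weak derivatives\<close>

lemma test_fun_continuous:
  assumes "test_fun \<phi> G"
  shows "continuous_on S \<phi>" "continuous_on S G"
proof -
  show "continuous_on S G"
    using assms by (auto simp: test_fun_def intro: continuous_on_subset)
  show "continuous_on S \<phi>"
    using assms by (auto simp: test_fun_def gderiv_def intro!: has_derivative_continuous_on intro: has_derivative_at_withinI)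
qed

lemma is_weak_deriv_field_of:
  assumes g: "g \<in> L2_per" and d: "decays R (fourier_coeff g)" "0 < R"
  shows "is_weak_deriv j g (field_of (deriv_coeff j (fourier_coeff g)))"
proof -
  let ?U = "field_of (fourier_coeff g)" and ?W = "field_of (deriv_coeff j (fourier_coeff g))"
  have dd: "decays (R/2) (deriv_coeff j (fourier_coeff g))" and R2: "0 < R/2"
    using d by (auto intro: decays_deriv_coeff)
  have W: "?W \<in> L2_per" by (rule field_of_L2_per[OF dd R2])
  have U: "?U \<in> L2_per" by (rule field_of_L2_per[OF d])
  have "(LINT x|torus. (G x $ j) *\<^sub>R g x) = - (LINT x|torus. \<phi> x *\<^sub>R ?W x)" if t: "test_fun \<phi> G" for \<phi> G
  proof -
    note cont = test_fun_continuous[OF t]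
    have Gm: "(\<lambda>x. G x $ j) \<in> borel_measurable torus"
      by (intro borel_measurable_integrable torus_integrable_continuous continuous_intros cont)
    have "(LINT x|torus. (G x $ j) *\<^sub>R g x) = (LINT x|torus. (G x $ j) *\<^sub>R ?U x)"
      using AE_eq_field_of[OF g d] L2_per_measurable[OF g] L2_per_measurable[OF U] Gm
      by (intro integral_cong_AE) (auto elim: eventually_mono)
    moreover have "(LINT x|torus. (G x $ j) *\<^sub>R ?U x) = - (LINT x|torus. \<phi> x *\<^sub>R ?W x)"
    proof -
      have i1: "integrable torus (\<lambda>x. (G x $ j) *\<^sub>R ?U x)"
        by (intro torus_integrable_continuous continuous_intros field_of_continuous[OF d] cont)
      have i2: "integrable torus (\<lambda>x. \<phi> x *\<^sub>R ?W x)"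
        by (intro torus_integrable_continuous continuous_intros field_of_continuous[OF dd R2] cont)
      have "(LINT x|torus. (G x $ j) *\<^sub>R ?U x) $ i = (- (LINT x|torus. \<phi> x *\<^sub>R ?W x)) $ i" for i
        using integration_by_parts[OF field_of_test_fun[OF d, of i] t, of j]
        by (simp add: integral_vec_nth[OF i1] integral_vec_nth[OF i2] mult.commute)
      then show ?thesis by (simp add: vec_eq_iff)
    qed
    ultimately show ?thesis by simp
  qed
  then show ?thesis using W by (simp add: is_weak_deriv_def)
qed

text \<open>
  Cosines and sines as test functions determine the Fourier coefficients.
\<close>

lemma is_weak_deriv_unique:
  assumes "is_weak_deriv j g w" "is_weak_deriv j g w'"
  shows "AE x in torus. w x = w' x"
proof -
  have L: "w \<in> L2_per" "w' \<in> L2_per" using assms by (auto simp: is_weak_deriv_def)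
  have eq: "(LINT x|torus. w x $ i * \<phi> x) = (LINT x|torus. w' x $ i * \<phi> x)"
    if t: "test_fun \<phi> G" and b: "\<And>x. \<bar>\<phi> x\<bar> \<le> 1" for \<phi> G i
  proof -
    have cont: "continuous_on Omega \<phi>"
      using t by (auto simp: test_fun_def gderiv_def intro!: has_derivative_continuous_on intro: has_derivative_at_withinI)
    have pm: "\<phi> \<in> borel_measurable torus"
      by (intro borel_measurable_integrable torus_integrable_continuous cont)
    have int: "integrable torus (\<lambda>x. \<phi> x *\<^sub>R v x)" if v: "v \<in> L2_per" for v
    proof (rule Bochner_Integration.integrable_bound[OF L2_per_integrable[OF v]])
      show "(\<lambda>x. \<phi> x *\<^sub>R v x) \<in> borel_measurable torus"
        using pm L2_per_measurable[OF v] by measurable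
      show "AE x in torus. norm (\<phi> x *\<^sub>R v x) \<le> norm (v x)"
        using b by (auto intro!: mult_left_le_one_le)
    qed
    have "(LINT x|torus. \<phi> x *\<^sub>R w x) = (LINT x|torus. \<phi> x *\<^sub>R w' x)"
    proof -
      have "(LINT x|torus. (G x $ j) *\<^sub>R g x) = - (LINT x|torus. \<phi> x *\<^sub>R w x)"
        "(LINT x|torus. (G x $ j) *\<^sub>R g x) = - (LINT x|torus. \<phi> x *\<^sub>R w' x)"
        using assms t by (auto simp: is_weak_deriv_def)
      then show ?thesis by simp
    qed
    then have "(LINT x|torus. \<phi> x *\<^sub>R w x) $ i = (LINT x|torus. \<phi> x *\<^sub>R w' x) $ i"
      by simp
    then show ?thesis
      by (simp add: integral_vec_nth int L mult.commute)
  qed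
  have "fourier_coeff w k $ i = fourier_coeff w' k $ i" for k i
    unfolding fourier_coeff_nth scoeff_def fourier_coeff_cos_sin[OF L2_per_integrable_nth[OF L(1)]]
      fourier_coeff_cos_sin[OF L2_per_integrable_nth[OF L(2)]]
    using eq[OF test_fun_cos[of k], of i] eq[OF test_fun_sin[of k], of i] by simp
  then have "fourier_coeff w = fourier_coeff w'"
    by (simp add: fun_eq_iff vec_eq_iff)
  then show ?thesis by (rule fourier_unique_AE[OF L])
qed

lemma weak_deriv_props:
  assumes g: "g \<in> L2_per" and d: "decays R (fourier_coeff g)" "0 < R"
  shows "weak_deriv j g \<in> L2_per" "AE x in torus. weak_deriv j g x = field_of (deriv_coeff j (fourier_coeff g)) x"
proof -
  have w: "is_weak_deriv j g (weak_deriv j g)"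
    unfolding weak_deriv_def by (rule someI[of "is_weak_deriv j g", OF is_weak_deriv_field_of[OF assms]])
  then show "weak_deriv j g \<in> L2_per" by (simp add: is_weak_deriv_def)
  show "AE x in torus. weak_deriv j g x = field_of (deriv_coeff j (fourier_coeff g)) x"
    by (rule is_weak_deriv_unique[OF w is_weak_deriv_field_of[OF assms]])
qed

section \<open>The convection term\<close>

text \<open>
  The coefficients of a product are a convolution.  Distribute the weight \<open>e\<^bsup>r|k|\<^esup>\<close> over the two factors by
  the triangle inequality for \<open>k = l + (k - l)\<close>, and use \<open>2ab \<le> a\<^sup>2 + b\<^sup>2\<close>.
\<close>

lemma scoeff_product_le:
  assumes d: "decays R c" "0 < R" and h: "hermitian_vec c" and r: "0 \<le> r" and p: "gevrey r c < top"
  shows "exp (r * wn k) * norm (scoeff (\<lambda>x. complex_of_real (field_of c x $ j * field_of c x $ i)) k) \<le> enn2real (gevrey r c)"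
proof -
  let ?U = "field_of c"
  have c0: "decays 0 (\<lambda>k. c k $ i)" for i
    by (rule decays_nth[OF decays_0[OF d]])
  have Ui: "integrable torus (\<lambda>x. complex_of_real (?U x $ i))"
    by (rule L2_per_integrable_nth_complex[OF field_of_L2_per[OF d]])
  have Ur: "complex_of_real (?U x $ j) = series (\<lambda>k. c k $ j) (cvec x)" for x j
    using h by (simp add: field_of_def series_real hermitian_vec_def)
  have fcU: "scoeff (\<lambda>x. complex_of_real (?U x $ i)) l = c l $ i" for l i
    using fourier_coeff_field_of[OF decays_0[OF d] h] by (metis fourier_coeff_nth)
  have \<psi>: "integrable torus (\<lambda>x. complex_of_real (?U x $ i) * fmode (- k) x)"
    by (rule torus_integrable_fmode[OF Ui])
  have e: "(LINT x|torus. fmode l x * (complex_of_real (?U x $ i) * fmode (- k) x)) = complex_of_real volume * c (k - l) $ i" for l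
  proof -
    have "fmode l x * (complex_of_real (?U x $ i) * fmode (- k) x) = complex_of_real (?U x $ i) * fmode (- (k - l)) x" for x
      by (simp add: fmode_add[of l "- k", simplified] mult_ac)
    then have "(LINT x|torus. fmode l x * (complex_of_real (?U x $ i) * fmode (- k) x)) = complex_of_real volume * scoeff (\<lambda>x. complex_of_real (?U x $ i)) (k - l)"
      by (simp only: scoeff_def) simp
    then show ?thesis by (simp add: fcU)
  qed
  note S = integral_series[OF c0 \<psi>, of j]
  have abs: "(\<lambda>l. c l $ j * c (k - l) $ i) abs_summable_on UNIV"
  proof -
    have "(\<lambda>l. (1 / volume) * norm (c l $ j * (complex_of_real volume * c (k - l) $ i))) summable_on UNIV"
      using S(3) unfolding e by (rule summable_on_cmult_right)
    then show ?thesis by (simp add: norm_mult norm_power)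
  qed
  have "scoeff (\<lambda>x. complex_of_real (?U x $ j * ?U x $ i)) k = (\<Sum>\<^sub>\<infinity>l. c l $ j * (complex_of_real volume * c (k - l) $ i)) / complex_of_real volume"
  proof -
    have "(LINT x|torus. complex_of_real (?U x $ j * ?U x $ i) * fmode (- k) x) = (LINT x|torus. series (\<lambda>k. c k $ j) (cvec x) * (complex_of_real (?U x $ i) * fmode (- k) x))"
      by (simp only: of_real_mult Ur mult.assoc)
    then show ?thesis unfolding scoeff_def S(2) e by simp
  qed
  also have "\<dots> = (\<Sum>\<^sub>\<infinity>l. c l $ j * c (k - l) $ i)"
  proof -
    have "(\<Sum>\<^sub>\<infinity>l. c l $ j * (complex_of_real volume * c (k - l) $ i)) = complex_of_real volume * (\<Sum>\<^sub>\<infinity>l. c l $ j * c (k - l) $ i)"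
      by (subst infsum_cmult_right'[symmetric]) (simp add: mult_ac)
    then show ?thesis by simp
  qed
  finally have eq: "scoeff (\<lambda>x. complex_of_real (?U x $ j * ?U x $ i)) k = (\<Sum>\<^sub>\<infinity>l. c l $ j * c (k - l) $ i)" .
  define a where "a l = exp (r * wn l) * norm (c l)" for l
  have asq: "(a l)\<^sup>2 = gterm r c l" for l
    by (simp add: a_def power_mult_distrib exp_double[symmetric] mult.assoc)
  have s1: "(\<lambda>l. (a l)\<^sup>2) summable_on UNIV"
    unfolding asq by (rule gevrey_finite(1)[OF p])
  have P: "enn2real (gevrey r c) = (\<Sum>\<^sub>\<infinity>l. (a l)\<^sup>2)"
    unfolding gevrey_finite(2)[OF p] asq by (simp add: infsum_nonneg)
  have bij: "bij_betw (\<lambda>l. k - l) UNIV UNIV"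
    by (rule bij_betw_byWitness[where f' = "\<lambda>l. k - l"]) auto
  have s2: "(\<lambda>l. (a (k - l))\<^sup>2) summable_on UNIV" "(\<Sum>\<^sub>\<infinity>l. (a (k - l))\<^sup>2) = (\<Sum>\<^sub>\<infinity>l. (a l)\<^sup>2)"
    using summable_on_reindex_bij_betw[OF bij, of "\<lambda>l. (a l)\<^sup>2"] s1 infsum_reindex_bij_betw[OF bij, of "\<lambda>l. (a l)\<^sup>2"] by auto
  have s3: "(\<lambda>l. (1/2) * ((a l)\<^sup>2 + (a (k - l))\<^sup>2)) summable_on UNIV"
    by (intro summable_on_cmult_right summable_on_add s1 s2)
  have b: "exp (r * wn k) * norm (c l $ j * c (k - l) $ i) \<le> (1/2) * ((a l)\<^sup>2 + (a (k - l))\<^sup>2)" for l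
  proof -
    have "wn k \<le> wn l + wn (k - l)"
      using norm_triangle_ineq[of "wavevec l" "wavevec (k - l)"] by (simp add: wavevec_diff)
    then have "r * wn k \<le> r * wn l + r * wn (k - l)"
      using r by (metis distrib_left mult_left_mono)
    then have "exp (r * wn k) \<le> exp (r * wn l) * exp (r * wn (k - l))"
      by (simp add: exp_add[symmetric])
    moreover have "norm (c l $ j * c (k - l) $ i) \<le> norm (c l) * norm (c (k - l))"
      unfolding norm_mult by (intro mult_mono norm_vec_nth_le) auto
    ultimately have "exp (r * wn k) * norm (c l $ j * c (k - l) $ i)
       \<le> (exp (r * wn l) * exp (r * wn (k - l))) * (norm (c l) * norm (c (k - l)))"
      by (intro mult_mono) auto
    also have "\<dots> = a l * a (k - l)" by (simp add: a_def mult_ac)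
    also have "\<dots> \<le> (1/2) * ((a l)\<^sup>2 + (a (k - l))\<^sup>2)"
      using sum_squares_bound[of "a l" "a (k - l)"] by simp
    finally show ?thesis .
  qed
  have "exp (r * wn k) * norm (\<Sum>\<^sub>\<infinity>l. c l $ j * c (k - l) $ i) \<le> exp (r * wn k) * (\<Sum>\<^sub>\<infinity>l. norm (c l $ j * c (k - l) $ i))"
    by (intro mult_left_mono norm_infsum_bound[OF abs]) simp
  also have "\<dots> = (\<Sum>\<^sub>\<infinity>l. exp (r * wn k) * norm (c l $ j * c (k - l) $ i))"
    by (rule infsum_cmult_right'[symmetric])
  also have "\<dots> \<le> (\<Sum>\<^sub>\<infinity>l. (1/2) * ((a l)\<^sup>2 + (a (k - l))\<^sup>2))"
    by (rule infsum_mono) (use b s3 abs in \<open>auto intro: summable_on_cmult_right\<close>)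
  also have "\<dots> = (1/2) * ((\<Sum>\<^sub>\<infinity>l. (a l)\<^sup>2) + (\<Sum>\<^sub>\<infinity>l. (a (k - l))\<^sup>2))"
    by (simp only: infsum_cmult_right' infsum_add[OF s1 s2(1)])
  also have "\<dots> = enn2real (gevrey r c)"
    by (simp add: s2 P)
  finally show ?thesis unfolding eq .
qed

definition convection :: "(int^3 \<Rightarrow> complex^3) \<Rightarrow> real^3 \<Rightarrow> real^3" where
  "convection c x = (\<Sum>j\<in>UNIV. (field_of c x $ j) *\<^sub>R field_of (deriv_coeff j c) x)"

lemma convection_continuous:
  assumes d: "decays R c" "0 < R"
  shows "continuous_on S (convection c)"
proof -
  have dd: "decays (R/2) (deriv_coeff j c)" "0 < R / 2" for j
    using d by (auto intro: decays_deriv_coeff)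
  show ?thesis
    unfolding convection_def by (intro continuous_intros field_of_continuous[OF d] field_of_continuous[OF dd])
qed

lemma convection_L2_per:
  assumes d: "decays R c" "0 < R"
  shows "convection c \<in> L2_per"
  using field_of_periodic
  by (intro continuous_periodic_L2_per convection_continuous[OF d]) (simp add: periodic_def convection_def)

text \<open>
  Test the vanishing divergence of \<open>U\<close> with \<open>U\<^sub>i \<psi>\<close>: the product rule moves the derivative from \<open>U\<^sub>i\<close> to
  \<open>\<psi>\<close>.
\<close>

lemma convection_test:
  assumes d: "decays R c" "0 < R" and U: "field_of c \<in> H" and t: "test_fun \<psi> K"
  shows "(LINT x|torus. convection c x $ i * \<psi> x) = - (LINT x|torus. field_of c x $ i * (field_of c x \<bullet> K x))"
proof -
  let ?U = "field_of c"
  note cont = test_fun_continuous[OF t] field_of_continuous_nth[OF d] field_of_continuous[OF d]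
  have df: "div_free ?U" using U by (simp add: H_def)
  have "0 = (LINT x|torus. ?U x \<bullet> (?U x $ i *\<^sub>R K x + \<psi> x *\<^sub>R (\<chi> j. field_of (deriv_coeff j c) x $ i)))"
    by (rule div_freeD[OF df test_fun_mult[OF field_of_test_fun[OF d] t], symmetric])
  also have "\<dots> = (LINT x|torus. ?U x $ i * (?U x \<bullet> K x) + convection c x $ i * \<psi> x)"
  proof -
    have "?U x \<bullet> (\<chi> j. field_of (deriv_coeff j c) x $ i) = convection c x $ i" for x
      by (simp add: convection_def inner_vec_def)
    then show ?thesis by (simp add: inner_add_right mult.commute)
  qed
  also have "\<dots> = (LINT x|torus. ?U x $ i * (?U x \<bullet> K x)) + (LINT x|torus. convection c x $ i * \<psi> x)"
    by (intro Bochner_Integration.integral_add torus_integrable_continuous continuous_intros cont convection_continuous[OF d])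
  finally show ?thesis by simp
qed

text \<open>
  With \<open>\<psi> = U\<^sub>i\<close> in \<open>convection_test\<close> each component integral equals its own negative.
\<close>

lemma convection_cancel:
  assumes d: "decays R c" "0 < R" and U: "field_of c \<in> H"
  shows "L2_inner (convection c) (field_of c) = 0"
proof -
  let ?U = "field_of c"
  have z: "(LINT x|torus. convection c x $ i * ?U x $ i) = 0" for i
  proof -
    have "(LINT x|torus. convection c x $ i * ?U x $ i) = - (LINT x|torus. ?U x $ i * (?U x \<bullet> (\<chi> j. field_of (deriv_coeff j c) x $ i)))"
      by (rule convection_test[OF d U field_of_test_fun[OF d]])
    also have "\<dots> = - (LINT x|torus. convection c x $ i * ?U x $ i)"
      by (simp add: convection_def inner_vec_def mult.commute)
    finally show ?thesis by simp
  qed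
  have i: "integrable torus (\<lambda>x. convection c x $ i * ?U x $ i)" for i
    by (intro torus_integrable_continuous continuous_intros convection_continuous[OF d] field_of_continuous[OF d])
  have "L2_inner (convection c) ?U = (\<Sum>i\<in>UNIV. LINT x|torus. convection c x $ i * ?U x $ i)"
    using i by (simp add: L2_inner_def inner_vec_def Bochner_Integration.integral_sum)
  then show ?thesis using z by simp
qed

text \<open>
  By \<open>convection_test\<close> with the modes as \<open>\<psi>\<close>, the \<open>k\<close>-th coefficient is \<open>i \<Sum>\<^sub>j k\<^sub>j (U\<^sub>j U\<^sub>i)\<^sub>k\<close>.  The factor 9
  counts the pairs \<open>(i, j)\<close>.
\<close>

lemma norm_fourier_coeff_convection:
  assumes d: "decays R c" "0 < R" and h: "hermitian_vec c" and U: "field_of c \<in> H"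
    and r: "0 \<le> r" and p: "gevrey r c < top"
  shows "norm (fourier_coeff (convection c) k) \<le> 9 * wn k * exp (- r * wn k) * enn2real (gevrey r c)"
proof -
  let ?U = "field_of c" and ?n = "wn k"
  define Q where "Q i x = ?U x $ i * (?U x \<bullet> wavevec k)" for i x
  have Qc: "continuous_on S (Q i)" for S i
    unfolding Q_def by (intro continuous_intros field_of_continuous[OF d])
  have Qi: "integrable torus (Q i)" for i
    by (rule torus_integrable_continuous[OF Qc])
  have Ci: "integrable torus (\<lambda>x. convection c x $ i)" for i
    by (rule L2_per_integrable_nth[OF convection_L2_per[OF d]])
  have comp: "norm (fourier_coeff (convection c) k $ i) \<le> 3 * ?n * exp (- r * ?n) * enn2real (gevrey r c)" for i
  proof -
    have "(LINT x|torus. convection c x $ i * cos (wavevec k \<bullet> x)) = (LINT x|torus. Q i x * sin (wavevec k \<bullet> x))"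
      using convection_test[OF d U test_fun_cos[of k], of i] by (simp add: Q_def mult_ac)
    moreover have "(LINT x|torus. convection c x $ i * sin (wavevec k \<bullet> x)) = - (LINT x|torus. Q i x * cos (wavevec k \<bullet> x))"
      using convection_test[OF d U test_fun_sin[of k], of i] by (simp add: Q_def mult_ac)
    ultimately have "(LINT x|torus. complex_of_real (convection c x $ i) * fmode (- k) x) = \<i> * (LINT x|torus. complex_of_real (Q i x) * fmode (- k) x)"
      by (simp add: fourier_coeff_cos_sin Ci Qi complex_eq_iff)
    then have 1: "fourier_coeff (convection c) k $ i = \<i> * scoeff (\<lambda>x. complex_of_real (Q i x)) k"
      by (simp add: fourier_coeff_nth scoeff_def)
    have 2: "scoeff (\<lambda>x. complex_of_real (Q i x)) k = (\<Sum>j\<in>UNIV. of_int (k $ j) * scoeff (\<lambda>x. complex_of_real (?U x $ j * ?U x $ i)) k)"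
    proof -
      have "(LINT x|torus. complex_of_real (Q i x) * fmode (- k) x) = (LINT x|torus. (\<Sum>j\<in>UNIV. of_int (k $ j) * (complex_of_real (?U x $ j * ?U x $ i) * fmode (- k) x)))"
        by (simp add: Q_def inner_vec_def sum_distrib_left sum_distrib_right mult_ac)
      also have "\<dots> = (\<Sum>j\<in>UNIV. LINT x|torus. of_int (k $ j) * (complex_of_real (?U x $ j * ?U x $ i) * fmode (- k) x))"
        by (intro Bochner_Integration.integral_sum torus_integrable_continuous continuous_intros fmode_continuous field_of_continuous[OF d])
      finally show ?thesis
        unfolding scoeff_def by (simp add: sum_divide_distrib)
    qed
    have "norm (scoeff (\<lambda>x. complex_of_real (Q i x)) k) \<le> (\<Sum>j\<in>(UNIV::3 set). ?n * (exp (- r * ?n) * enn2real (gevrey r c)))"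
      unfolding 2
    proof (rule sum_norm_le)
      fix j
      define f where "f = norm (scoeff (\<lambda>x. complex_of_real (?U x $ j * ?U x $ i)) k)"
      have "exp (r * ?n) * f \<le> enn2real (gevrey r c)"
        unfolding f_def by (rule scoeff_product_le[OF d h r p])
      then have "exp (- r * ?n) * (exp (r * ?n) * f) \<le> exp (- r * ?n) * enn2real (gevrey r c)"
        by (rule mult_left_mono) simp
      moreover have "exp (- r * ?n) * (exp (r * ?n) * f) = f"
        by (simp add: exp_minus)
      ultimately have "f \<le> exp (- r * ?n) * enn2real (gevrey r c)" by linarith
      then show "norm (of_int (k $ j) * scoeff (\<lambda>x. complex_of_real (?U x $ j * ?U x $ i)) k) \<le> ?n * (exp (- r * ?n) * enn2real (gevrey r c))"
        unfolding norm_mult using wavevec_component_le[of k j] unfolding f_def by (intro mult_mono) auto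
    qed
    then show ?thesis by (simp add: 1 norm_mult mult.assoc)
  qed
  have "norm (fourier_coeff (convection c) k) \<le> (\<Sum>i\<in>(UNIV::3 set). 3 * ?n * exp (- r * ?n) * enn2real (gevrey r c))"
    by (rule order_trans[OF norm_le_sum sum_mono[OF comp]])
  then show ?thesis by simp
qed

text \<open>
  For \<open>u\<close> in a Gevrey class, \<open>convect u u\<close> is almost everywhere the classical convection term of the
  Fourier series of \<open>u\<close>, and its coefficients decay fast enough for \<open>leray_projection\<close>.
\<close>

lemma B_field_props:
  assumes u: "u \<in> H" and R: "0 < R" and pR: "gevrey R (fourier_coeff u) < top"
  shows "B u u \<in> H"
    and "\<And>r k. 0 \<le> r \<Longrightarrow> gevrey r (fourier_coeff u) < top \<Longrightarrow>
       norm (fourier_coeff (B u u) k) \<le> 9 * wn k * exp (- r * wn k) * enn2real (gevrey r (fourier_coeff u))"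
    and "(\<lambda>k. fourier_coeff u k \<bullet> fourier_coeff (B u u) k) abs_summable_on UNIV"
    and "(\<Sum>\<^sub>\<infinity>k. fourier_coeff u k \<bullet> fourier_coeff (B u u) k) = 0"
proof -
  let ?c = "fourier_coeff u"
  have d: "decays (R/2) ?c" "0 < R/2"
    using R by (auto intro: decays_of_gevrey[OF pR])
  have h: "hermitian_vec ?c" by (rule hermitian_fourier_coeff)
  have uL: "u \<in> L2_per" by (rule H_L2_per[OF u])
  have U: "field_of ?c \<in> H"
    using u by (intro field_of_in_H[OF d h]) (auto simp: H_fourier_coeff_0 H_wave_dot)
  have UL: "field_of ?c \<in> L2_per" by (rule H_L2_per[OF U])
  note W = weak_deriv_props[OF uL d]
  have m: "convect u u \<in> borel_measurable torus"
  proof -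
    have [measurable]: "u \<in> borel_measurable torus" "weak_deriv j u \<in> borel_measurable torus" for j
      using uL W by (auto intro: L2_per_measurable)
    show ?thesis unfolding convect_def[abs_def] by measurable
  qed
  have ae: "AE x in torus. convect u u x = convection ?c x"
  proof -
    have "AE x in torus. \<forall>j. weak_deriv j u x = field_of (deriv_coeff j ?c) x"
      using W(2) by (subst AE_all_countable) auto
    then show ?thesis
      using AE_eq_field_of[OF uL d] by eventually_elim (simp add: convect_def convection_def)
  qed
  have F: "convection ?c \<in> L2_per" by (rule convection_L2_per[OF d])
  note nb = norm_fourier_coeff_convection[OF d h U]
  \<comment> \<open>The factor \<open>|k|\<close> costs a part of the rate \<open>R\<close>.\<close>
  have dF: "decays (R/4) (fourier_coeff (convection ?c))" "0 < R/4"
  proof -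
    have "(\<lambda>k. exp (- (R/2) * wn k)) summable_on UNIV"
      using R by (intro summable_exp_wavevec) auto
    then have dc: "decays (R/2) (\<lambda>k. exp (- R * wn k))"
      by (simp add: decays_def exp_add[symmetric] algebra_simps)
    show "decays (R/4) (fourier_coeff (convection ?c))"
      by (rule decays_derivative[OF dc, where C = "9 * enn2real (gevrey R ?c)"])
        (use R nb[OF _ pR] in \<open>auto simp: mult_ac\<close>)
  qed (use R in simp)
  note L = leray_projection[OF m ae F dF]
  show BH: "B u u \<in> H" unfolding B_def by (rule L(1))
  show "norm (fourier_coeff (B u u) k) \<le> 9 * wn k * exp (- r * wn k) * enn2real (gevrey r ?c)"
    if "0 \<le> r" "gevrey r ?c < top" for r k
    unfolding B_def by (rule order_trans[OF L(3) nb[OF that]])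
  show "(\<lambda>k. ?c k \<bullet> fourier_coeff (B u u) k) abs_summable_on UNIV"
    by (rule L2_inner_field_of(1)[OF d H_L2_per[OF BH]])
  have "volume * (\<Sum>\<^sub>\<infinity>k. ?c k \<bullet> fourier_coeff (B u u) k) = L2_inner (B u u) (field_of ?c)"
    using L2_inner_field_of(2)[OF d H_L2_per[OF BH]] by (simp add: L2_inner_commute)
  also have "\<dots> = L2_inner (convection ?c) (field_of ?c)"
    unfolding B_def by (rule L(2)[OF U])
  also have "\<dots> = 0" by (rule convection_cancel[OF d U])
  finally show "(\<Sum>\<^sub>\<infinity>k. ?c k \<bullet> fourier_coeff (B u u) k) = 0"
    by simp
qed

section \<open>Entire extension\<close>

lemma periodic_shift:
  assumes "periodic g"
  shows "g (x + (\<chi> i. 2 * pi * real_of_int (m $ i))) = g x"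
proof -
  have n: "g (x + axis j (2 * pi * real n)) = g x" for j n x
  proof (induction n)
    case 0
    have "axis j 0 = (0::real^3)" by simp
    then show ?case by (simp only: mult_zero_right of_nat_0 add_0_right)
  next
    case (Suc n)
    have "x + axis j (2 * pi * real (Suc n)) = (x + axis j (2 * pi * real n)) + axis j (2 * pi)"
      by (simp add: vec_eq_iff axis_def algebra_simps)
    then show ?case using Suc assms by (simp only: periodic_def)
  qed
  have z: "g (x + axis j (2 * pi * real_of_int m)) = g x" for j m x
  proof (cases "m \<ge> 0")
    case True
    then show ?thesis using n[of x j "nat m"] by simp
  next
    case False
    have e: "x + axis j (2 * pi * real_of_int m) + axis j (2 * pi * real (nat (- m))) = x"
      using False by (simp add: vec_eq_iff axis_def)
    from n[of "x + axis j (2 * pi * real_of_int m)" j "nat (- m)"]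
    show ?thesis unfolding e by simp
  qed
  have "x + (\<chi> i. 2 * pi * real_of_int (m $ i)) = x + axis 1 (2 * pi * real_of_int (m $ 1)) + axis 2 (2 * pi * real_of_int (m $ 2)) + axis 3 (2 * pi * real_of_int (m $ 3))"
    by (simp add: vec_eq_iff axis_def forall_3)
  then show ?thesis by (simp only: z)
qed

text \<open>
  The exceptional set is periodic, hence a countable union of translates of its null part in the box.
\<close>

lemma AE_periodic:
  assumes g: "periodic g" "periodic h" and ae: "AE x in torus. g x = h x"
  shows "AE x in lebesgue. g x = h x"
proof -
  let ?N = "{x. g x \<noteq> h x}"
  have "AE x in lebesgue. x \<notin> ?N \<inter> Omega"
    using ae by (auto simp: AE_restrict_space_iff elim!: eventually_mono)
  then have n0: "negligible (?N \<inter> Omega)"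
    by (simp only: negligible_iff_null_sets eventually_ae_filter)
      (auto intro: completion.complete2 simp: subset_iff)
  define v where "v m = (\<chi> i. 2 * pi * real_of_int (m $ i))" for m :: "int^3"
  have "?N \<subseteq> (\<Union>m. (+) (v m) ` (?N \<inter> Omega))"
  proof
    fix x assume x: "x \<in> ?N"
    define m :: "int^3" where "m = (\<chi> i. \<lfloor>x $ i / (2 * pi)\<rfloor>)"
    define y where "y = x - v m"
    have "y \<in> Omega"
      unfolding mem_Omega
    proof
      fix i
      have "real_of_int \<lfloor>x $ i / (2 * pi)\<rfloor> \<le> x $ i / (2 * pi)" "x $ i / (2 * pi) \<le> real_of_int \<lfloor>x $ i / (2 * pi)\<rfloor> + 1"
        by linarith+
      then have "real_of_int \<lfloor>x $ i / (2 * pi)\<rfloor> * (2 * pi) \<le> x $ i" "x $ i \<le> (real_of_int \<lfloor>x $ i / (2 * pi)\<rfloor> + 1) * (2 * pi)"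
        by (simp_all only: pos_le_divide_eq[of "2 * pi"] pos_divide_le_eq[of "2 * pi"] mult_pos_pos zero_less_numeral pi_gt_zero)
      then show "0 \<le> y $ i \<and> y $ i \<le> 2 * pi"
        by (simp add: y_def v_def m_def algebra_simps)
    qed
    moreover have xy: "x = y + v m" by (simp add: y_def)
    moreover have "g y \<noteq> h y"
      using x periodic_shift[OF g(1), of y m] periodic_shift[OF g(2), of y m] unfolding xy v_def by simp
    ultimately show "x \<in> (\<Union>m. (+) (v m) ` (?N \<inter> Omega))"
      by (auto simp: image_iff add.commute intro!: exI[of _ m] bexI[of _ y])
  qed
  moreover have "negligible (\<Union>m. (+) (v m) ` (?N \<inter> Omega))"
    by (intro negligible_countable_Union) (auto intro: negligible_translation[OF n0])
  ultimately have "negligible ?N" by (rule negligible_subset[rotated])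
  then have "?N \<in> null_sets lebesgue"
    by (simp add: negligible_iff_null_sets)
  then have "AE x in lebesgue. x \<notin> ?N"
    by (rule AE_not_in)
  then show ?thesis by simp
qed

lemma cvec_nth: "cvec x $ i = complex_of_real (x $ i)"
  by (simp add: cvec_def)

lemma entire_field_of_decays:
  assumes g: "g \<in> L2_per" and d: "\<And>R. decays R (fourier_coeff g)"
  shows "entire_field g"
proof -
  let ?c = "fourier_coeff g"
  define F where "F z = (\<chi> i. series (\<lambda>k. ?c k $ i) z)" for z
  define D where "D z h = (\<chi> i. \<Sum>j\<in>UNIV. h $ j * series (\<lambda>k. \<i> * of_int (k $ j) * ?c k $ i) z)" for z h
  have "(F has_derivative D z) (at z)" for z
  proof -
    have "((\<lambda>z. F z \<bullet> b) has_derivative (\<lambda>h. D z h \<bullet> b)) (at z)" if bB: "b \<in> Basis" for b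
    proof -
      obtain i y where b: "b = axis i y"
        using bB unfolding Basis_vec_def by blast
      have "(series (\<lambda>k. ?c k $ i) has_derivative (\<lambda>h. \<Sum>j\<in>UNIV. h $ j * series (\<lambda>k. \<i> * of_int (k $ j) * ?c k $ i) z)) (at z)"
        by (rule series_has_derivative[OF decays_nth[OF d], of z "norm (Im_vec z) + 1"]) simp
      then have "((\<lambda>z. series (\<lambda>k. ?c k $ i) z \<bullet> y) has_derivative (\<lambda>h. (\<Sum>j\<in>UNIV. h $ j * series (\<lambda>k. \<i> * of_int (k $ j) * ?c k $ i) z) \<bullet> y)) (at z)"
        by (rule has_derivative_inner_left)
      then show ?thesis by (simp add: b inner_axis F_def D_def)
    qed
    then show ?thesis by (subst has_derivative_componentwise_within) blast
  qed
  moreover have "D z (c *s h) = c *s D z h" for z c h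
    by (simp add: D_def vec_eq_iff sum_distrib_left mult.assoc)
  ultimately have "holomorphic_C3 F"
    unfolding holomorphic_C3_def by blast
  moreover have "F (cvec x) = cvec (field_of ?c x)" for x
    using hermitian_fourier_coeff[of g]
    by (simp add: F_def cvec_nth vec_eq_iff hermitian_vec_def) (simp add: field_of_def series_real)
  moreover have "AE x in lebesgue. g x = field_of ?c x"
    using g by (intro AE_periodic AE_eq_field_of[OF g d[of 1]] field_of_periodic) (auto simp: L2_per_def)
  then have "AE x in lebesgue. cvec (field_of ?c x) = cvec (g x)"
    by eventually_elim simp
  ultimately show ?thesis
    unfolding entire_field_def by auto
qed

section \<open>Indefinite integrals on an interval\<close>

lemma AE_subinterval:
  fixes a b c d :: real
  assumes "AE s in lebesgue_on {a..b}. P s" "{c..d} \<subseteq> {a..b}"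
  shows "AE s in lebesgue_on {c..d}. P s"
  using assms by (auto simp: AE_restrict_space_iff elim!: eventually_mono)

lemma measurable_subinterval:
  fixes a b c d :: real
  assumes "f \<in> borel_measurable (lebesgue_on {a..b})" "{c..d} \<subseteq> {a..b}"
  shows "f \<in> borel_measurable (lebesgue_on {c..d})"
  by (rule measurable_restrict_mono[OF assms])

lemma nn_integral_subinterval:
  fixes a b c d :: real
  assumes "{c..d} \<subseteq> {a..b}"
  shows "(\<integral>\<^sup>+s. f s \<partial>lebesgue_on {c..d}) \<le> (\<integral>\<^sup>+s. f s \<partial>lebesgue_on {a..b})"
  using assms by (subst (1 2) nn_integral_restrict_space) (auto intro!: nn_integral_mono simp: indicator_def)

lemma finite_measure_interval: "finite_measure (lebesgue_on {a..b::real})"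
  by (rule finite_measureI) (simp add: emeasure_restrict_space emeasure_lborel_Icc_eq)

text \<open>
  Completeness of Lebesgue measure makes measurability of \<open>h\<close> automatic.
\<close>

lemma integrable_cong_AE_interval:
  fixes g h :: "real \<Rightarrow> real"
  assumes g: "integrable (lebesgue_on {a..b}) g" and ae: "AE s in lebesgue_on {a..b}. g s = h s"
  shows "integrable (lebesgue_on {a..b}) h"
proof -
  have "AE s in lebesgue. s \<in> {a..b} \<longrightarrow> g s = h s"
    using ae by (simp add: AE_restrict_space_iff)
  then obtain N where N: "N \<in> null_sets lebesgue" "{s \<in> space lebesgue. \<not> (s \<in> {a..b} \<longrightarrow> g s = h s)} \<subseteq> N"
    unfolding eventually_ae_filter by blast
  have "g absolutely_integrable_on {a..b}"
    using g by (simp add: set_integrable_def integrable_restrict_space)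
  then have "h absolutely_integrable_on {a..b}"
    by (rule absolutely_integrable_spike[where S = N]) (use N in \<open>auto simp: negligible_iff_null_sets\<close>)
  then show ?thesis
    by (rule absolutely_integrable_imp_integrable) simp
qed

lemma integrable_continuous_mult:
  fixes h y :: "real \<Rightarrow> real"
  assumes h: "integrable (lebesgue_on {a..b}) h" and y: "continuous_on {a..b} y"
  shows "integrable (lebesgue_on {a..b}) (\<lambda>t. y t * h t)"
proof -
  have "bounded (y ` {a..b})"
    by (intro compact_imp_bounded compact_continuous_image y compact_Icc)
  then obtain C where C: "\<And>t. t \<in> {a..b} \<Longrightarrow> \<bar>y t\<bar> \<le> C"
    unfolding bounded_iff real_norm_def by blast
  show ?thesis
  proof (rule Bochner_Integration.integrable_bound)
    show "integrable (lebesgue_on {a..b}) (\<lambda>t. C * \<bar>h t\<bar>)" using h by simp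
    show "(\<lambda>t. y t * h t) \<in> borel_measurable (lebesgue_on {a..b})"
      using h borel_measurable_integrable[OF continuous_imp_integrable_real[OF y]] by measurable
    show "AE t in lebesgue_on {a..b}. norm (y t * h t) \<le> norm (C * \<bar>h t\<bar>)"
    proof (rule AE_I2)
      fix t assume "t \<in> space (lebesgue_on {a..b})"
      then have "\<bar>y t\<bar> \<le> \<bar>C\<bar>"
        using C[of t] by auto
      then show "norm (y t * h t) \<le> norm (C * \<bar>h t\<bar>)"
        by (simp add: abs_mult mult_right_mono)
    qed
  qed
qed

lemma integral_interval_diff:
  fixes h :: "real \<Rightarrow> real"
  assumes "integrable (lebesgue_on {a..b}) h" "a \<le> s" "s \<le> t" "t \<le> b"
  shows "(LINT \<tau>|lebesgue_on {a..t}. h \<tau>) = (LINT \<tau>|lebesgue_on {a..s}. h \<tau>) + (LINT \<tau>|lebesgue_on {s..t}. h \<tau>)"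
proof -
  have i: "integrable (lebesgue_on {c..d}) h" if "{c..d} \<subseteq> {a..b}" for c d
    by (rule integrable_subinterval[OF assms(1) that])
  have "integral {a..s} h + integral {s..t} h = integral {a..t} h"
    using assms i[of a t] by (intro Henstock_Kurzweil_Integration.integral_combine integrable_on_lebesgue_on) auto
  then show ?thesis
    using assms i[of a t] i[of a s] i[of s t] by (simp add: lebesgue_integral_eq_integral)
qed

text \<open>
  The square \<open>[a,b] \<times> [a,b]\<close> is the union of the triangles \<open>x \<le> y\<close> and \<open>y \<le> x\<close>, which overlap in a null set
  and carry the same integral of \<open>h(x) h(y)\<close>.
\<close>

lemma square_integral:
  fixes h :: "real \<Rightarrow> real"
  assumes h: "integrable (lebesgue_on {a..b}) h"
  shows "(LINT x|lebesgue_on {a..b}. h x)\<^sup>2 = 2 * (LINT y|lebesgue_on {a..b}. h y * (LINT x|lebesgue_on {a..y}. h x))"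
proof -
  let ?M = "lebesgue_on {a..b}"
  interpret M: finite_measure ?M by (rule finite_measure_interval)
  interpret MM: pair_sigma_finite ?M ?M
    by (intro pair_sigma_finite.intro M.sigma_finite_measure_axioms)
  have [measurable]: "h \<in> borel_measurable ?M" using h by simp
  have idm [measurable]: "(\<lambda>x. x) \<in> borel_measurable ?M"
    by (intro borel_measurable_integrable continuous_imp_integrable_real continuous_on_id)
  define Y where "Y y = (LINT x|lebesgue_on {a..y}. h x)" for y
  let ?i = "\<lambda>x y. if x \<le> y then 1 else (0::real)"
  have int1: "integrable ?M (\<lambda>x. h x * ?i x y)" for y
    by (rule Bochner_Integration.integrable_bound[OF h]) auto
  have int1': "integrable ?M (\<lambda>x. h x * ?i y x)" for y
    by (rule Bochner_Integration.integrable_bound[OF h]) auto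
  have Y: "(LINT x|?M. h x * ?i x y) = Y y" if "y \<in> {a..b}" for y
    unfolding Y_def using that
    by (simp add: integral_restrict_space) (rule Bochner_Integration.integral_cong, auto simp: indicator_def)
  have fst_m [measurable]: "(\<lambda>p. fst p) \<in> borel_measurable (?M \<Otimes>\<^sub>M ?M)" "(\<lambda>p. snd p) \<in> borel_measurable (?M \<Otimes>\<^sub>M ?M)"
    using measurable_compose[OF measurable_fst idm] measurable_compose[OF measurable_snd idm] by auto
  have hm [measurable]: "(\<lambda>p. h (fst p)) \<in> borel_measurable (?M \<Otimes>\<^sub>M ?M)" "(\<lambda>p. h (snd p)) \<in> borel_measurable (?M \<Otimes>\<^sub>M ?M)"
    using measurable_compose[OF measurable_fst, of h] measurable_compose[OF measurable_snd, of h] h by auto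
  have I: "integrable (?M \<Otimes>\<^sub>M ?M) (case_prod (\<lambda>x y. h x * h y * ?i x y))"
  proof (rule MM.Fubini_integrable)
    have "(\<lambda>p. h (fst p) * h (snd p) * (if fst p \<le> snd p then 1 else 0)) \<in> borel_measurable (?M \<Otimes>\<^sub>M ?M)"
      by measurable
    then show "case_prod (\<lambda>x y. h x * h y * ?i x y) \<in> borel_measurable (?M \<Otimes>\<^sub>M ?M)"
      by (simp add: case_prod_beta')
    show "AE x in ?M. integrable ?M (\<lambda>y. case_prod (\<lambda>x y. h x * h y * ?i x y) (x, y))"
      using int1' by (simp add: mult.assoc)
    have "integrable ?M (\<lambda>x. LINT y|?M. norm (h x * h y * ?i x y))"
    proof (rule Bochner_Integration.integrable_bound)
      show "integrable ?M (\<lambda>x. \<bar>h x\<bar> * (LINT y|?M. \<bar>h y\<bar>))" using h by simp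
      have "(\<lambda>p. norm (h (fst p) * h (snd p) * (if fst p \<le> snd p then 1 else 0))) \<in> borel_measurable (?M \<Otimes>\<^sub>M ?M)"
        by measurable
      then show "(\<lambda>x. LINT y|?M. norm (h x * h y * ?i x y)) \<in> borel_measurable ?M"
        by (intro M.borel_measurable_lebesgue_integral) (simp add: case_prod_beta')
      have "(LINT y|?M. norm (h x * h y * ?i x y)) \<le> (LINT y|?M. \<bar>h x\<bar> * \<bar>h y\<bar>)" for x
      proof (rule integral_mono)
        show "integrable ?M (\<lambda>y. norm (h x * h y * ?i x y))"
          using integrable_norm[OF integrable_mult_right[OF int1'[of x], of "h x"]] by (simp add: mult.assoc)
        show "integrable ?M (\<lambda>y. \<bar>h x\<bar> * \<bar>h y\<bar>)" using h by simp
      qed (auto simp: abs_mult)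
      then show "AE x in ?M. norm (LINT y|?M. norm (h x * h y * ?i x y)) \<le> norm (\<bar>h x\<bar> * (LINT y|?M. \<bar>h y\<bar>))"
        by (simp add: abs_mult)
    qed
    then show "integrable ?M (\<lambda>x. LINT y|?M. norm (case_prod (\<lambda>x y. h x * h y * ?i x y) (x, y)))"
      by simp
  qed
  have A1: "(LINT y|?M. (LINT x|?M. h x * h y * ?i x y)) = (LINT y|?M. h y * Y y)"
  proof (rule Bochner_Integration.integral_cong)
    fix y assume "y \<in> space ?M"
    then have "y \<in> {a..b}" by simp
    have "(LINT x|?M. h x * h y * ?i x y) = (LINT x|?M. h y * (h x * ?i x y))"
      by (simp add: mult_ac)
    then show "(LINT x|?M. h x * h y * ?i x y) = h y * Y y"
      using Y[OF \<open>y \<in> {a..b}\<close>] by simp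
  qed simp
  have A2: "(LINT x|?M. (LINT y|?M. h x * h y * ?i x y)) = (LINT y|?M. h y * Y y)"
    using MM.Fubini_integral[OF I] A1 by simp
  \<comment> \<open>The diagonal is counted twice, but it is a null set.\<close>
  have A3: "(LINT y|?M. h x * h y * ?i y x) + (LINT y|?M. h x * h y * ?i x y) = h x * (LINT y|?M. h y)" for x
  proof -
    have "(LINT y|?M. h x * (h y * ?i y x)) + (LINT y|?M. h x * (h y * ?i x y)) = (LINT y|?M. h x * (h y * ?i y x) + h x * (h y * ?i x y))"
      by (intro Bochner_Integration.integral_add[symmetric] integrable_mult_right int1 int1')
    also have "\<dots> = (LINT y|?M. h x * h y)"
    proof (rule integral_cong_AE)
      have "AE y in lebesgue. y \<noteq> x"
        using AE_not_in[of "{x}" lebesgue] by simp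
      then have "AE y in ?M. y \<noteq> x"
        by (auto simp: AE_restrict_space_iff elim!: eventually_mono)
      then show "AE y in ?M. h x * (h y * ?i y x) + h x * (h y * ?i x y) = h x * h y"
        by eventually_elim auto
    qed measurable
    finally show ?thesis by (simp add: mult.assoc)
  qed
  have i3: "integrable ?M (\<lambda>x. LINT y|?M. h x * h y * ?i x y)"
    using MM.integrable_fst[OF I] by simp
  have i4: "integrable ?M (\<lambda>x. LINT y|?M. h x * h y * ?i y x)"
  proof -
    have "(\<lambda>x. LINT y|?M. h x * h y * ?i y x) = (\<lambda>x. h x * (LINT y|?M. h y) - (LINT y|?M. h x * h y * ?i x y))"
      using A3 by (auto simp: fun_eq_iff algebra_simps)
    then show ?thesis using h i3 by simp
  qed
  have "(LINT x|?M. h x)\<^sup>2 = (LINT x|?M. h x * (LINT y|?M. h y))"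
    by (simp add: power2_eq_square)
  also have "\<dots> = (LINT x|?M. (LINT y|?M. h x * h y * ?i y x)) + (LINT x|?M. (LINT y|?M. h x * h y * ?i x y))"
    unfolding A3[symmetric] by (rule Bochner_Integration.integral_add[OF i4 i3])
  also have "(LINT x|?M. (LINT y|?M. h x * h y * ?i y x)) = (LINT y|?M. h y * Y y)"
    using A1 by (simp add: mult_ac)
  finally show ?thesis using A2 by (simp add: Y_def)
qed

text \<open>
  The chain rule for \<open>y\<^sup>2\<close> in integrated form, for an absolutely continuous \<open>y\<close>.
\<close>

lemma square_identity:
  fixes h y :: "real \<Rightarrow> real"
  assumes h: "integrable (lebesgue_on {0..T}) h"
    and y: "\<And>t. t \<in> {0..T} \<Longrightarrow> y t = y 0 + (LINT \<tau>|lebesgue_on {0..t}. h \<tau>)"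
    and st: "0 \<le> s" "s \<le> t" "t \<le> T"
  shows "continuous_on {0..T} y" "(y t)\<^sup>2 = (y s)\<^sup>2 + (LINT \<tau>|lebesgue_on {s..t}. 2 * (y \<tau> * h \<tau>))"
proof -
  have "continuous_on {0..T} (\<lambda>t. y 0 + (LINT \<tau>|lebesgue_on {0..t}. h \<tau>))"
    by (intro continuous_intros indefinite_integral_continuous_real h)
  then show c: "continuous_on {0..T} y"
    by (rule continuous_on_eq) (rule y[symmetric])
  define Y where "Y \<tau> = (LINT x|lebesgue_on {s..\<tau>}. h x)" for \<tau>
  have hs: "integrable (lebesgue_on {s..t}) h"
    using st by (intro integrable_subinterval[OF h]) auto
  have yY: "y \<tau> = y s + Y \<tau>" if "\<tau> \<in> {s..t}" for \<tau>
    using y[of \<tau>] y[of s] integral_interval_diff[OF h, of s \<tau>] st that by (simp add: Y_def)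
  have Yc: "continuous_on {s..t} Y"
    unfolding Y_def by (rule indefinite_integral_continuous_real[OF hs])
  have Yh: "integrable (lebesgue_on {s..t}) (\<lambda>\<tau>. h \<tau> * Y \<tau>)"
    using integrable_continuous_mult[OF hs Yc] by (simp add: mult.commute)
  have "(LINT \<tau>|lebesgue_on {s..t}. 2 * (y \<tau> * h \<tau>)) = (LINT \<tau>|lebesgue_on {s..t}. 2 * y s * h \<tau> + 2 * (h \<tau> * Y \<tau>))"
  proof (rule Bochner_Integration.integral_cong)
    fix \<tau> assume "\<tau> \<in> space (lebesgue_on {s..t})"
    then have e: "y \<tau> = y s + Y \<tau>" by (intro yY) simp
    show "2 * (y \<tau> * h \<tau>) = 2 * y s * h \<tau> + 2 * (h \<tau> * Y \<tau>)"
      unfolding e by (simp add: algebra_simps)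
  qed simp
  also have "\<dots> = 2 * y s * Y t + 2 * (LINT \<tau>|lebesgue_on {s..t}. h \<tau> * Y \<tau>)"
    using hs Yh by (simp add: Y_def)
  also have "2 * (LINT \<tau>|lebesgue_on {s..t}. h \<tau> * Y \<tau>) = (Y t)\<^sup>2"
    using square_integral[OF hs] by (simp add: Y_def)
  finally have L: "(LINT \<tau>|lebesgue_on {s..t}. 2 * (y \<tau> * h \<tau>)) = 2 * y s * Y t + (Y t)\<^sup>2" .
  show "(y t)\<^sup>2 = (y s)\<^sup>2 + (LINT \<tau>|lebesgue_on {s..t}. 2 * (y \<tau> * h \<tau>))"
  proof -
    have e: "y t = y s + Y t" using st by (intro yY) simp
    show ?thesis unfolding L unfolding e by (simp add: power2_eq_square algebra_simps)
  qed
qed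

section \<open>The equation, mode by mode\<close>

locale ns_solution =
  fixes \<mu> \<sigma> T :: real and u0 and f u :: "real \<Rightarrow> real^3 \<Rightarrow> real^3"
  assumes mu: "0 < \<mu>" and sigma: "0 < \<sigma>" and T: "0 < T"
    and u0: "u0 \<in> H" and forcing: "entire_forcing \<sigma> T f" and sol: "weak_solution \<mu> \<sigma> T u0 f u"
begin

definition u_hat :: "real \<Rightarrow> int^3 \<Rightarrow> complex^3" where "u_hat s = fourier_coeff (u s)"
definition b_hat :: "real \<Rightarrow> int^3 \<Rightarrow> complex^3" where "b_hat s = fourier_coeff (B (u s) (u s))"
definition f_hat :: "real \<Rightarrow> int^3 \<Rightarrow> complex^3" where "f_hat s = fourier_coeff (f s)"
text \<open>
  The right-hand side of the evolution equation of the \<open>k\<close>-th coefficient.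
\<close>

definition rhs_hat :: "real \<Rightarrow> int^3 \<Rightarrow> complex^3" where
  "rhs_hat s k = f_hat s k - b_hat s k - (\<mu> * exp (2 * \<sigma> * wn k)) *\<^sub>R u_hat s k"

abbreviation I where "I \<equiv> lebesgue_on {0..T}"

lemma u_H: "s \<in> {0..T} \<Longrightarrow> u s \<in> H"
  using sol by (auto simp: weak_solution_def continuous_into_H_def)

lemma f_H: "s \<in> {0..T} \<Longrightarrow> f s \<in> H"
  using forcing by (auto simp: entire_forcing_def)

lemma AE_dom: "AE s in I. u s \<in> dom_expA \<sigma>"
  using sol by (auto simp: weak_solution_def expA_L2_time_def)

lemma gevrey_sigma_le: "u s \<in> dom_expA \<sigma> \<Longrightarrow> gevrey \<sigma> (u_hat s) \<le> ennreal ((L2_norm (expA \<sigma> (u s)))\<^sup>2 / volume)"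
  unfolding u_hat_def by (rule gevrey_le_expA)

lemma gevrey_sigma_finite: "u s \<in> dom_expA \<sigma> \<Longrightarrow> gevrey \<sigma> (u_hat s) < top"
  using gevrey_sigma_le by (meson ennreal_less_top order_le_less_trans)

lemma b_hat_props:
  assumes "u s \<in> dom_expA \<sigma>"
  shows "B (u s) (u s) \<in> H"
    "\<And>r k. 0 \<le> r \<Longrightarrow> gevrey r (u_hat s) < top \<Longrightarrow>
       norm (b_hat s k) \<le> 9 * wn k * exp (- r * wn k) * enn2real (gevrey r (u_hat s))"
    "(\<lambda>k. u_hat s k \<bullet> b_hat s k) abs_summable_on UNIV" "(\<Sum>\<^sub>\<infinity>k. u_hat s k \<bullet> b_hat s k) = 0"
  using B_field_props[OF dom_expA_H[OF assms] sigma] gevrey_sigma_finite[OF assms]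
  unfolding u_hat_def b_hat_def by blast+

text \<open>
  Insert \<open>testfield k e\<close> into the weak formulation.
\<close>

lemma weak_form:
  fixes e :: "complex^3"
  shows "integrable I (\<lambda>s. e \<bullet> u_hat s k)" "integrable I (\<lambda>s. e \<bullet> b_hat s k)" "integrable I (\<lambda>s. e \<bullet> f_hat s k)"
    "\<And>t. t \<in> {0..T} \<Longrightarrow> e \<bullet> u_hat t k = e \<bullet> u_hat 0 k + (LINT s|lebesgue_on {0..t}. e \<bullet> rhs_hat s k)"
proof -
  let ?v = "testfield k e" and ?W = "exp (2 * \<sigma> * wn k)"
  have cW: "2 * volume * ?W \<noteq> 0" and c2: "2 * volume \<noteq> 0" by simp_all
  have v: "?v \<in> dom_expA \<sigma>" by (rule testfield_dom_expA)
  note S = sol[unfolded weak_solution_def, THEN conjunct2, THEN conjunct2, THEN conjunct2, rule_format, OF v]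
  have 1: "AE s in I. L2_inner (expA \<sigma> (u s)) (expA \<sigma> ?v) = (2 * volume * ?W) * (e \<bullet> u_hat s k)"
    using AE_dom by eventually_elim (simp add: L2_inner_expA_testfield u_hat_def)
  have 2: "AE s in I. L2_inner (B (u s) (u s)) ?v = 2 * volume * (e \<bullet> b_hat s k)"
    using AE_dom by eventually_elim (simp add: L2_inner_testfield_H b_hat_def b_hat_props)
  have 3: "L2_inner (f s) ?v = 2 * volume * (e \<bullet> f_hat s k)" if "s \<in> {0..T}" for s
    using f_H[OF that] by (simp add: L2_inner_testfield_H f_hat_def)
  have iL: "integrable I (\<lambda>s. L2_inner (expA \<sigma> (u s)) (expA \<sigma> ?v))" "integrable I (\<lambda>s. L2_inner (B (u s) (u s)) ?v)"
    "integrable I (\<lambda>s. L2_inner (f s) ?v)"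
    using S by auto
  have scale: "integrable I g" if "integrable I (\<lambda>s. c * g s)" "c \<noteq> 0" for c and g :: "real \<Rightarrow> real"
    using integrable_mult_right[OF that(1), of "1 / c"] that(2) by simp
  have ae3: "AE s in I. L2_inner (f s) ?v = 2 * volume * (e \<bullet> f_hat s k)"
    by (rule AE_I2) (simp add: 3)
  show iu: "integrable I (\<lambda>s. e \<bullet> u_hat s k)"
    by (rule scale[OF integrable_cong_AE_interval[OF iL(1) 1] cW])
  show ib: "integrable I (\<lambda>s. e \<bullet> b_hat s k)"
    by (rule scale[OF integrable_cong_AE_interval[OF iL(2) 2] c2])
  show jf: "integrable I (\<lambda>s. e \<bullet> f_hat s k)"
    by (rule scale[OF integrable_cong_AE_interval[OF iL(3) ae3] c2])
  fix t assume t: "t \<in> {0..T}"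
  let ?J = "lebesgue_on {0..t}"
  have sub: "{0..t} \<subseteq> {0..T}" using t by auto
  have LE: "(LINT s|?J. g s) = c * (LINT s|?J. g' s)"
    if "integrable I g" "AE s in I. g s = c * g' s" "integrable I g'" for g g' :: "real \<Rightarrow> real" and c
  proof -
    have "(LINT s|?J. g s) = (LINT s|?J. c * g' s)"
      using integrable_subinterval[OF that(1) sub] integrable_subinterval[OF that(3) sub] AE_subinterval[OF that(2) sub]
      by (intro integral_cong_AE) auto
    then show ?thesis by simp
  qed
  have "L2_inner u0 ?v = L2_inner (u 0) ?v"
  proof (rule L2_inner_cong_AE(1))
    have "AE x in lebesgue. u 0 x = u0 x" using sol by (simp add: weak_solution_def)
    then show "AE x in torus. u0 x = u 0 x"
      by (auto simp: AE_restrict_space_iff elim!: eventually_mono)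
  qed (use u0 u_H[of 0] T testfield_H in \<open>auto intro: L2_per_measurable H_L2_per\<close>)
  moreover have "L2_inner (u t) ?v + \<mu> * (LINT s|?J. L2_inner (expA \<sigma> (u s)) (expA \<sigma> ?v)) + (LINT s|?J. L2_inner (B (u s) (u s)) ?v)
      = L2_inner u0 ?v + (LINT s|?J. L2_inner (f s) ?v)"
    using S t by blast
  moreover have "L2_inner (u r) ?v = 2 * volume * (e \<bullet> u_hat r k)" if "r \<in> {0..T}" for r
    using u_H[OF that] by (simp add: L2_inner_testfield_H u_hat_def)
  ultimately have "2 * volume * (e \<bullet> u_hat t k) + \<mu> * ((2 * volume * ?W) * (LINT s|?J. e \<bullet> u_hat s k)) + 2 * volume * (LINT s|?J. e \<bullet> b_hat s k)
     = 2 * volume * (e \<bullet> u_hat 0 k) + 2 * volume * (LINT s|?J. e \<bullet> f_hat s k)"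
    using t T by (simp only: LE[OF iL(1) 1 iu] LE[OF iL(2) 2 ib] LE[OF iL(3) ae3 jf]) simp
  moreover have "x = x0 + (r - q - m * W * p)" if "a * x + m * ((a * W) * p) + a * q = a * x0 + a * r" "a \<noteq> 0"
    for a x m W p q x0 r :: real
  proof -
    have "a * x = a * (x0 + (r - q - m * W * p))"
      using that(1) by (simp add: algebra_simps)
    then show ?thesis using that(2) by simp
  qed
  ultimately have "e \<bullet> u_hat t k = e \<bullet> u_hat 0 k + ((LINT s|?J. e \<bullet> f_hat s k) - (LINT s|?J. e \<bullet> b_hat s k) - \<mu> * ?W * (LINT s|?J. e \<bullet> u_hat s k))"
    using c2 by blast
  also have "(LINT s|?J. e \<bullet> f_hat s k) - (LINT s|?J. e \<bullet> b_hat s k) - \<mu> * ?W * (LINT s|?J. e \<bullet> u_hat s k) = (LINT s|?J. e \<bullet> rhs_hat s k)"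
    using integrable_subinterval[OF iu sub] integrable_subinterval[OF ib sub] integrable_subinterval[OF jf sub]
    by (simp add: rhs_hat_def inner_diff_right)
  finally show "e \<bullet> u_hat t k = e \<bullet> u_hat 0 k + (LINT s|?J. e \<bullet> rhs_hat s k)" .
qed

lemma rhs_hat_integrable: "integrable I (\<lambda>s. e \<bullet> rhs_hat s k)" for e :: "complex^3"
  using weak_form(1-3)[of e k] by (simp add: rhs_hat_def inner_diff_right)

lemma u_hat_continuous: "continuous_on {0..T} (\<lambda>s. e \<bullet> u_hat s k)" for e :: "complex^3"
  by (rule square_identity(1)[where s = 0 and t = 0, OF rhs_hat_integrable weak_form(4)]) (use T in auto)

lemma norm_sq_Basis: "(norm a)\<^sup>2 = (\<Sum>e\<in>Basis. (e \<bullet> a)\<^sup>2)" for a :: "complex^3"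
  unfolding power2_norm_eq_inner euclidean_inner[of a a] by (simp add: power2_eq_square inner_commute)

lemma inner_Basis: "(\<Sum>e\<in>Basis. (e \<bullet> a) * (e \<bullet> b)) = a \<bullet> b" for a b :: "complex^3"
  unfolding euclidean_inner[of a b] by (simp add: inner_commute)

lemma norm_u_hat_continuous: "continuous_on {0..T} (\<lambda>s. (norm (u_hat s k))\<^sup>2)"
  unfolding norm_sq_Basis by (intro continuous_intros u_hat_continuous)

lemma mode_identity:
  assumes st: "0 \<le> s" "s \<le> t" "t \<le> T"
  shows "integrable (lebesgue_on {s..t}) (\<lambda>\<tau>. u_hat \<tau> k \<bullet> rhs_hat \<tau> k)"
    "(norm (u_hat t k))\<^sup>2 = (norm (u_hat s k))\<^sup>2 + (LINT \<tau>|lebesgue_on {s..t}. 2 * (u_hat \<tau> k \<bullet> rhs_hat \<tau> k))"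
proof -
  have sub: "{s..t} \<subseteq> {0..T}" using st by auto
  have i: "integrable (lebesgue_on {s..t}) (\<lambda>\<tau>. (e \<bullet> u_hat \<tau> k) * (e \<bullet> rhs_hat \<tau> k))" for e :: "complex^3"
    by (intro integrable_continuous_mult integrable_subinterval[OF rhs_hat_integrable sub] continuous_on_subset[OF u_hat_continuous sub])
  show i2: "integrable (lebesgue_on {s..t}) (\<lambda>\<tau>. u_hat \<tau> k \<bullet> rhs_hat \<tau> k)"
    unfolding inner_Basis[symmetric, of "u_hat _ k"] by (intro Bochner_Integration.integrable_sum i)
  have "(norm (u_hat t k))\<^sup>2 = (\<Sum>e\<in>Basis. (e \<bullet> u_hat s k)\<^sup>2 + (LINT \<tau>|lebesgue_on {s..t}. 2 * ((e \<bullet> u_hat \<tau> k) * (e \<bullet> rhs_hat \<tau> k))))"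
    unfolding norm_sq_Basis
    by (intro sum.cong refl square_identity(2)[OF rhs_hat_integrable weak_form(4) st])
  also have "\<dots> = (norm (u_hat s k))\<^sup>2 + (\<Sum>e\<in>Basis. LINT \<tau>|lebesgue_on {s..t}. 2 * ((e \<bullet> u_hat \<tau> k) * (e \<bullet> rhs_hat \<tau> k)))"
    unfolding norm_sq_Basis by (rule sum.distrib)
  also have "(\<Sum>e\<in>Basis. LINT \<tau>|lebesgue_on {s..t}. 2 * ((e \<bullet> u_hat \<tau> k) * (e \<bullet> rhs_hat \<tau> k)))
     = (LINT \<tau>|lebesgue_on {s..t}. (\<Sum>e\<in>Basis. 2 * ((e \<bullet> u_hat \<tau> k) * (e \<bullet> rhs_hat \<tau> k))))"
    by (intro Bochner_Integration.integral_sum[symmetric] integrable_mult_right i)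
  also have "\<dots> = (LINT \<tau>|lebesgue_on {s..t}. 2 * (u_hat \<tau> k \<bullet> rhs_hat \<tau> k))"
    by (simp only: sum_distrib_left[symmetric] inner_Basis)
  finally show "(norm (u_hat t k))\<^sup>2 = (norm (u_hat s k))\<^sup>2 + (LINT \<tau>|lebesgue_on {s..t}. 2 * (u_hat \<tau> k \<bullet> rhs_hat \<tau> k))" .
qed

lemma gevrey_u_hat_measurable: "(\<lambda>s. gevrey r (u_hat s)) \<in> borel_measurable I"
proof -
  have "(\<lambda>s. (norm (u_hat s k))\<^sup>2) \<in> borel_measurable I" for k
    by (intro borel_measurable_integrable continuous_imp_integrable_real norm_u_hat_continuous)
  then show ?thesis unfolding gevrey_def by measurable
qed

lemma gevrey_f_hat_measurable: "(\<lambda>s. gevrey r (f_hat s)) \<in> borel_measurable I"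
proof -
  have "(\<lambda>s. (norm (f_hat s k))\<^sup>2) \<in> borel_measurable I" for k
    unfolding norm_sq_Basis using weak_form(3) by (intro borel_measurable_sum borel_measurable_power) auto
  then show ?thesis unfolding gevrey_def by measurable
qed

end

section \<open>Energy inequalities\<close>

definition gevrey_part :: "nat \<Rightarrow> real \<Rightarrow> (int^3 \<Rightarrow> complex^3) \<Rightarrow> real" where
  "gevrey_part N r c = (\<Sum>k\<in>enum_modes ` {..<N}. gterm r c k)"

lemma gevrey_SUP: "gevrey r c = (SUP N. ennreal (gevrey_part N r c))"
  unfolding gevrey_part_def by (rule gevrey_partial)

lemma gevrey_part_le_gevrey: "ennreal (gevrey_part N r c) \<le> gevrey r c"
  unfolding gevrey_SUP by (rule SUP_upper) simp

lemma gevrey_part_nonneg [simp]: "0 \<le> gevrey_part N r c"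
  by (simp add: gevrey_part_def sum_nonneg)

lemma gevrey_part_mono: "N \<le> N' \<Longrightarrow> gevrey_part N r c \<le> gevrey_part N' r c"
  unfolding gevrey_part_def by (intro sum_mono2) auto

lemma gevrey_part_incseq: "incseq (\<lambda>N. ennreal (gevrey_part N r c))"
  by (intro incseq_SucI ennreal_leI gevrey_part_mono) simp

text \<open>
  Squaring the factor \<open>9|k|\<close> of \<open>B_field_props\<close> leaves \<open>81|k|\<^sup>2\<close>; the exponential is what remains of the
  weights.
\<close>

definition lattice_const :: "real \<Rightarrow> ennreal" where
  "lattice_const \<sigma> = (\<Sum>n. ennreal (81 * (wn (enum_modes n))\<^sup>2 * exp (- \<sigma> * wn (enum_modes n))))"

lemma lattice_const_finite:
  assumes "0 < \<sigma>"
  shows "lattice_const \<sigma> < top"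
proof -
  have s: "(\<lambda>k. (81 * (4 / \<sigma>)\<^sup>2) * exp (- (\<sigma> / 2) * wn k)) summable_on UNIV"
    using assms by (intro summable_on_cmult_right summable_exp_wavevec) simp
  have b: "81 * (wn k)\<^sup>2 * exp (- \<sigma> * wn k) \<le> (81 * (4 / \<sigma>)\<^sup>2) * exp (- (\<sigma> / 2) * wn k)" for k
  proof -
    let ?n = "wn k"
    have "?n\<^sup>2 \<le> ((1 / (\<sigma> / 4)) * exp ((\<sigma> / 4) * ?n))\<^sup>2"
      using assms by (intro power_mono mult_exp_le) auto
    also have "\<dots> = (4 / \<sigma>)\<^sup>2 * exp ((\<sigma> / 2) * ?n)"
      by (simp add: power_mult_distrib power_divide exp_double[symmetric])
    finally have "81 * ?n\<^sup>2 * exp (- \<sigma> * ?n) \<le> 81 * ((4 / \<sigma>)\<^sup>2 * exp ((\<sigma> / 2) * ?n)) * exp (- \<sigma> * ?n)"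
      by (intro mult_right_mono mult_left_mono) auto
    also have "\<dots> = (81 * (4 / \<sigma>)\<^sup>2) * (exp ((\<sigma> / 2) * ?n) * exp (- \<sigma> * ?n))"
      by (simp only: mult_ac)
    also have "exp ((\<sigma> / 2) * ?n) * exp (- \<sigma> * ?n) = exp (- (\<sigma> / 2) * ?n)"
      by (simp add: exp_add[symmetric])
    finally show ?thesis .
  qed
  have "(\<lambda>k. (81 * (4 / \<sigma>)\<^sup>2) * exp (- (\<sigma> / 2) * wn k)) abs_summable_on UNIV"
    using s by (simp add: abs_mult)
  note e = sums_summable[OF enum_modes_sums[OF this]]
  have "lattice_const \<sigma> \<le> (\<Sum>n. ennreal ((81 * (4 / \<sigma>)\<^sup>2) * exp (- (\<sigma> / 2) * wn (enum_modes n))))"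
    unfolding lattice_const_def by (intro suminf_le ennreal_leI b) auto
  also have "\<dots> < top"
    using e by (subst suminf_ennreal2) auto
  finally show ?thesis .
qed

lemma ennreal_add_le: "ennreal (a + b) \<le> ennreal a + ennreal b"
  by (cases "0 \<le> a"; cases "0 \<le> b") (auto simp: ennreal_neg ennreal_plus[symmetric] simp del: ennreal_plus intro: ennreal_leI)

lemma ennreal_integral_le:
  assumes "integrable M w"
  shows "ennreal (LINT x|M. w x) \<le> (\<integral>\<^sup>+x. ennreal (w x) \<partial>M)"
proof -
  have i: "integrable M (\<lambda>x. max 0 (w x))" using assms by simp
  have "ennreal (LINT x|M. w x) \<le> ennreal (LINT x|M. max 0 (w x))"
    by (intro ennreal_leI integral_mono assms i) simp
  also have "\<dots> = (\<integral>\<^sup>+x. ennreal (max 0 (w x)) \<partial>M)"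
    by (rule nn_integral_eq_integral[OF i, symmetric]) simp
  also have "\<dots> = (\<integral>\<^sup>+x. ennreal (w x) \<partial>M)"
    by (intro nn_integral_cong) (simp add: ennreal_max_0)
  finally show ?thesis .
qed

context ns_solution
begin

text \<open>
  The rate of change of the truncated sum at level \<open>r\<close>, with half of the dissipation added back.
\<close>

abbreviation excess :: "nat \<Rightarrow> real \<Rightarrow> real \<Rightarrow> real" where
  "excess N r \<tau> \<equiv> (\<Sum>k\<in>enum_modes ` {..<N}. exp (2 * r * wn k) * (2 * (u_hat \<tau> k \<bullet> rhs_hat \<tau> k))) + \<mu> * gevrey_part N (r + \<sigma>) (u_hat \<tau>)"

abbreviation source :: "real \<Rightarrow> real \<Rightarrow> ennreal" where
  "source \<rho> \<tau> \<equiv> ennreal (2 / \<mu>) * (lattice_const \<sigma> * (gevrey \<rho> (u_hat \<tau>) * gevrey (\<rho> + \<sigma>) (u_hat \<tau>)) + gevrey \<rho> (f_hat \<tau>))"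

text \<open>
  The inequality for the truncated sums passes to the limit by monotone convergence.  The functions \<open>g N\<close>
  collect terms that cancel only in the full sum over all modes.
\<close>

lemma energy_limit:
  assumes st: "0 \<le> s" "s \<le> t" "t \<le> T"
    and g: "\<And>N. integrable (lebesgue_on {s..t}) (g N)" "(\<lambda>N. LINT \<tau>|lebesgue_on {s..t}. g N \<tau>) \<longlonglongrightarrow> 0"
    and ae: "AE \<tau> in lebesgue_on {s..t}. \<forall>N. ennreal (excess N r \<tau> - g N \<tau>) \<le> G \<tau>"
  shows "gevrey r (u_hat t) + ennreal \<mu> * (\<integral>\<^sup>+\<tau>. gevrey (r + \<sigma>) (u_hat \<tau>) \<partial>lebesgue_on {s..t}) \<le> gevrey r (u_hat s) + (\<integral>\<^sup>+\<tau>. G \<tau> \<partial>lebesgue_on {s..t})"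
proof -
  let ?J = "lebesgue_on {s..t}"
  have sub: "{s..t} \<subseteq> {0..T}" using st by auto
  define q where "q N \<tau> = (\<Sum>k\<in>enum_modes ` {..<N}. exp (2 * r * wn k) * (2 * (u_hat \<tau> k \<bullet> rhs_hat \<tau> k)))" for N \<tau>
  define p where "p N \<tau> = \<mu> * gevrey_part N (r + \<sigma>) (u_hat \<tau>)" for N \<tau>
  have qi: "integrable ?J (q N)" for N
    unfolding q_def by (intro Bochner_Integration.integrable_sum integrable_mult_right mode_identity(1)[OF st])
  have pi: "integrable ?J (p N)" for N
    unfolding p_def gevrey_part_def
    by (intro continuous_imp_integrable_real continuous_intros continuous_on_subset[OF norm_u_hat_continuous sub])
  have E: "gevrey_part N r (u_hat t) = gevrey_part N r (u_hat s) + (LINT \<tau>|?J. q N \<tau>)" for N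
  proof -
    have "(LINT \<tau>|?J. q N \<tau>) = (\<Sum>k\<in>enum_modes ` {..<N}. exp (2 * r * wn k) * (LINT \<tau>|?J. 2 * (u_hat \<tau> k \<bullet> rhs_hat \<tau> k)))"
      unfolding q_def
      by (subst Bochner_Integration.integral_sum) (auto intro!: integrable_mult_right mode_identity(1)[OF st])
    then show ?thesis
      unfolding gevrey_part_def mode_identity(2)[OF st] by (simp add: distrib_left sum.distrib)
  qed
  let ?L = "\<lambda>N. ennreal (gevrey_part N r (u_hat t)) + ennreal \<mu> * (\<integral>\<^sup>+\<tau>. ennreal (gevrey_part N (r + \<sigma>) (u_hat \<tau>)) \<partial>?J)"
  have Em: "(\<lambda>\<tau>. ennreal (gevrey_part N (r + \<sigma>) (u_hat \<tau>))) \<in> borel_measurable ?J" for N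
  proof -
    have "(\<lambda>\<tau>. gevrey_part N (r + \<sigma>) (u_hat \<tau>)) \<in> borel_measurable ?J"
      unfolding gevrey_part_def
      by (intro borel_measurable_integrable continuous_imp_integrable_real continuous_intros continuous_on_subset[OF norm_u_hat_continuous sub])
    then show ?thesis by simp
  qed
  have bound: "?L N \<le> gevrey r (u_hat s) + (\<integral>\<^sup>+\<tau>. G \<tau> \<partial>?J) + ennreal \<bar>LINT \<tau>|?J. g N \<tau>\<bar>" for N
  proof -
    have "(\<integral>\<^sup>+\<tau>. ennreal (p N \<tau>) \<partial>?J) = ennreal \<mu> * (\<integral>\<^sup>+\<tau>. ennreal (gevrey_part N (r + \<sigma>) (u_hat \<tau>)) \<partial>?J)"
      unfolding p_def using mu by (simp add: ennreal_mult nn_integral_cmult Em)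
    moreover have "(\<integral>\<^sup>+\<tau>. ennreal (p N \<tau>) \<partial>?J) = ennreal (LINT \<tau>|?J. p N \<tau>)"
      by (rule nn_integral_eq_integral[OF pi]) (use mu in \<open>simp add: p_def\<close>)
    moreover have "0 \<le> (LINT \<tau>|?J. p N \<tau>)"
      using mu by (intro integral_nonneg_AE) (simp add: p_def)
    ultimately have "?L N = ennreal (gevrey_part N r (u_hat t) + (LINT \<tau>|?J. p N \<tau>))"
      by (simp add: ennreal_plus)
    also have "gevrey_part N r (u_hat t) + (LINT \<tau>|?J. p N \<tau>) = gevrey_part N r (u_hat s) + (LINT \<tau>|?J. q N \<tau> + p N \<tau> - g N \<tau>) + (LINT \<tau>|?J. g N \<tau>)"
      using qi[of N] pi[of N] g(1)[of N] by (simp add: E)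
    also have "ennreal \<dots> \<le> ennreal (gevrey_part N r (u_hat s)) + ennreal (LINT \<tau>|?J. q N \<tau> + p N \<tau> - g N \<tau>) + ennreal (LINT \<tau>|?J. g N \<tau>)"
      by (intro order_trans[OF ennreal_add_le] add_right_mono ennreal_add_le)
    also have "\<dots> \<le> gevrey r (u_hat s) + (\<integral>\<^sup>+\<tau>. G \<tau> \<partial>?J) + ennreal \<bar>LINT \<tau>|?J. g N \<tau>\<bar>"
    proof (intro add_mono gevrey_part_le_gevrey ennreal_leI abs_ge_self)
      have "ennreal (LINT \<tau>|?J. q N \<tau> + p N \<tau> - g N \<tau>) \<le> (\<integral>\<^sup>+\<tau>. ennreal (q N \<tau> + p N \<tau> - g N \<tau>) \<partial>?J)"
        using qi[of N] pi[of N] g(1)[of N] by (intro ennreal_integral_le) simp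
      also have "\<dots> \<le> (\<integral>\<^sup>+\<tau>. G \<tau> \<partial>?J)"
        by (intro nn_integral_mono_AE) (use ae in \<open>auto simp: q_def p_def elim: eventually_mono\<close>)
      finally show "ennreal (LINT \<tau>|?J. q N \<tau> + p N \<tau> - g N \<tau>) \<le> (\<integral>\<^sup>+\<tau>. G \<tau> \<partial>?J)" .
    qed
    finally show ?thesis .
  qed
  have incI: "incseq (\<lambda>N \<tau>. ennreal (gevrey_part N (r + \<sigma>) (u_hat \<tau>)))"
    by (intro incseq_SucI le_funI ennreal_leI gevrey_part_mono) simp
  have incJ: "incseq (\<lambda>N. ennreal \<mu> * (\<integral>\<^sup>+\<tau>. ennreal (gevrey_part N (r + \<sigma>) (u_hat \<tau>)) \<partial>?J))"
    by (intro incseq_SucI mult_left_mono nn_integral_mono ennreal_leI gevrey_part_mono) auto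
  have "gevrey r (u_hat t) + ennreal \<mu> * (\<integral>\<^sup>+\<tau>. gevrey (r + \<sigma>) (u_hat \<tau>) \<partial>?J) = (SUP N. ?L N)"
    unfolding gevrey_SUP nn_integral_monotone_convergence_SUP[OF incI Em] SUP_mult_left_ennreal
    by (rule ennreal_SUP_add[OF gevrey_part_incseq incJ, symmetric])
  moreover have "incseq ?L"
    using gevrey_part_incseq[of r "u_hat t"] incJ by (auto simp: incseq_def intro: add_mono)
  then have "?L \<longlonglongrightarrow> (SUP N. ?L N)"
    by (rule LIMSEQ_SUP)
  moreover have "(\<lambda>N. gevrey r (u_hat s) + (\<integral>\<^sup>+\<tau>. G \<tau> \<partial>?J) + ennreal \<bar>LINT \<tau>|?J. g N \<tau>\<bar>) \<longlonglongrightarrow> gevrey r (u_hat s) + (\<integral>\<^sup>+\<tau>. G \<tau> \<partial>?J) + ennreal 0"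
    by (intro tendsto_add tendsto_const tendsto_ennrealI) (use g(2) in \<open>simp add: tendsto_rabs_zero\<close>)
  ultimately show ?thesis
    using LIMSEQ_le[of ?L _ "\<lambda>N. gevrey r (u_hat s) + (\<integral>\<^sup>+\<tau>. G \<tau> \<partial>?J) + ennreal \<bar>LINT \<tau>|?J. g N \<tau>\<bar>"] bound by auto
qed

lemma u_hat_rhs_hat: "u_hat \<tau> k \<bullet> rhs_hat \<tau> k = u_hat \<tau> k \<bullet> f_hat \<tau> k - u_hat \<tau> k \<bullet> b_hat \<tau> k - \<mu> * gterm \<sigma> (u_hat \<tau>) k"
  by (simp add: rhs_hat_def inner_diff_right power2_norm_eq_inner)

lemma young: "2 * a * b \<le> e * a\<^sup>2 + b\<^sup>2 / e" if "0 < e" for a b e :: real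
proof -
  have "0 \<le> (e * a - b)\<^sup>2 / e" using that by simp
  also have "\<dots> = e * a\<^sup>2 + b\<^sup>2 / e - 2 * a * b"
    using that by (simp add: power2_eq_square field_simps)
  finally show ?thesis by simp
qed

text \<open>
  Of the decay \<open>e\<^bsup>-2r|k|\<^esup>\<close> of \<open>|B\<^sub>k|\<^sup>2\<close> the amount \<open>2\<rho>\<close> is spent on the weight, and at least \<open>\<sigma>\<close> is left to
  sum over the modes.
\<close>

lemma gevrey_b_hat_le:
  assumes u: "u \<tau> \<in> dom_expA \<sigma>" and r: "0 \<le> r" "gevrey r (u_hat \<tau>) < top" and \<rho>: "2 * \<rho> \<le> 2 * r - \<sigma>"
  shows "gevrey \<rho> (b_hat \<tau>) \<le> lattice_const \<sigma> * (gevrey r (u_hat \<tau>))\<^sup>2"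
proof -
  let ?P = "enn2real (gevrey r (u_hat \<tau>))"
  have P: "ennreal (?P\<^sup>2) = (gevrey r (u_hat \<tau>))\<^sup>2"
    using r(2) by (simp add: ennreal_power[symmetric])
  have b: "gterm \<rho> (b_hat \<tau>) k \<le> (81 * (wn k)\<^sup>2 * exp (- \<sigma> * wn k)) * ?P\<^sup>2" for k
  proof -
    let ?n = "wn k"
    have "(norm (b_hat \<tau> k))\<^sup>2 \<le> (9 * ?n * exp (- r * ?n) * ?P)\<^sup>2"
      by (intro power_mono b_hat_props(2)[OF u r]) simp
    also have "\<dots> = 81 * ?n\<^sup>2 * exp (- (2 * r) * ?n) * ?P\<^sup>2"
      by (simp add: power_mult_distrib exp_double[symmetric])
    finally have "exp (2 * \<rho> * ?n) * (norm (b_hat \<tau> k))\<^sup>2 \<le> exp ((2 * r - \<sigma>) * ?n) * (81 * ?n\<^sup>2 * exp (- (2 * r) * ?n) * ?P\<^sup>2)"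
      using \<rho> by (intro mult_mono) (auto intro: mult_right_mono)
    also have "\<dots> = 81 * ?n\<^sup>2 * (exp ((2 * r - \<sigma>) * ?n) * exp (- (2 * r) * ?n)) * ?P\<^sup>2"
      by (simp only: mult_ac)
    also have "exp ((2 * r - \<sigma>) * ?n) * exp (- (2 * r) * ?n) = exp (- \<sigma> * ?n)"
      by (simp add: exp_add[symmetric] algebra_simps)
    finally show ?thesis .
  qed
  have "gevrey \<rho> (b_hat \<tau>) \<le> (\<Sum>n. ennreal (81 * (wn (enum_modes n))\<^sup>2 * exp (- \<sigma> * wn (enum_modes n))) * ennreal (?P\<^sup>2))"
    unfolding gevrey_def[of _ "b_hat \<tau>"]
    by (intro suminf_le) (auto simp: ennreal_mult[symmetric] intro!: ennreal_leI order_trans[OF b])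
  also have "\<dots> = lattice_const \<sigma> * ennreal (?P\<^sup>2)"
    unfolding lattice_const_def by (rule ennreal_suminf_multc)
  finally show ?thesis unfolding P .
qed

text \<open>
  Half of the dissipation is spent, in equal parts, on the force and on the quadratic term, each paired with
  the solution as \<open>e\<^bsup>\<rho>|k|\<^esup>\<close> against \<open>e\<^bsup>(\<rho>+2\<sigma>)|k|\<^esup>\<close>.
\<close>

lemma energy_step:
  assumes st: "0 \<le> s" "s \<le> t" "t \<le> T" and \<rho>: "0 \<le> \<rho>"
    and fin: "(\<integral>\<^sup>+\<tau>. gevrey (\<rho> + \<sigma>) (u_hat \<tau>) \<partial>lebesgue_on {s..t}) < top"
  shows "gevrey (\<rho> + \<sigma>) (u_hat t) + ennreal \<mu> * (\<integral>\<^sup>+\<tau>. gevrey (\<rho> + \<sigma> + \<sigma>) (u_hat \<tau>) \<partial>lebesgue_on {s..t})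
    \<le> gevrey (\<rho> + \<sigma>) (u_hat s) + (\<integral>\<^sup>+\<tau>. source \<rho> \<tau> \<partial>lebesgue_on {s..t})"
proof (rule energy_limit[OF st, where g = "\<lambda>_ _. 0"])
  let ?J = "lebesgue_on {s..t}"
  have sub: "{s..t} \<subseteq> {0..T}" using st by auto
  have "AE \<tau> in ?J. gevrey (\<rho> + \<sigma>) (u_hat \<tau>) \<noteq> \<infinity>"
    using fin by (intro nn_integral_noteq_infinite measurable_subinterval[OF gevrey_u_hat_measurable sub]) auto
  then show "AE \<tau> in ?J. \<forall>N. ennreal (excess N (\<rho> + \<sigma>) \<tau> - 0)
      \<le> source \<rho> \<tau>"
    using AE_subinterval[OF AE_dom sub]
  proof (eventually_elim, intro allI)
    fix \<tau> N
    assume fin': "gevrey (\<rho> + \<sigma>) (u_hat \<tau>) \<noteq> \<infinity>" and u: "u \<tau> \<in> dom_expA \<sigma>"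
    have mode: "exp (2 * (\<rho> + \<sigma>) * wn k) * (2 * (u_hat \<tau> k \<bullet> rhs_hat \<tau> k)) + \<mu> * (gterm (\<rho> + \<sigma> + \<sigma>) (u_hat \<tau>) k)
        \<le> (2 / \<mu>) * (gterm \<rho> (b_hat \<tau>) k) + (2 / \<mu>) * (gterm \<rho> (f_hat \<tau>) k)" for k
    proof -
      let ?n = "wn k"
      define x where "x = exp ((\<rho> + \<sigma> + \<sigma>) * ?n) * norm (u_hat \<tau> k)"
      define y where "y = exp (\<rho> * ?n)"
      have x2: "exp (2 * (\<rho> + \<sigma> + \<sigma>) * ?n) * (norm (u_hat \<tau> k))\<^sup>2 = x\<^sup>2"
        by (simp add: x_def power_mult_distrib exp_double[symmetric] mult.assoc)
      have xy: "exp (2 * (\<rho> + \<sigma>) * ?n) * (2 * norm (u_hat \<tau> k) * z) = 2 * x * (y * z)" for z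
        by (simp add: x_def y_def mult_ac) (simp add: exp_add[symmetric] algebra_simps)
      have y2: "exp (2 * \<rho> * ?n) * z\<^sup>2 = (y * z)\<^sup>2" for z
        by (simp add: y_def power_mult_distrib exp_double[symmetric] mult.assoc)
      have visc: "exp (2 * (\<rho> + \<sigma>) * ?n) * (2 * (\<mu> * exp (2 * \<sigma> * ?n) * (norm (u_hat \<tau> k))\<^sup>2)) = 2 * \<mu> * x\<^sup>2"
        unfolding x2[symmetric] by (simp add: exp_add[symmetric] algebra_simps)
      have "u_hat \<tau> k \<bullet> f_hat \<tau> k - u_hat \<tau> k \<bullet> b_hat \<tau> k \<le> norm (u_hat \<tau> k) * norm (f_hat \<tau> k) + norm (u_hat \<tau> k) * norm (b_hat \<tau> k)"
        using norm_cauchy_schwarz[of "u_hat \<tau> k" "f_hat \<tau> k"] norm_cauchy_schwarz[of "u_hat \<tau> k" "- b_hat \<tau> k"] by simp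
      then have "exp (2 * (\<rho> + \<sigma>) * ?n) * (2 * (u_hat \<tau> k \<bullet> f_hat \<tau> k - u_hat \<tau> k \<bullet> b_hat \<tau> k)) \<le> exp (2 * (\<rho> + \<sigma>) * ?n) * (2 * norm (u_hat \<tau> k) * norm (f_hat \<tau> k)) + exp (2 * (\<rho> + \<sigma>) * ?n) * (2 * norm (u_hat \<tau> k) * norm (b_hat \<tau> k))"
        unfolding distrib_left[symmetric] by (intro mult_left_mono) auto
      also have "\<dots> = 2 * x * (y * norm (f_hat \<tau> k)) + 2 * x * (y * norm (b_hat \<tau> k))"
        by (simp only: xy)
      also have "\<dots> \<le> ((\<mu> / 2) * x\<^sup>2 + (y * norm (f_hat \<tau> k))\<^sup>2 / (\<mu> / 2)) + ((\<mu> / 2) * x\<^sup>2 + (y * norm (b_hat \<tau> k))\<^sup>2 / (\<mu> / 2))"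
        using mu by (intro add_mono young) auto
      finally have "exp (2 * (\<rho> + \<sigma>) * ?n) * (2 * (u_hat \<tau> k \<bullet> f_hat \<tau> k - u_hat \<tau> k \<bullet> b_hat \<tau> k)) \<le> \<mu> * x\<^sup>2 + (2 / \<mu>) * (y * norm (b_hat \<tau> k))\<^sup>2 + (2 / \<mu>) * (y * norm (f_hat \<tau> k))\<^sup>2"
        by (simp add: mult.commute[of _ 2])
      moreover have "exp (2 * (\<rho> + \<sigma>) * ?n) * (2 * (u_hat \<tau> k \<bullet> rhs_hat \<tau> k)) = exp (2 * (\<rho> + \<sigma>) * ?n) * (2 * (u_hat \<tau> k \<bullet> f_hat \<tau> k - u_hat \<tau> k \<bullet> b_hat \<tau> k)) - 2 * \<mu> * x\<^sup>2"
        unfolding u_hat_rhs_hat visc[symmetric] by (simp add: algebra_simps)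
      ultimately show ?thesis unfolding x2 y2 by linarith
    qed
    have "excess N (\<rho> + \<sigma>) \<tau> \<le> (2 / \<mu>) * gevrey_part N \<rho> (b_hat \<tau>) + (2 / \<mu>) * gevrey_part N \<rho> (f_hat \<tau>)"
      unfolding gevrey_part_def sum_distrib_left sum.distrib[symmetric] by (intro sum_mono mode)
    then have "ennreal (excess N (\<rho> + \<sigma>) \<tau> - 0)
       \<le> ennreal ((2 / \<mu>) * (gevrey_part N \<rho> (b_hat \<tau>) + gevrey_part N \<rho> (f_hat \<tau>)))"
      unfolding distrib_left[of "2 / \<mu>"] by (intro ennreal_leI) simp
    also have "\<dots> = ennreal (2 / \<mu>) * (ennreal (gevrey_part N \<rho> (b_hat \<tau>)) + ennreal (gevrey_part N \<rho> (f_hat \<tau>)))"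
      using mu by (subst ennreal_mult) (auto simp del: ennreal_plus simp: ennreal_plus)
    also have "\<dots> \<le> source \<rho> \<tau>"
    proof (intro mult_left_mono add_mono gevrey_part_le_gevrey)
      have f2: "gevrey (\<rho> + \<sigma> / 2) (u_hat \<tau>) < top"
        using gevrey_mono[of "\<rho> + \<sigma> / 2" "\<rho> + \<sigma>" "u_hat \<tau>"] fin' sigma by (auto simp: less_top[symmetric] top_unique)
      have "ennreal (gevrey_part N \<rho> (b_hat \<tau>)) \<le> gevrey \<rho> (b_hat \<tau>)" by (rule gevrey_part_le_gevrey)
      also have "\<dots> \<le> lattice_const \<sigma> * (gevrey (\<rho> + \<sigma> / 2) (u_hat \<tau>))\<^sup>2"
        using \<rho> sigma by (intro gevrey_b_hat_le u f2) auto
      also have "\<dots> \<le> lattice_const \<sigma> * (gevrey \<rho> (u_hat \<tau>) * gevrey (\<rho> + \<sigma>) (u_hat \<tau>))"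
        using gevrey_Cauchy_Schwarz[of \<rho> "\<rho> + \<sigma>" "u_hat \<tau>"] by (intro mult_left_mono) (auto simp: field_simps)
      finally show "ennreal (gevrey_part N \<rho> (b_hat \<tau>)) \<le> lattice_const \<sigma> * (gevrey \<rho> (u_hat \<tau>) * gevrey (\<rho> + \<sigma>) (u_hat \<tau>))" .
    qed auto
    finally show "ennreal (excess N (\<rho> + \<sigma>) \<tau> - 0)
      \<le> source \<rho> \<tau>" .
  qed
qed auto

text \<open>
  A continuous curve on a compact interval is bounded.
\<close>

lemma gevrey_0_bounded: "\<exists>K\<ge>0. \<forall>s\<in>{0..T}. gevrey 0 (u_hat s) \<le> ennreal K"
proof -
  let ?N = "\<lambda>s. (L2_norm (u s))\<^sup>2"
  have sq: "(L2_norm (u s))\<^sup>2 \<le> 2 * (L2_norm (\<lambda>x. u s x - u t x))\<^sup>2 + 2 * (L2_norm (u t))\<^sup>2"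
    if "s \<in> {0..T}" "t \<in> {0..T}" for s t
  proof -
    have us: "u s \<in> L2_per" "u t \<in> L2_per" using that u_H H_L2_per by auto
    have i: "integrable torus (\<lambda>x. (norm (u s x))\<^sup>2)" "integrable torus (\<lambda>x. (norm (u t x))\<^sup>2)" "integrable torus (\<lambda>x. u s x \<bullet> u t x)"
      using us L2_per_inner_integrable[OF us] by (auto simp: L2_per_def)
    have d: "(norm (u s x - u t x))\<^sup>2 = (norm (u s x))\<^sup>2 - 2 * (u s x \<bullet> u t x) + (norm (u t x))\<^sup>2" for x
      by (simp add: power2_norm_eq_inner inner_diff_left inner_diff_right inner_commute)
    have i4: "integrable torus (\<lambda>x. (norm (u s x - u t x))\<^sup>2)"
      unfolding d using i by simp
    have p: "(norm (u s x))\<^sup>2 \<le> 2 * (norm (u s x - u t x))\<^sup>2 + 2 * (norm (u t x))\<^sup>2" for x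
    proof -
      have "0 \<le> (norm (u s x - 2 *\<^sub>R u t x))\<^sup>2" by simp
      also have "\<dots> = 2 * (norm (u s x - u t x))\<^sup>2 + 2 * (norm (u t x))\<^sup>2 - (norm (u s x))\<^sup>2"
        by (simp add: power2_norm_eq_inner inner_diff_left inner_diff_right inner_commute)
      finally show ?thesis by simp
    qed
    have "(LINT x|torus. (norm (u s x))\<^sup>2) \<le> (LINT x|torus. 2 * (norm (u s x - u t x))\<^sup>2 + 2 * (norm (u t x))\<^sup>2)"
      by (intro integral_mono i Bochner_Integration.integrable_add integrable_mult_right i4 p)
    also have "\<dots> = 2 * (LINT x|torus. (norm (u s x - u t x))\<^sup>2) + 2 * (LINT x|torus. (norm (u t x))\<^sup>2)"
      using i4 i by simp
    finally show ?thesis by (simp add: L2_norm_def)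
  qed
  have "\<exists>U. open U \<and> t \<in> U \<and> (\<forall>s\<in>U \<inter> {0..T}. ?N s \<le> 2 + 2 * ?N t)" if t: "t \<in> {0..T}" for t
  proof -
    have "((\<lambda>s. L2_norm (\<lambda>x. u s x - u t x)) \<longlongrightarrow> 0) (at t within {0..T})"
      using sol t by (auto simp: weak_solution_def continuous_into_H_def)
    then have "eventually (\<lambda>s. dist (L2_norm (\<lambda>x. u s x - u t x)) 0 < 1) (at t within {0..T})"
      by (rule tendstoD) simp
    then obtain U where U: "open U" "t \<in> U" "\<And>s. s \<in> U \<Longrightarrow> s \<noteq> t \<Longrightarrow> s \<in> {0..T} \<Longrightarrow> dist (L2_norm (\<lambda>x. u s x - u t x)) 0 < 1"
      unfolding eventually_at_topological by blast
    have "?N s \<le> 2 + 2 * ?N t" if s: "s \<in> U" "s \<in> {0..T}" for s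
    proof (cases "s = t")
      case False
      then have "\<bar>L2_norm (\<lambda>x. u s x - u t x)\<bar> < 1"
        using U(3)[OF s(1) _ s(2)] by simp
      then have "(L2_norm (\<lambda>x. u s x - u t x))\<^sup>2 \<le> 1"
        by (simp add: abs_square_le_1)
      then show ?thesis using sq[OF s(2) t] by simp
    qed simp
    then show ?thesis using U by blast
  qed
  then obtain U where U: "\<And>t. t \<in> {0..T} \<Longrightarrow> open (U t) \<and> t \<in> U t \<and> (\<forall>s\<in>U t \<inter> {0..T}. ?N s \<le> 2 + 2 * ?N t)"
    by metis
  have U': "\<And>t. t \<in> {0..T} \<Longrightarrow> open (U t)" "{0..T} \<subseteq> (\<Union>t\<in>{0..T}. U t)"
    using U by auto
  obtain D where D: "D \<subseteq> {0..T}" "finite D" "{0..T} \<subseteq> (\<Union>t\<in>D. U t)"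
    using compactE_image[OF compact_Icc U'] by blast
  define K where "K = (\<Sum>t\<in>D. 2 + 2 * ?N t)"
  have "?N s \<le> K" if s: "s \<in> {0..T}" for s
  proof -
    obtain t where t: "t \<in> D" "s \<in> U t" using D s by auto
    then have "?N s \<le> 2 + 2 * ?N t" using U D s by blast
    also have "\<dots> \<le> K"
      unfolding K_def by (rule member_le_sum) (use t D in auto)
    finally show ?thesis .
  qed
  then have "\<forall>s\<in>{0..T}. gevrey 0 (u_hat s) \<le> ennreal (K / volume)"
    unfolding u_hat_def
    by (auto intro!: order_trans[OF gevrey_0_le_L2_norm[OF H_L2_per[OF u_H]]] ennreal_leI divide_right_mono)
  moreover have "0 \<le> K / volume" by (simp add: K_def sum_nonneg)
  ultimately show ?thesis by blast
qed

lemma nn_integral_gevrey_sigma: "(\<integral>\<^sup>+s. gevrey \<sigma> (u_hat s) \<partial>I) < top"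
proof -
  have i: "integrable I (\<lambda>s. (L2_norm (expA \<sigma> (u s)))\<^sup>2)"
    using sol by (auto simp: weak_solution_def expA_L2_time_def L2_time_def)
  have "(\<integral>\<^sup>+s. gevrey \<sigma> (u_hat s) \<partial>I) \<le> (\<integral>\<^sup>+s. ennreal ((L2_norm (expA \<sigma> (u s)))\<^sup>2 / volume) \<partial>I)"
    by (rule nn_integral_mono_AE[OF eventually_mono[OF AE_dom gevrey_sigma_le]])
  also have "\<dots> = ennreal (LINT s|I. (L2_norm (expA \<sigma> (u s)))\<^sup>2 / volume)"
    by (rule nn_integral_eq_integral) (use i in auto)
  also have "\<dots> < top" by simp
  finally show ?thesis .
qed

lemma nn_integral_gevrey_f_hat:
  assumes "0 \<le> M"
  shows "(\<integral>\<^sup>+s. gevrey (M * \<sigma>) (f_hat s) \<partial>I) \<le> ennreal ((LINT s|I. (L2_norm (expA (M * \<sigma>) (f s)))\<^sup>2) / volume)"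
proof -
  have e: "expA_L2_time {0..T} (M * \<sigma>) f"
    using forcing assms by (auto simp: entire_forcing_def)
  then have i: "integrable I (\<lambda>s. (L2_norm (expA (M * \<sigma>) (f s)))\<^sup>2)" and d: "AE s in I. f s \<in> dom_expA (M * \<sigma>)"
    by (auto simp: expA_L2_time_def L2_time_def)
  have "(\<integral>\<^sup>+s. gevrey (M * \<sigma>) (f_hat s) \<partial>I) \<le> (\<integral>\<^sup>+s. ennreal ((L2_norm (expA (M * \<sigma>) (f s)))\<^sup>2 / volume) \<partial>I)"
    unfolding f_hat_def by (rule nn_integral_mono_AE[OF eventually_mono[OF d gevrey_le_expA]])
  also have "\<dots> = ennreal (LINT s|I. (L2_norm (expA (M * \<sigma>) (f s)))\<^sup>2 / volume)"
    by (rule nn_integral_eq_integral) (use i in auto)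
  finally show ?thesis by simp
qed

text \<open>
  The pairing of the truncated solution with the quadratic term need not vanish, but it tends to zero
  pointwise in time and is dominated by \<open>\<phi>\<^sub>\<sigma> + S K\<^sup>2\<close>, where \<open>K\<close> bounds \<open>\<phi>\<^sub>0\<close>.
\<close>

lemma base_inequality:
  assumes t: "0 \<le> t" "t \<le> T"
  shows "gevrey 0 (u_hat t) + ennreal \<mu> * (\<integral>\<^sup>+\<tau>. gevrey \<sigma> (u_hat \<tau>) \<partial>lebesgue_on {0..t})
    \<le> gevrey 0 (u_hat 0) + (\<integral>\<^sup>+\<tau>. ennreal (1 / \<mu>) * gevrey 0 (f_hat \<tau>) \<partial>lebesgue_on {0..t})"
proof -
  let ?J = "lebesgue_on {0..t}"
  have sub: "{0..t} \<subseteq> {0..T}" using t by auto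
  define g where "g N \<tau> = (\<Sum>k\<in>enum_modes ` {..<N}. - 2 * (u_hat \<tau> k \<bullet> b_hat \<tau> k))" for N \<tau>
  obtain K where K: "0 \<le> K" "\<And>s. s \<in> {0..T} \<Longrightarrow> gevrey 0 (u_hat s) \<le> ennreal K"
    using gevrey_0_bounded by blast
  \<comment> \<open>This majorant results from \<open>2ab \<le> a\<^sup>2 + b\<^sup>2\<close> with weights \<open>e\<^bsup>\<sigma>|k|\<^esup>\<close> and \<open>e\<^bsup>-\<sigma>|k|\<^esup>\<close> on the two factors.\<close>
  define D where "D \<tau> = enn2real (gevrey \<sigma> (u_hat \<tau>)) + enn2real (lattice_const \<sigma>) * K\<^sup>2" for \<tau>
  have gi: "integrable ?J (g N)" for N
  proof -
    have "integrable ?J (\<lambda>\<tau>. u_hat \<tau> k \<bullet> b_hat \<tau> k)" for k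
      unfolding inner_Basis[symmetric, of "u_hat _ k"]
      by (intro Bochner_Integration.integrable_sum integrable_continuous_mult integrable_subinterval[OF weak_form(2) sub]
          continuous_on_subset[OF u_hat_continuous sub])
    then show ?thesis
      unfolding g_def by (intro Bochner_Integration.integrable_sum integrable_mult_right)
  qed
  have Di: "integrable ?J D"
  proof -
    have "integrable I (\<lambda>\<tau>. enn2real (gevrey \<sigma> (u_hat \<tau>)))"
    proof (rule integrableI_bounded)
      show "(\<lambda>\<tau>. enn2real (gevrey \<sigma> (u_hat \<tau>))) \<in> borel_measurable I"
        using gevrey_u_hat_measurable by measurable
      have "(\<integral>\<^sup>+\<tau>. ennreal (norm (enn2real (gevrey \<sigma> (u_hat \<tau>)))) \<partial>I) \<le> (\<integral>\<^sup>+\<tau>. gevrey \<sigma> (u_hat \<tau>) \<partial>I)"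
        by (intro nn_integral_mono) (simp add: ennreal_enn2real_if)
      then show "(\<integral>\<^sup>+\<tau>. ennreal (norm (enn2real (gevrey \<sigma> (u_hat \<tau>)))) \<partial>I) < \<infinity>"
        using nn_integral_gevrey_sigma by (simp add: order_le_less_trans)
    qed
    then have "integrable ?J (\<lambda>\<tau>. enn2real (gevrey \<sigma> (u_hat \<tau>)))"
      by (rule integrable_subinterval[OF _ sub])
    moreover have "integrable ?J (\<lambda>\<tau>. enn2real (lattice_const \<sigma>) * K\<^sup>2)"
      by (rule finite_measure.integrable_const[OF finite_measure_interval])
    ultimately show ?thesis unfolding D_def by simp
  qed
  have glim: "(\<lambda>N. LINT \<tau>|?J. g N \<tau>) \<longlonglongrightarrow> (LINT \<tau>|?J. 0)"
  proof (rule integral_dominated_convergence[OF _ _ Di])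
    show "AE \<tau> in ?J. (\<lambda>N. g N \<tau>) \<longlonglongrightarrow> 0"
      using AE_subinterval[OF AE_dom sub]
    proof eventually_elim
      fix \<tau> assume u: "u \<tau> \<in> dom_expA \<sigma>"
      have inj: "inj_on enum_modes A" for A
        using bij_enum_modes by (auto simp: bij_betw_def intro: inj_on_subset)
      have "(\<lambda>n. u_hat \<tau> (enum_modes n) \<bullet> b_hat \<tau> (enum_modes n)) sums 0"
        using enum_modes_sums[OF b_hat_props(3)[OF u]] b_hat_props(4)[OF u] by simp
      then have "(\<lambda>N. - 2 * (\<Sum>n<N. u_hat \<tau> (enum_modes n) \<bullet> b_hat \<tau> (enum_modes n))) \<longlonglongrightarrow> - 2 * 0"
        unfolding sums_def by (rule tendsto_mult_left)
      moreover have "g N \<tau> = - 2 * (\<Sum>n<N. u_hat \<tau> (enum_modes n) \<bullet> b_hat \<tau> (enum_modes n))" for N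
        by (simp add: g_def sum.reindex[OF inj] sum_distrib_left)
      ultimately show "(\<lambda>N. g N \<tau>) \<longlonglongrightarrow> 0"
        by simp
    qed
    show "AE \<tau> in ?J. norm (g N \<tau>) \<le> D \<tau>" for N
      using AE_subinterval[OF AE_dom sub] AE_space
    proof eventually_elim
      fix \<tau> assume u: "u \<tau> \<in> dom_expA \<sigma>" and "\<tau> \<in> space ?J"
      then have \<tau>: "\<tau> \<in> {0..T}" using t by simp
      have p0: "gevrey 0 (u_hat \<tau>) \<le> ennreal K" by (rule K(2)[OF \<tau>])
      then have f0: "gevrey 0 (u_hat \<tau>) < top" by (meson ennreal_less_top order_le_less_trans)
      have "norm (g N \<tau>) \<le> (\<Sum>k\<in>enum_modes ` {..<N}. gterm \<sigma> (u_hat \<tau>) k + gterm (- \<sigma>) (b_hat \<tau>) k)"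
        unfolding g_def
      proof (rule sum_norm_le)
        fix k
        let ?a = "exp (\<sigma> * wn k) * norm (u_hat \<tau> k)" and ?b = "exp (- \<sigma> * wn k) * norm (b_hat \<tau> k)"
        have "norm (- 2 * (u_hat \<tau> k \<bullet> b_hat \<tau> k)) \<le> 2 * (norm (u_hat \<tau> k) * norm (b_hat \<tau> k))"
          using Cauchy_Schwarz_ineq2[of "u_hat \<tau> k" "b_hat \<tau> k"] by simp
        also have "\<dots> = 2 * ?a * ?b"
          by (simp add: exp_minus field_simps)
        also have "\<dots> \<le> ?a\<^sup>2 + ?b\<^sup>2" by (rule sum_squares_bound)
        finally show "norm (- 2 * (u_hat \<tau> k \<bullet> b_hat \<tau> k)) \<le> gterm \<sigma> (u_hat \<tau>) k + gterm (- \<sigma>) (b_hat \<tau>) k"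
          by (simp add: power_mult_distrib exp_double[symmetric] mult.assoc)
      qed
      also have "\<dots> = gevrey_part N \<sigma> (u_hat \<tau>) + gevrey_part N (- \<sigma>) (b_hat \<tau>)"
        by (simp add: gevrey_part_def sum.distrib)
      also have "\<dots> \<le> D \<tau>"
        unfolding D_def
      proof (intro add_mono)
        have "ennreal (gevrey_part N \<sigma> (u_hat \<tau>)) \<le> ennreal (enn2real (gevrey \<sigma> (u_hat \<tau>)))"
          using gevrey_part_le_gevrey[of N \<sigma> "u_hat \<tau>"] gevrey_sigma_finite[OF u] by simp
        then show "gevrey_part N \<sigma> (u_hat \<tau>) \<le> enn2real (gevrey \<sigma> (u_hat \<tau>))"
          by (simp add: ennreal_le_iff)
        have "ennreal (gevrey_part N (- \<sigma>) (b_hat \<tau>)) \<le> gevrey (- \<sigma>) (b_hat \<tau>)" by (rule gevrey_part_le_gevrey)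
        also have "\<dots> \<le> lattice_const \<sigma> * (gevrey 0 (u_hat \<tau>))\<^sup>2"
          using sigma by (intro gevrey_b_hat_le[OF u _ f0]) auto
        also have "\<dots> \<le> lattice_const \<sigma> * (ennreal K)\<^sup>2"
          by (intro mult_left_mono power_mono p0) auto
        also have "\<dots> = ennreal (enn2real (lattice_const \<sigma>) * K\<^sup>2)"
          using lattice_const_finite[OF sigma] K(1) by (simp add: ennreal_mult ennreal_power[symmetric])
        finally show "gevrey_part N (- \<sigma>) (b_hat \<tau>) \<le> enn2real (lattice_const \<sigma>) * K\<^sup>2"
          using K(1) by (simp add: ennreal_le_iff)
      qed
      finally show "norm (g N \<tau>) \<le> D \<tau>" .
    qed
  qed (use gi in auto)
  have "gevrey 0 (u_hat t) + ennreal \<mu> * (\<integral>\<^sup>+\<tau>. gevrey (0 + \<sigma>) (u_hat \<tau>) \<partial>?J) \<le> gevrey 0 (u_hat 0) + (\<integral>\<^sup>+\<tau>. ennreal (1 / \<mu>) * gevrey 0 (f_hat \<tau>) \<partial>?J)"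
  proof (rule energy_limit[where g = g])
    show "AE \<tau> in ?J. \<forall>N. ennreal (excess N 0 \<tau> - g N \<tau>) \<le> ennreal (1 / \<mu>) * gevrey 0 (f_hat \<tau>)"
    proof (intro AE_I2 allI)
      fix \<tau> N
      have mode: "2 * (u_hat \<tau> k \<bullet> rhs_hat \<tau> k) + \<mu> * (gterm \<sigma> (u_hat \<tau>) k) + 2 * (u_hat \<tau> k \<bullet> b_hat \<tau> k) \<le> (1 / \<mu>) * (norm (f_hat \<tau> k))\<^sup>2" for k
      proof -
        have "2 * (u_hat \<tau> k \<bullet> f_hat \<tau> k) \<le> 2 * norm (u_hat \<tau> k) * norm (f_hat \<tau> k)"
          using norm_cauchy_schwarz[of "u_hat \<tau> k" "f_hat \<tau> k"] by simp
        also have "\<dots> \<le> \<mu> * (norm (u_hat \<tau> k))\<^sup>2 + (norm (f_hat \<tau> k))\<^sup>2 / \<mu>"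
          by (rule young[OF mu])
        also have "(norm (u_hat \<tau> k))\<^sup>2 \<le> gterm \<sigma> (u_hat \<tau>) k"
          using sigma mult_right_mono[of 1 "exp (2 * \<sigma> * wn k)" "(norm (u_hat \<tau> k))\<^sup>2"] by simp
        finally have "2 * (u_hat \<tau> k \<bullet> f_hat \<tau> k) \<le> \<mu> * (gterm \<sigma> (u_hat \<tau>) k) + (norm (f_hat \<tau> k))\<^sup>2 / \<mu>"
          using mu by simp
        then show ?thesis unfolding u_hat_rhs_hat by (simp add: algebra_simps)
      qed
      have "(\<Sum>k\<in>enum_modes ` {..<N}. 2 * (u_hat \<tau> k \<bullet> rhs_hat \<tau> k) + \<mu> * (gterm \<sigma> (u_hat \<tau>) k) + 2 * (u_hat \<tau> k \<bullet> b_hat \<tau> k)) \<le> (\<Sum>k\<in>enum_modes ` {..<N}. (1 / \<mu>) * (norm (f_hat \<tau> k))\<^sup>2)"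
        by (intro sum_mono mode)
      then have "excess N 0 \<tau> - g N \<tau> \<le> (1 / \<mu>) * gevrey_part N 0 (f_hat \<tau>)"
        by (simp add: gevrey_part_def g_def sum.distrib sum_distrib_left sum_negf)
      then have "ennreal (excess N 0 \<tau> - g N \<tau>) \<le> ennreal ((1 / \<mu>) * gevrey_part N 0 (f_hat \<tau>))"
        by (rule ennreal_leI)
      also have "\<dots> = ennreal (1 / \<mu>) * ennreal (gevrey_part N 0 (f_hat \<tau>))"
        using mu by (intro ennreal_mult) auto
      also have "\<dots> \<le> ennreal (1 / \<mu>) * gevrey 0 (f_hat \<tau>)"
        by (intro mult_left_mono gevrey_part_le_gevrey) auto
      finally show "ennreal (excess N 0 \<tau> - g N \<tau>) \<le> ennreal (1 / \<mu>) * gevrey 0 (f_hat \<tau>)" .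
    qed
  qed (use t gi glim in auto)
  then show ?thesis by simp
qed

end

section \<open>Smoothing by induction on the exponent\<close>

lemma ennreal_mult_le_cancel:
  assumes "0 < m" "ennreal m * b \<le> ennreal R" "0 \<le> R"
  shows "b \<le> ennreal (R / m)"
proof (cases b)
  case (real x)
  then have "m * x \<le> R"
    using assms by (simp add: ennreal_mult[symmetric])
  then show ?thesis
    using real assms by (auto intro!: ennreal_leI simp: field_simps)
next
  case top
  then show ?thesis using assms by (simp add: ennreal_mult_top top_unique)
qed

context ns_solution
begin

text \<open>
  A function does not exceed its mean everywhere; adding 1 leaves room for a strict inequality.
\<close>

lemma small_value:
  assumes ab: "0 \<le> a" "a < b" "b \<le> T" and X: "0 \<le> X" and i: "(\<integral>\<^sup>+\<tau>. gevrey r (u_hat \<tau>) \<partial>lebesgue_on {a..b}) \<le> ennreal X"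
  shows "\<exists>s\<in>{a..b}. gevrey r (u_hat s) \<le> ennreal (X / (b - a) + 1)"
proof (rule ccontr)
  assume neg: "\<not> ?thesis"
  have n: "ennreal (X / (b - a) + 1) \<le> gevrey r (u_hat s)" if "s \<in> {a..b}" for s
    using neg that by (meson linear)
  have "ennreal X < ennreal ((X / (b - a) + 1) * (b - a))"
  proof (rule ennreal_lessI)
    have "(X / (b - a) + 1) * (b - a) = X + (b - a)"
      using ab by (simp add: distrib_right)
    then show "X < (X / (b - a) + 1) * (b - a)" "0 < (X / (b - a) + 1) * (b - a)"
      using ab X by linarith+
  qed
  also have "\<dots> = (\<integral>\<^sup>+\<tau>. ennreal (X / (b - a) + 1) \<partial>lebesgue_on {a..b})"
    using ab X by (simp add: emeasure_restrict_space emeasure_lborel_Icc_eq ennreal_mult)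
  also have "\<dots> \<le> (\<integral>\<^sup>+\<tau>. gevrey r (u_hat \<tau>) \<partial>lebesgue_on {a..b})"
    by (intro nn_integral_mono n) simp
  finally show False using i by simp
qed

lemma source_bound:
  assumes a: "0 < a" "a \<le> s" "s \<le> t" "t \<le> T" and \<rho>: "0 \<le> \<rho>" and D: "0 \<le> D" and \<Phi>: "0 \<le> \<Phi>"
    and h1: "\<And>\<tau>. \<tau> \<in> {0<..T} \<Longrightarrow> gevrey \<rho> (u_hat \<tau>) \<le> ennreal (D / \<tau> ^ p)"
    and h2: "\<And>\<tau>. \<tau> \<in> {0<..T} \<Longrightarrow> (\<integral>\<^sup>+x. gevrey (\<rho> + \<sigma>) (u_hat x) \<partial>lebesgue_on {\<tau>..T}) \<le> ennreal (D / \<tau> ^ p)"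
    and f: "(\<integral>\<^sup>+x. gevrey \<rho> (f_hat x) \<partial>I) \<le> ennreal \<Phi>"
  shows "(\<integral>\<^sup>+\<tau>. gevrey (\<rho> + \<sigma>) (u_hat \<tau>) \<partial>lebesgue_on {s..t}) \<le> ennreal (D / a ^ p)"
    and "(\<integral>\<^sup>+\<tau>. source \<rho> \<tau> \<partial>lebesgue_on {s..t})
      \<le> ennreal ((2 / \<mu>) * (enn2real (lattice_const \<sigma>) * (D / a ^ p)\<^sup>2 + \<Phi>))"
proof -
  let ?J = "lebesgue_on {s..t}" and ?A = "D / a ^ p"
  have A: "0 \<le> ?A" using a D by simp
  have sub: "{s..t} \<subseteq> {0..T}" using a by auto
  note [measurable] = measurable_subinterval[OF gevrey_u_hat_measurable sub] measurable_subinterval[OF gevrey_f_hat_measurable sub]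
  show i1: "(\<integral>\<^sup>+\<tau>. gevrey (\<rho> + \<sigma>) (u_hat \<tau>) \<partial>?J) \<le> ennreal ?A"
  proof -
    have "(\<integral>\<^sup>+\<tau>. gevrey (\<rho> + \<sigma>) (u_hat \<tau>) \<partial>?J) \<le> (\<integral>\<^sup>+\<tau>. gevrey (\<rho> + \<sigma>) (u_hat \<tau>) \<partial>lebesgue_on {a..T})"
      by (rule nn_integral_subinterval) (use a in auto)
    also have "\<dots> \<le> ennreal ?A" using a by (intro h2) auto
    finally show ?thesis .
  qed
  have "(\<integral>\<^sup>+\<tau>. source \<rho> \<tau> \<partial>?J)
     \<le> (\<integral>\<^sup>+\<tau>. ennreal (2 / \<mu>) * (lattice_const \<sigma> * (ennreal ?A * gevrey (\<rho> + \<sigma>) (u_hat \<tau>)) + gevrey \<rho> (f_hat \<tau>)) \<partial>?J)"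
  proof (intro nn_integral_mono mult_left_mono add_mono mult_right_mono order_refl)
    fix \<tau> assume "\<tau> \<in> space ?J"
    then have \<tau>: "s \<le> \<tau>" "\<tau> \<le> t" by auto
    have "gevrey \<rho> (u_hat \<tau>) \<le> ennreal (D / \<tau> ^ p)" using \<tau> a by (intro h1) auto
    also have "\<dots> \<le> ennreal ?A"
      using \<tau> a D by (intro ennreal_leI divide_left_mono power_mono mult_pos_pos zero_less_power) auto
    finally show "gevrey \<rho> (u_hat \<tau>) \<le> ennreal ?A" .
  qed auto
  also have "\<dots> = ennreal (2 / \<mu>) * (lattice_const \<sigma> * (ennreal ?A * (\<integral>\<^sup>+\<tau>. gevrey (\<rho> + \<sigma>) (u_hat \<tau>) \<partial>?J)) + (\<integral>\<^sup>+\<tau>. gevrey \<rho> (f_hat \<tau>) \<partial>?J))"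
    by (simp add: nn_integral_cmult nn_integral_add)
  also have "\<dots> \<le> ennreal (2 / \<mu>) * (lattice_const \<sigma> * (ennreal ?A * ennreal ?A) + ennreal \<Phi>)"
    by (intro mult_left_mono add_mono i1 order_trans[OF nn_integral_subinterval[OF sub] f]) auto
  also have "\<dots> = ennreal ((2 / \<mu>) * (enn2real (lattice_const \<sigma>) * (?A)\<^sup>2 + \<Phi>))"
  proof -
    have e: "ennreal a * (ennreal S * (ennreal b * ennreal b) + ennreal c) = ennreal (a * (S * b\<^sup>2 + c))"
      if "0 \<le> a" "0 \<le> S" "0 \<le> b" "0 \<le> c" for a S b c :: real
      using that by (simp add: ennreal_mult[symmetric] ennreal_plus[symmetric] power2_eq_square del: ennreal_plus)
    have "lattice_const \<sigma> = ennreal (enn2real (lattice_const \<sigma>))"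
      using lattice_const_finite[OF sigma] by simp
    then show ?thesis
      using e[of "2 / \<mu>" "enn2real (lattice_const \<sigma>)" ?A \<Phi>] mu A \<Phi> by simp
  qed
  finally show "(\<integral>\<^sup>+\<tau>. source \<rho> \<tau> \<partial>?J)
      \<le> ennreal ((2 / \<mu>) * (enn2real (lattice_const \<sigma>) * (?A)\<^sup>2 + \<Phi>))" .
qed

text \<open>
  With \<open>A = D / (t/2)\<^sup>p\<close> both hypotheses are bounded by \<open>A\<close> from time \<open>t/2\<close> on, so the source term in
  \<open>energy_step\<close> contributes \<open>O(A\<^sup>2)\<close>, while the initial value contributes \<open>O(A/t + 1)\<close>.  On \<open>(0,T]\<close> every
  smaller power of \<open>1/t\<close> is at most a constant multiple of \<open>t\<^bsup>-2p\<^esup>\<close>.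
\<close>

lemma step_bound:
  assumes \<rho>: "0 \<le> \<rho>" and D: "0 \<le> D" and \<Phi>: "0 \<le> \<Phi>" and p: "1 \<le> p"
    and h1: "\<And>\<tau>. \<tau> \<in> {0<..T} \<Longrightarrow> gevrey \<rho> (u_hat \<tau>) \<le> ennreal (D / \<tau> ^ p)"
    and h2: "\<And>\<tau>. \<tau> \<in> {0<..T} \<Longrightarrow> (\<integral>\<^sup>+x. gevrey (\<rho> + \<sigma>) (u_hat x) \<partial>lebesgue_on {\<tau>..T}) \<le> ennreal (D / \<tau> ^ p)"
    and f: "(\<integral>\<^sup>+x. gevrey \<rho> (f_hat x) \<partial>I) \<le> ennreal \<Phi>"
    and t: "t \<in> {0<..T}"
  defines "D1 \<equiv> 2 ^ (p + 1) * D * T ^ (p - 1) + T ^ (2 * p) + (2 / \<mu>) * (enn2real (lattice_const \<sigma>) * (4 ^ p * D\<^sup>2) + \<Phi> * T ^ (2 * p))"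
  shows "gevrey (\<rho> + \<sigma>) (u_hat t) \<le> ennreal (D1 / t ^ (2 * p))"
    and "(\<integral>\<^sup>+x. gevrey (\<rho> + \<sigma> + \<sigma>) (u_hat x) \<partial>lebesgue_on {t..T}) \<le> ennreal (2 * D1 / \<mu> / t ^ (2 * p))"
proof -
  have t0: "0 < t" "t \<le> T" using t by auto
  let ?a = "t / 2"
  define A where "A = D / ?a ^ p"
  have A: "0 \<le> A" using D t0 by (simp add: A_def)
  have A': "A = 2 ^ p * D / t ^ p" by (simp add: A_def power_divide)
  define S where "S = enn2real (lattice_const \<sigma>)"
  have S: "0 \<le> S" by (simp add: S_def)
  define Y where "Y = (2 / \<mu>) * (S * A\<^sup>2 + \<Phi>)"
  have Y0: "0 \<le> Y" using mu S \<Phi> by (simp add: Y_def)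
  have tT: "1 \<le> T ^ (2 * p) / t ^ (2 * p)"
    using t0 by (simp add: power_mono)
  have YD: "Y \<le> (2 / \<mu>) * (S * (4 ^ p * D\<^sup>2) + \<Phi> * T ^ (2 * p)) / t ^ (2 * p)"
  proof -
    have "A\<^sup>2 = 4 ^ p * D\<^sup>2 / t ^ (2 * p)"
      unfolding A' by (simp add: power_divide power_mult_distrib power_mult[symmetric] mult.commute[of p 2])
        (simp add: power_mult)
    moreover have "\<Phi> \<le> \<Phi> * T ^ (2 * p) / t ^ (2 * p)"
      using mult_left_mono[OF tT \<Phi>] by simp
    ultimately have "S * A\<^sup>2 + \<Phi> \<le> (S * (4 ^ p * D\<^sup>2) + \<Phi> * T ^ (2 * p)) / t ^ (2 * p)"
      by (simp add: add_divide_distrib)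
    then have "Y \<le> (2 / \<mu>) * ((S * (4 ^ p * D\<^sup>2) + \<Phi> * T ^ (2 * p)) / t ^ (2 * p))"
      unfolding Y_def using mu by (intro mult_left_mono) auto
    then show ?thesis by simp
  qed
  have "\<exists>s\<in>{?a..t}. gevrey (\<rho> + \<sigma>) (u_hat s) \<le> ennreal (A / (t - ?a) + 1)"
    by (rule small_value) (use t0 A source_bound(1)[OF _ _ _ _ \<rho> D \<Phi> h1 h2 f, of ?a ?a t] in \<open>auto simp: A_def\<close>)
  then obtain s where s: "?a \<le> s" "s \<le> t" and ps: "gevrey (\<rho> + \<sigma>) (u_hat s) \<le> ennreal (A / (t - ?a) + 1)"
    by auto
  have as: "0 < ?a" using t0 by simp
  have sb: "(\<integral>\<^sup>+\<tau>. gevrey (\<rho> + \<sigma>) (u_hat \<tau>) \<partial>lebesgue_on {c..d}) \<le> ennreal A"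
    "(\<integral>\<^sup>+\<tau>. source \<rho> \<tau> \<partial>lebesgue_on {c..d}) \<le> ennreal Y"
    if "?a \<le> c" "c \<le> d" "d \<le> T" for c d
    using source_bound[OF as that \<rho> D \<Phi> h1 h2 f] by (simp_all only: A_def S_def Y_def)
  have "gevrey (\<rho> + \<sigma>) (u_hat t) + ennreal \<mu> * (\<integral>\<^sup>+\<tau>. gevrey (\<rho> + \<sigma> + \<sigma>) (u_hat \<tau>) \<partial>lebesgue_on {s..t})
    \<le> gevrey (\<rho> + \<sigma>) (u_hat s) + (\<integral>\<^sup>+\<tau>. source \<rho> \<tau> \<partial>lebesgue_on {s..t})"
    by (rule energy_step) (use s t0 \<rho> sb(1)[of s t] in \<open>auto intro: order_le_less_trans[OF _ ennreal_less_top]\<close>)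
  also have "\<dots> \<le> ennreal (A / (t - ?a) + 1) + ennreal Y"
    by (intro add_mono ps sb(2)) (use s t0 in auto)
  also have "\<dots> = ennreal (A / (t - ?a) + 1 + Y)"
    using A Y0 t0 by (intro ennreal_plus[symmetric]) auto
  also have "\<dots> \<le> ennreal (D1 / t ^ (2 * p))"
  proof (rule ennreal_leI)
    have "A / (t - ?a) \<le> 2 ^ (p + 1) * D * T ^ (p - 1) / t ^ (2 * p)"
    proof -
      have "A / (t - ?a) = 2 ^ (p + 1) * D / t ^ (p + 1)"
        using t0 by (simp add: A' field_simps)
      also have "\<dots> = 2 ^ (p + 1) * D * t ^ (p - 1) / t ^ (2 * p)"
      proof -
        have "2 * p = (p + 1) + (p - 1)" using p by simp
        then have "t ^ (2 * p) = t ^ (p + 1) * t ^ (p - 1)" by (metis power_add)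
        then show ?thesis using t0 by simp
      qed
      also have "\<dots> \<le> 2 ^ (p + 1) * D * T ^ (p - 1) / t ^ (2 * p)"
        using t0 D by (intro divide_right_mono mult_left_mono power_mono) auto
      finally show ?thesis .
    qed
    then have "A / (t - ?a) + 1 + Y \<le> 2 ^ (p + 1) * D * T ^ (p - 1) / t ^ (2 * p) + T ^ (2 * p) / t ^ (2 * p)
       + (2 / \<mu>) * (S * (4 ^ p * D\<^sup>2) + \<Phi> * T ^ (2 * p)) / t ^ (2 * p)"
      using tT YD by linarith
    then show "A / (t - ?a) + 1 + Y \<le> D1 / t ^ (2 * p)"
      by (simp only: D1_def S_def add_divide_distrib)
  qed
  finally have fin: "gevrey (\<rho> + \<sigma>) (u_hat t) + ennreal \<mu> * (\<integral>\<^sup>+\<tau>. gevrey (\<rho> + \<sigma> + \<sigma>) (u_hat \<tau>) \<partial>lebesgue_on {s..t}) \<le> ennreal (D1 / t ^ (2 * p))" .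
  then show pt: "gevrey (\<rho> + \<sigma>) (u_hat t) \<le> ennreal (D1 / t ^ (2 * p))"
    by (rule order_trans[OF add_increasing2[OF zero_le order_refl]])
  have YD1: "Y \<le> D1 / t ^ (2 * p)"
  proof -
    have "(2 / \<mu>) * (S * (4 ^ p * D\<^sup>2) + \<Phi> * T ^ (2 * p)) / t ^ (2 * p) \<le> D1 / t ^ (2 * p)"
      using t0 D T by (intro divide_right_mono) (auto simp: D1_def S_def)
    then show ?thesis using YD by linarith
  qed
  have D10: "0 \<le> D1 / t ^ (2 * p)" using YD1 Y0 by linarith
  have "gevrey (\<rho> + \<sigma>) (u_hat T) + ennreal \<mu> * (\<integral>\<^sup>+\<tau>. gevrey (\<rho> + \<sigma> + \<sigma>) (u_hat \<tau>) \<partial>lebesgue_on {t..T})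
    \<le> gevrey (\<rho> + \<sigma>) (u_hat t) + (\<integral>\<^sup>+\<tau>. source \<rho> \<tau> \<partial>lebesgue_on {t..T})"
    by (rule energy_step) (use t0 \<rho> sb(1)[of t T] in \<open>auto intro: order_le_less_trans[OF _ ennreal_less_top]\<close>)
  also have "\<dots> \<le> ennreal (D1 / t ^ (2 * p)) + ennreal Y"
    by (intro add_mono pt sb(2)) (use t0 in auto)
  also have "\<dots> \<le> ennreal (D1 / t ^ (2 * p)) + ennreal (D1 / t ^ (2 * p))"
    by (intro add_mono order_refl ennreal_leI YD1)
  also have "\<dots> = ennreal (2 * D1 / t ^ (2 * p))"
    using D10 by (simp add: ennreal_plus[symmetric] del: ennreal_plus)
  finally have "ennreal \<mu> * (\<integral>\<^sup>+\<tau>. gevrey (\<rho> + \<sigma> + \<sigma>) (u_hat \<tau>) \<partial>lebesgue_on {t..T}) \<le> ennreal (2 * D1 / t ^ (2 * p))"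
    by (rule order_trans[OF add_increasing[OF zero_le order_refl]])
  moreover have "0 \<le> 2 * D1 / t ^ (2 * p)" using D10 by simp
  ultimately have "(\<integral>\<^sup>+x. gevrey (\<rho> + \<sigma> + \<sigma>) (u_hat x) \<partial>lebesgue_on {t..T}) \<le> ennreal (2 * D1 / t ^ (2 * p) / \<mu>)"
    by (rule ennreal_mult_le_cancel[OF mu])
  moreover have "2 * D1 / t ^ (2 * p) / \<mu> = 2 * D1 / \<mu> / t ^ (2 * p)"
    by (simp only: divide_divide_eq_left mult.commute)
  ultimately show "(\<integral>\<^sup>+x. gevrey (\<rho> + \<sigma> + \<sigma>) (u_hat x) \<partial>lebesgue_on {t..T}) \<le> ennreal (2 * D1 / \<mu> / t ^ (2 * p))"
    by (simp only:)
qed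

lemma base_bound:
  assumes f: "(\<integral>\<^sup>+x. gevrey 0 (f_hat x) \<partial>I) \<le> ennreal \<Phi>" and \<Phi>: "0 \<le> \<Phi>" and t: "t \<in> {0<..T}"
  defines "R \<equiv> (L2_norm u0)\<^sup>2 / volume + \<Phi> / \<mu>"
  shows "gevrey 0 (u_hat t) \<le> ennreal R" "(\<integral>\<^sup>+x. gevrey \<sigma> (u_hat x) \<partial>lebesgue_on {t..T}) \<le> ennreal (R / \<mu>)"
proof -
  have R: "0 \<le> R" using \<Phi> mu by (simp add: R_def)
  have "fourier_coeff (u 0) = fourier_coeff u0"
  proof (rule fourier_coeff_cong_AE)
    have "AE x in lebesgue. u 0 x = u0 x" using sol by (simp add: weak_solution_def)
    then show "AE x in torus. u 0 x = u0 x"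
      by (auto simp: AE_restrict_space_iff elim!: eventually_mono)
  qed (use u0 u_H[of 0] T in \<open>auto intro: L2_per_measurable H_L2_per\<close>)
  then have p0: "gevrey 0 (u_hat 0) \<le> ennreal ((L2_norm u0)\<^sup>2 / volume)"
    using gevrey_0_le_L2_norm[OF H_L2_per[OF u0]] by (simp only: u_hat_def)
  have main: "gevrey 0 (u_hat r) + ennreal \<mu> * (\<integral>\<^sup>+\<tau>. gevrey \<sigma> (u_hat \<tau>) \<partial>lebesgue_on {0..r}) \<le> ennreal R" if r: "0 \<le> r" "r \<le> T" for r
  proof -
    have sub: "{0..r} \<subseteq> {0..T}" using r by auto
    have "(\<integral>\<^sup>+\<tau>. ennreal (1 / \<mu>) * gevrey 0 (f_hat \<tau>) \<partial>lebesgue_on {0..r}) = ennreal (1 / \<mu>) * (\<integral>\<^sup>+\<tau>. gevrey 0 (f_hat \<tau>) \<partial>lebesgue_on {0..r})"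
      by (rule nn_integral_cmult[OF measurable_subinterval[OF gevrey_f_hat_measurable sub]])
    also have "\<dots> \<le> ennreal (1 / \<mu>) * ennreal \<Phi>"
      by (intro mult_left_mono order_trans[OF nn_integral_subinterval[OF sub] f]) auto
    also have "\<dots> = ennreal (\<Phi> / \<mu>)"
      using mu \<Phi> by (simp add: ennreal_mult[symmetric])
    finally have "gevrey 0 (u_hat 0) + (\<integral>\<^sup>+\<tau>. ennreal (1 / \<mu>) * gevrey 0 (f_hat \<tau>) \<partial>lebesgue_on {0..r}) \<le> ennreal ((L2_norm u0)\<^sup>2 / volume) + ennreal (\<Phi> / \<mu>)"
      by (intro add_mono p0)
    also have "\<dots> = ennreal R"
      unfolding R_def using mu \<Phi> by (intro ennreal_plus[symmetric]) auto
    finally show ?thesis using base_inequality[OF r] by (rule order_trans[rotated])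
  qed
  show "gevrey 0 (u_hat t) \<le> ennreal R"
    by (rule order_trans[OF add_increasing2[OF zero_le order_refl] main]) (use t in auto)
  have "ennreal \<mu> * (\<integral>\<^sup>+\<tau>. gevrey \<sigma> (u_hat \<tau>) \<partial>lebesgue_on {0..T}) \<le> ennreal R"
    by (rule order_trans[OF add_increasing[OF zero_le order_refl] main]) (use T in auto)
  from ennreal_mult_le_cancel[OF mu this R]
  have le: "(\<integral>\<^sup>+\<tau>. gevrey \<sigma> (u_hat \<tau>) \<partial>lebesgue_on {0..T}) \<le> ennreal (R / \<mu>)" .
  show "(\<integral>\<^sup>+x. gevrey \<sigma> (u_hat x) \<partial>lebesgue_on {t..T}) \<le> ennreal (R / \<mu>)"
    by (rule order_trans[OF nn_integral_subinterval le]) (use t in auto)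
qed

end

text \<open>
  At \<open>n = 0\<close> the truncated subtraction makes the force enter through \<open>\<phi>\<^sub>0\<close>, the same level as at \<open>n = 1\<close>.
\<close>

definition smoothing_bound :: "nat \<Rightarrow> nat \<Rightarrow> real \<Rightarrow> real \<Rightarrow> real \<Rightarrow> real \<Rightarrow> real \<Rightarrow> real \<Rightarrow> bool" where
  "smoothing_bound n p \<mu> \<sigma> T U \<Phi> D \<longleftrightarrow> (\<forall>u0 f u. ns_solution \<mu> \<sigma> T u0 f u \<longrightarrow> L2_norm u0 = U \<longrightarrow>
      (\<integral>\<^sup>+s. gevrey (real (n - 1) * \<sigma>) (fourier_coeff (f s)) \<partial>lebesgue_on {0..T}) \<le> ennreal \<Phi> \<longrightarrow>
      (\<forall>t\<in>{0<..T}. gevrey (real n * \<sigma>) (fourier_coeff (u t)) \<le> ennreal (D / t ^ p) \<and>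
        (\<integral>\<^sup>+s. gevrey ((real n + 1) * \<sigma>) (fourier_coeff (u s)) \<partial>lebesgue_on {t..T}) \<le> ennreal (D / t ^ p)))"

text \<open>
  Each level doubles the power, and its constant is computed from the constant of the level below, hence from the
  same data.
\<close>

theorem gevrey_bounds:
  "\<exists>p\<ge>1. \<forall>\<mu> \<sigma> T U \<Phi>. 0 < \<mu> \<longrightarrow> 0 < \<sigma> \<longrightarrow> 0 < T \<longrightarrow> 0 \<le> \<Phi> \<longrightarrow> (\<exists>D\<ge>0. smoothing_bound n p \<mu> \<sigma> T U \<Phi> D)"
proof (induction n)
  case 0
  show ?case
  proof (intro exI[of _ "1::nat"] conjI allI impI)
    fix \<mu> \<sigma> T U \<Phi> :: real
    assume pos: "0 < \<mu>" "0 < \<sigma>" "0 < T" "0 \<le> \<Phi>"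
    define R where "R = U\<^sup>2 / volume + \<Phi> / \<mu>"
    \<comment> \<open>The factor \<open>T\<close> turns a constant into a bound by \<open>1/t\<close> on \<open>(0,T]\<close>.\<close>
    define D where "D = max R (R / \<mu>) * T"
    have R: "0 \<le> R" using pos by (simp add: R_def)
    have D: "0 \<le> D" using R pos by (simp add: D_def le_max_iff_disj)
    have le: "R \<le> D / t ^ 1" "R / \<mu> \<le> D / t ^ 1" if t: "t \<in> {0<..T}" for t
    proof -
      have "max R (R / \<mu>) * 1 \<le> max R (R / \<mu>) * (T / t)"
        using t R by (intro mult_left_mono) (auto simp: le_max_iff_disj)
      then have "max R (R / \<mu>) \<le> D / t ^ 1" by (simp add: D_def)
      then show "R \<le> D / t ^ 1" "R / \<mu> \<le> D / t ^ 1" by linarith+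
    qed
    show "\<exists>D\<ge>0. smoothing_bound 0 1 \<mu> \<sigma> T U \<Phi> D"
      unfolding smoothing_bound_def
    proof (intro exI[of _ D] conjI D allI impI ballI)
      fix u0 f u t
      assume ns: "ns_solution \<mu> \<sigma> T u0 f u" and U: "L2_norm u0 = U"
        and f: "(\<integral>\<^sup>+s. gevrey (real (0 - 1) * \<sigma>) (fourier_coeff (f s)) \<partial>lebesgue_on {0..T}) \<le> ennreal \<Phi>"
        and t: "t \<in> {0<..T}"
      interpret ns_solution \<mu> \<sigma> T u0 f u by (rule ns)
      have f0: "(\<integral>\<^sup>+s. gevrey 0 (f_hat s) \<partial>I) \<le> ennreal \<Phi>"
        using f by (simp add: f_hat_def)
      note b = base_bound[OF f0 pos(4) t, unfolded U, folded R_def]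
      show "gevrey (real 0 * \<sigma>) (fourier_coeff (u t)) \<le> ennreal (D / t ^ 1)"
        using order_trans[OF b(1) ennreal_leI[OF le(1)[OF t]]] by (simp add: u_hat_def)
      show "(\<integral>\<^sup>+s. gevrey ((real 0 + 1) * \<sigma>) (fourier_coeff (u s)) \<partial>lebesgue_on {t..T}) \<le> ennreal (D / t ^ 1)"
        using order_trans[OF b(2) ennreal_leI[OF le(2)[OF t]]] by (simp add: u_hat_def)
    qed
  qed simp
next
  case (Suc n)
  then obtain p where p: "1 \<le> p" and IH: "\<And>\<mu> \<sigma> T U \<Phi> :: real. 0 < \<mu> \<Longrightarrow> 0 < \<sigma> \<Longrightarrow> 0 < T \<Longrightarrow> 0 \<le> \<Phi> \<Longrightarrow>
    \<exists>D\<ge>0. smoothing_bound n p \<mu> \<sigma> T U \<Phi> D"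
    by blast
  show ?case
  proof (intro exI[of _ "2 * p"] conjI allI impI)
    fix \<mu> \<sigma> T U \<Phi> :: real
    assume pos: "0 < \<mu>" "0 < \<sigma>" "0 < T" "0 \<le> \<Phi>"
    obtain D where D: "0 \<le> D" and B: "\<And>u0 f u t. ns_solution \<mu> \<sigma> T u0 f u \<Longrightarrow> L2_norm u0 = U \<Longrightarrow>
      (\<integral>\<^sup>+s. gevrey (real (n - 1) * \<sigma>) (fourier_coeff (f s)) \<partial>lebesgue_on {0..T}) \<le> ennreal \<Phi> \<Longrightarrow> t \<in> {0<..T} \<Longrightarrow>
      gevrey (real n * \<sigma>) (fourier_coeff (u t)) \<le> ennreal (D / t ^ p) \<and>
        (\<integral>\<^sup>+s. gevrey ((real n + 1) * \<sigma>) (fourier_coeff (u s)) \<partial>lebesgue_on {t..T}) \<le> ennreal (D / t ^ p)"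
      using IH[OF pos, of U] unfolding smoothing_bound_def by blast
    define D1 where "D1 = 2 ^ (p + 1) * D * T ^ (p - 1) + T ^ (2 * p) + (2 / \<mu>) * (enn2real (lattice_const \<sigma>) * (4 ^ p * D\<^sup>2) + \<Phi> * T ^ (2 * p))"
    have D1: "0 \<le> D1" using pos D by (auto simp: D1_def intro!: add_nonneg_nonneg mult_nonneg_nonneg)
    define D' where "D' = max D1 (2 * D1 / \<mu>)"
    have D': "0 \<le> D'" using D1 by (simp add: D'_def le_max_iff_disj)
    show "\<exists>D\<ge>0. smoothing_bound (Suc n) (2 * p) \<mu> \<sigma> T U \<Phi> D"
      unfolding smoothing_bound_def
    proof (intro exI[of _ D'] conjI D' allI impI ballI)
      fix u0 f u t
      assume ns: "ns_solution \<mu> \<sigma> T u0 f u" and U: "L2_norm u0 = U"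
        and f: "(\<integral>\<^sup>+s. gevrey (real (Suc n - 1) * \<sigma>) (fourier_coeff (f s)) \<partial>lebesgue_on {0..T}) \<le> ennreal \<Phi>"
        and t: "t \<in> {0<..T}"
      interpret ns_solution \<mu> \<sigma> T u0 f u by (rule ns)
      have f1: "(\<integral>\<^sup>+s. gevrey (real n * \<sigma>) (f_hat s) \<partial>I) \<le> ennreal \<Phi>"
        using f by (simp add: f_hat_def)
      have f0: "(\<integral>\<^sup>+s. gevrey (real (n - 1) * \<sigma>) (fourier_coeff (f s)) \<partial>lebesgue_on {0..T}) \<le> ennreal \<Phi>"
        using sigma by (intro order_trans[OF nn_integral_mono f1]) (auto simp: f_hat_def intro!: gevrey_mono mult_right_mono)
      have h1: "gevrey (real n * \<sigma>) (u_hat \<tau>) \<le> ennreal (D / \<tau> ^ p)"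
        and h2: "(\<integral>\<^sup>+x. gevrey (real n * \<sigma> + \<sigma>) (u_hat x) \<partial>lebesgue_on {\<tau>..T}) \<le> ennreal (D / \<tau> ^ p)" if "\<tau> \<in> {0<..T}" for \<tau>
        using B[OF ns U f0 that] by (auto simp: u_hat_def distrib_right)
      have n0: "0 \<le> real n * \<sigma>" using sigma by simp
      note sb = step_bound[OF n0 D pos(4) p h1 h2 f1 t, folded D1_def]
      have le: "D1 / t ^ (2 * p) \<le> D' / t ^ (2 * p)" "2 * D1 / \<mu> / t ^ (2 * p) \<le> D' / t ^ (2 * p)"
      proof -
        have "D1 \<le> D'" "2 * D1 / \<mu> \<le> D'" by (simp_all add: D'_def)
        then show "D1 / t ^ (2 * p) \<le> D' / t ^ (2 * p)" "2 * D1 / \<mu> / t ^ (2 * p) \<le> D' / t ^ (2 * p)"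
          using t by (auto intro: divide_right_mono simp del: divide_divide_eq_left)
      qed
      have r: "real (Suc n) * \<sigma> = real n * \<sigma> + \<sigma>" "(real (Suc n) + 1) * \<sigma> = real n * \<sigma> + \<sigma> + \<sigma>"
        by (simp_all add: algebra_simps)
      show "gevrey (real (Suc n) * \<sigma>) (fourier_coeff (u t)) \<le> ennreal (D' / t ^ (2 * p))"
        using order_trans[OF sb(1) ennreal_leI[OF le(1)]] unfolding r u_hat_def .
      show "(\<integral>\<^sup>+s. gevrey ((real (Suc n) + 1) * \<sigma>) (fourier_coeff (u s)) \<partial>lebesgue_on {t..T}) \<le> ennreal (D' / t ^ (2 * p))"
        using order_trans[OF sb(2) ennreal_leI[OF le(2)]] unfolding r u_hat_def .
    qed
  qed (use p in simp)
qed

context ns_solution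
begin

text \<open>
  The forcing is Gevrey of every order, so each level of \<open>gevrey_bounds\<close> is available for this solution, with
  some constant.
\<close>

lemma gevrey_all_finite:
  assumes t: "t \<in> {0<..T}"
  shows "gevrey r (u_hat t) < top"
proof -
  obtain n :: nat where n: "r / \<sigma> \<le> real n"
    using real_arch_simple by blast
  then have "r \<le> real n * \<sigma>" using sigma by (simp add: field_simps)
  define \<Phi> where "\<Phi> = (LINT s|I. (L2_norm (expA (real (n - 1) * \<sigma>) (f s)))\<^sup>2) / volume"
  have \<Phi>: "0 \<le> \<Phi>" by (simp add: \<Phi>_def)
  have f: "(\<integral>\<^sup>+s. gevrey (real (n - 1) * \<sigma>) (fourier_coeff (f s)) \<partial>lebesgue_on {0..T}) \<le> ennreal \<Phi>"
    using nn_integral_gevrey_f_hat[of "real (n - 1)"] by (simp add: \<Phi>_def f_hat_def)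
  obtain p D where "smoothing_bound n p \<mu> \<sigma> T (L2_norm u0) \<Phi> D"
    using gevrey_bounds[of n] mu sigma T \<Phi> by meson
  then have "gevrey (real n * \<sigma>) (fourier_coeff (u t)) \<le> ennreal (D / t ^ p)"
    unfolding smoothing_bound_def using f ns_solution_axioms t by blast
  then have "gevrey (real n * \<sigma>) (u_hat t) < top"
    unfolding u_hat_def by (rule order_le_less_trans) simp
  then show ?thesis
    using gevrey_mono[OF \<open>r \<le> real n * \<sigma>\<close>] by (rule order_le_less_trans[rotated])
qed

lemma dom_all:
  assumes t: "t \<in> {0<..T}"
  shows "u t \<in> dom_expA r" "ennreal ((L2_norm (expA r (u t)))\<^sup>2) = ennreal volume * gevrey r (u_hat t)"
proof -
  have uH: "u t \<in> H" using t by (intro u_H) auto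
  have f: "gevrey (r + 1) (fourier_coeff (u t)) < top" using gevrey_all_finite[OF t] by (simp add: u_hat_def)
  have r: "r < r + 1" by simp
  show "u t \<in> dom_expA r" by (rule expA_of_gevrey(1)[OF uH f r])
  show "ennreal ((L2_norm (expA r (u t)))\<^sup>2) = ennreal volume * gevrey r (u_hat t)"
    unfolding u_hat_def by (rule expA_norm[OF uH f r])
qed

lemma entire_all: "t \<in> {0<..T} \<Longrightarrow> entire_field (u t)"
proof (rule entire_field_of_decays)
  assume t: "t \<in> {0<..T}"
  then show "u t \<in> L2_per" by (intro H_L2_per u_H) auto
  show "decays R (fourier_coeff (u t))" for R
    by (rule decays_of_gevrey[OF gevrey_all_finite[OF t, of "R + 1", unfolded u_hat_def]]) simp
qed

text \<open>
  Weak measurability in time: the pairing is a series of continuous functions of time.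
\<close>

lemma expA_time:
  assumes t: "t \<in> {0<..T}" and X: "0 \<le> X" and i: "(\<integral>\<^sup>+s. gevrey r (u_hat s) \<partial>lebesgue_on {t..T}) \<le> ennreal X"
  shows "expA_L2_time {t..T} r u" "(LINT s|lebesgue_on {t..T}. (L2_norm (expA r (u s)))\<^sup>2) \<le> volume * X"
proof -
  let ?J = "lebesgue_on {t..T}"
  have sub: "{t..T} \<subseteq> {0..T}" and sub': "s \<in> {0<..T}" if "s \<in> {t..T}" for s
    using t that by auto
  have subset: "{t..T} \<subseteq> {0..T}" using t by auto
  have r: "r < r + 1" by simp
  have dom: "u s \<in> dom_expA r" if "s \<in> {t..T}" for s
    by (rule dom_all[OF sub'[OF that]])
  have meas: "(\<lambda>s. L2_inner (expA r (u s)) v) \<in> borel_measurable ?J" if v: "v \<in> H" for v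
  proof -
    let ?h = "\<lambda>s. volume * (\<Sum>n. exp (r * wn (enum_modes n)) * (fourier_coeff v (enum_modes n) \<bullet> u_hat s (enum_modes n)))"
    have "(\<lambda>s. e \<bullet> u_hat s k) \<in> borel_measurable ?J" for e :: "complex^3" and k
      by (intro borel_measurable_integrable continuous_imp_integrable_real continuous_on_subset[OF u_hat_continuous subset])
    then have "?h \<in> borel_measurable ?J"
      by measurable
    moreover have "L2_inner (expA r (u s)) v = ?h s" if s: "s \<in> {t..T}" for s
    proof -
      have uH: "u s \<in> H" using sub[OF s] s by (intro u_H) auto
      have f: "gevrey (r + 1) (fourier_coeff (u s)) < top" using gevrey_all_finite[OF sub'[OF s]] by (simp add: u_hat_def)
      note E = expA_inner[OF uH f r H_L2_per[OF v]]
      show ?thesis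
        using E(1) enum_modes_sums[OF E(2)] by (simp add: sums_iff u_hat_def inner_commute)
    qed
    ultimately show ?thesis
      by (subst measurable_cong[where g = ?h]) auto
  qed
  have eq: "(L2_norm (expA r (u s)))\<^sup>2 = volume * enn2real (gevrey r (u_hat s))" if s: "s \<in> {t..T}" for s
  proof -
    have "(L2_norm (expA r (u s)))\<^sup>2 = enn2real (ennreal volume * gevrey r (u_hat s))"
      using dom_all(2)[OF sub'[OF s], of r] by (metis enn2real_ennreal zero_le_power2)
    then show ?thesis by (simp add: enn2real_mult)
  qed
  have int: "integrable ?J (\<lambda>s. enn2real (gevrey r (u_hat s)))" and le: "(LINT s|?J. enn2real (gevrey r (u_hat s))) \<le> X"
  proof -
    have m: "(\<lambda>s. enn2real (gevrey r (u_hat s))) \<in> borel_measurable ?J"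
      using measurable_subinterval[OF gevrey_u_hat_measurable subset] by measurable
    have n: "(\<integral>\<^sup>+s. ennreal (enn2real (gevrey r (u_hat s))) \<partial>?J) \<le> ennreal X"
      by (rule order_trans[OF nn_integral_mono i]) (simp add: ennreal_enn2real_if)
    then have "(\<integral>\<^sup>+s. ennreal (enn2real (gevrey r (u_hat s))) \<partial>?J) < \<infinity>"
      by (auto intro: order_le_less_trans)
    then show int: "integrable ?J (\<lambda>s. enn2real (gevrey r (u_hat s)))"
      by (intro integrableI_bounded m) simp
    have "ennreal (LINT s|?J. enn2real (gevrey r (u_hat s))) \<le> ennreal X"
      using n nn_integral_eq_integral[OF int] by simp
    then show "(LINT s|?J. enn2real (gevrey r (u_hat s))) \<le> X"
      using X by (simp add: ennreal_le_iff)
  qed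
  have cong: "(LINT s|?J. (L2_norm (expA r (u s)))\<^sup>2) = (LINT s|?J. volume * enn2real (gevrey r (u_hat s)))"
    by (rule Bochner_Integration.integral_cong) (auto simp: eq)
  show "(LINT s|?J. (L2_norm (expA r (u s)))\<^sup>2) \<le> volume * X"
    unfolding cong integral_mult_right_zero by (intro mult_left_mono le) simp
  have "integrable ?J (\<lambda>s. (L2_norm (expA r (u s)))\<^sup>2)"
    by (subst Bochner_Integration.integrable_cong[OF refl, where g = "\<lambda>s. volume * enn2real (gevrey r (u_hat s))"])
      (use int in \<open>auto simp: eq\<close>)
  then show "expA_L2_time {t..T} r u"
    unfolding expA_L2_time_def L2_time_def using dom meas by (auto intro!: AE_I2 expA_H)
qed

end

section \<open>Entire solutions and bounds by powers of time\<close>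

theorem corollary2p1:
  shows
    "(\<forall>\<mu> > 0. \<forall>\<sigma> > 0. \<forall>T > 0. \<forall>u0 f u.
        u0 \<in> H \<longrightarrow> entire_forcing \<sigma> T f \<longrightarrow> weak_solution \<mu> \<sigma> T u0 f u \<longrightarrow>
        (\<forall>t\<in>{0<..T}. entire_field (u t)))
     \<and>
     (\<forall>n::nat. n \<ge> 1 \<longrightarrow>
        (\<exists>p::nat. \<exists>q::nat. p \<ge> 1 \<and> q \<ge> 1 \<and>
          (\<forall>\<mu> > 0. \<forall>\<sigma> > 0. \<forall>T > 0. \<forall>U \<Phi> :: real.
            \<exists>C Cbar K Kbar :: real. \<forall>u0 f u.
              u0 \<in> H \<longrightarrow> entire_forcing \<sigma> T f \<longrightarrow> weak_solution \<mu> \<sigma> T u0 f u \<longrightarrow>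
              L2_norm u0 = U \<longrightarrow>
              (LINT s|lebesgue_on {0..T}. (L2_norm (expA ((real n - 1) * \<sigma>) (f s)))\<^sup>2) = \<Phi> \<longrightarrow>
              (\<forall>t\<in>{0<..T}.
                 u t \<in> dom_expA (real n * \<sigma>) \<and>
                 (L2_norm (expA (real n * \<sigma>) (u t)))\<^sup>2 \<le> K / t ^ p + C \<and>
                 expA_L2_time {t..T} ((real n + 1) * \<sigma>) u \<and>
                 (LINT s|lebesgue_on {t..T}. (L2_norm (expA ((real n + 1) * \<sigma>) (u s)))\<^sup>2)
                   \<le> Kbar / t ^ q + Cbar))))"
proof (intro conjI allI impI ballI, goal_cases)
  case (1 \<mu> \<sigma> T u0 f u t)
  then interpret ns_solution \<mu> \<sigma> T u0 f u by unfold_locales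
  show ?case by (rule entire_all) (use 1 in simp)
next
  case (2 n)
  then have n: "1 \<le> n" .
  obtain p where p: "1 \<le> p" and bounds: "\<And>\<mu> \<sigma> T U \<Phi> :: real. 0 < \<mu> \<Longrightarrow> 0 < \<sigma> \<Longrightarrow> 0 < T \<Longrightarrow> 0 \<le> \<Phi> \<Longrightarrow>
    \<exists>D\<ge>0. smoothing_bound n p \<mu> \<sigma> T U \<Phi> D"
    using gevrey_bounds[of n] by blast
  show ?case
  proof (rule exI[of _ p], rule exI[of _ p], intro conjI p allI impI, goal_cases)
    case (1 \<mu> \<sigma> T U \<Phi>)
    note pos = 1
    \<comment> \<open>A negative \<open>\<Phi>\<close> is the value of no such integral, so it may be replaced by 0.\<close>
    have F: "0 \<le> max 0 \<Phi> / volume" by simp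
    obtain D where D: "0 \<le> D" and b: "\<And>u0 f u t. ns_solution \<mu> \<sigma> T u0 f u \<Longrightarrow> L2_norm u0 = U \<Longrightarrow>
      (\<integral>\<^sup>+s. gevrey (real (n - 1) * \<sigma>) (fourier_coeff (f s)) \<partial>lebesgue_on {0..T}) \<le> ennreal (max 0 \<Phi> / volume) \<Longrightarrow> t \<in> {0<..T} \<Longrightarrow>
      gevrey (real n * \<sigma>) (fourier_coeff (u t)) \<le> ennreal (D / t ^ p) \<and>
        (\<integral>\<^sup>+s. gevrey ((real n + 1) * \<sigma>) (fourier_coeff (u s)) \<partial>lebesgue_on {t..T}) \<le> ennreal (D / t ^ p)"
      using bounds[OF pos F, of U] unfolding smoothing_bound_def by blast
    show ?case
    proof (rule exI[of _ 0], rule exI[of _ 0], rule exI[of _ "volume * D"], rule exI[of _ "volume * D"], intro allI impI ballI, goal_cases)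
      case (1 u0 f u t)
      then have h: "u0 \<in> H" "entire_forcing \<sigma> T f" "weak_solution \<mu> \<sigma> T u0 f u" and U: "L2_norm u0 = U"
        and \<Phi>: "(LINT s|lebesgue_on {0..T}. (L2_norm (expA ((real n - 1) * \<sigma>) (f s)))\<^sup>2) = \<Phi>"
        and t: "t \<in> {0<..T}"
        by auto
      interpret ns_solution \<mu> \<sigma> T u0 f u using pos h by unfold_locales
      have rn: "real (n - 1) = real n - 1" using n by simp
      have \<Phi>0: "0 \<le> \<Phi>" unfolding \<Phi>[symmetric] by simp
      have "(\<integral>\<^sup>+s. gevrey (real (n - 1) * \<sigma>) (fourier_coeff (f s)) \<partial>lebesgue_on {0..T}) \<le> ennreal (max 0 \<Phi> / volume)"
        using nn_integral_gevrey_f_hat[of "real (n - 1)"] \<Phi> \<Phi>0 unfolding rn f_hat_def by (simp only: max_absorb2) (use n in simp)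
      from b[OF ns_solution_axioms U this t]
      have b1: "gevrey (real n * \<sigma>) (u_hat t) \<le> ennreal (D / t ^ p)"
        and b2: "(\<integral>\<^sup>+s. gevrey ((real n + 1) * \<sigma>) (u_hat s) \<partial>lebesgue_on {t..T}) \<le> ennreal (D / t ^ p)"
        by (simp_all only: u_hat_def)
      have Dt: "0 \<le> D / t ^ p" using D t by simp
      have "ennreal ((L2_norm (expA (real n * \<sigma>) (u t)))\<^sup>2) \<le> ennreal volume * ennreal (D / t ^ p)"
        unfolding dom_all(2)[OF t] by (intro mult_left_mono b1) simp
      also have "\<dots> = ennreal (volume * (D / t ^ p))"
        using Dt by (intro ennreal_mult[symmetric]) auto
      finally have "(L2_norm (expA (real n * \<sigma>) (u t)))\<^sup>2 \<le> volume * (D / t ^ p)"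
        using mult_nonneg_nonneg[OF volume_pos(3) Dt] by (subst (asm) ennreal_le_iff)
      then show ?case
        using dom_all(1)[OF t] expA_time[OF t Dt b2] by simp
    qed
  qed
qed

end
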